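(* Let $x\in\mathcal{D}^\epsilon_0=\{(\tau_1,\tau_2,\epsilon)\in\mathcal{D}^\epsilon\mid\epsilon=0\}$. Then there exists a $G$-invariant neighborhood $\mathcal{N}^\epsilon_x\subseteq\mathcal{D}^\epsilon$ of $x$ throughout which the map $F^\epsilon:\mathcal{D}^\epsilon\to\mathbb{H}_2$, $(\tau_1,\tau_2,\epsilon)\mapsto\Omega^{(2)}(\tau_1,\tau_2,\epsilon)$, is invertible (as a map onto its image).
   Context: $\mathbb{H}_1$ is the upper half-plane, $\mathbb{H}_2$ the genus 2 Siegel upper half-space. $\Lambda_\tau$ is the lattice with basis $(2\pi i\tau,2\pi i)$, $D(\Lambda)=\min_{0\ne\lambda\in\Lambda}|\lambda|$, and $\mathcal{D}^\epsilon=\{(\tau_1,\tau_2,\epsilon)\in\mathbb{H}_1\times\mathbb{H}_1\times\mathbb{C}\mid|\epsilon|<\frac14D(\Lambda_{\tau_1})D(\Lambda_{\tau_2})\}$. The holomorphic map $F^\epsilon$: $\Omega^{(2)}(\tau_1,\tau_2,\epsilon)$ is the period matrix of the genus two surface obtained from the tori $\mathcal{S}_a=\mathbb{C}/\Lambda_{\tau_a}$ (coordinate $z_a$ at the origin, $r_a<\frac12D(\Lambda_{\tau_a})$, $|\epsilon|\le r_1r_2$) by excising $|z_a|\le|\epsilon|/r_{\bar a}$ ($\bar1=2,\bar2=1$) and identifying the annuli $|\epsilon|/r_{\bar a}\le|z_a|\le r_a$ via $z_1z_2=\epsilon$, with homology basis inherited from the tori ($a_a$, $b_a$ having periods $2\pi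 i$, $2\pi i\tau_a$), $\Omega^{(2)}_{ij}=\frac1{2\pi i}\oint_{b_i}\nu_j$, $\oint_{a_i}\nu_j=2\pi i\delta_{ij}$. Explicitly, $$2\pi i\Omega_{11}^{(2)}=2\pi i\tau_1+\epsilon(A_2(I-A_1A_2)^{-1})(1,1),\quad2\pi i\Omega_{22}^{(2)}=2\pi i\tau_2+\epsilon(A_1(I-A_2A_1)^{-1})(1,1),\quad2\pi i\Omega_{12}^{(2)}=-\epsilon(I-A_1A_2)^{-1}(1,1),$$ where $A_a$ is the infinite matrix $A_a(k,l)=\frac{\epsilon^{(k+l)/2}}{\sqrt{kl}}(-1)^{k+1}\frac{(k+l-1)!}{(k-1)!(l-1)!}E_{k+l}(\tau_a)$, $k,l\ge1$, with $E_k=0$ for $k$ odd and $E_k(\tau)=-\frac{B_k}{k!}+\frac{2}{(k-1)!}\sum_{n\ge1}\sigma_{k-1}(n)e^{2\pi in\tau}$ for $k$ even, inverses being given by geometric series. In particular $F^\epsilon(\tau_1,\tau_2,0)=\mathrm{diag}(\tau_1,\tau_2)$. The group $G\cong(SL(2,\mathbb{Z})\times SL(2,\mathbb{Z}))\rtimes\mathbb{Z}_2$ (the involution $\beta$ generating $\mathbb{Z}_2$ interchanges the two factors) acts on $\mathcal{D}^\epsilon$ on the left by $$\gamma_1.(\tau_1,\tau_2,\epsilon)=\Big(\gamma_1\tau_1,\tau_2,\frac{\epsilon}{c_1\tau_1+d_1}\Big),\quad\gamma_2.(\tau_1,\tau_2,\epsilon)=\Big(\tau_1,\gamma_2\tau_2,\frac{\epsilon}{c_2\tau_2+d_2}\Big),\quad\beta.(\tau_1,\tau_2,\epsilon)=(\tau_2,\tau_1,\epsilon),$$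 where $\gamma_i=\begin{pmatrix}a_i&b_i\\c_i&d_i\end{pmatrix}\in SL(2,\mathbb{Z})$ lies in the $i$-th factor and $\gamma_i\tau_i=\frac{a_i\tau_i+b_i}{c_i\tau_i+d_i}$. *)

theory Defs
  imports "HOL-Analysis.Analysis" "HOL-Computational_Algebra.Formal_Power_Series"
begin

definition upper_half_plane :: "complex set" where
  "upper_half_plane = {\<tau>. Im \<tau> > 0}"

definition siegel_upper_half_space_2 :: "(complex^2^2) set" where
  "siegel_upper_half_space_2 =
     {\<Omega>. transpose \<Omega> = \<Omega> \<and>
        (\<forall>v :: real^2. v \<noteq> 0 \<longrightarrow> 0 < v \<bullet> ((\<chi> i j. Im (\<Omega> $ i $ j)) *v v))}"

definition period_lattice :: "complex \<Rightarrow> complex set" where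
  "period_lattice \<tau> =
     {of_int m * (2 * of_real pi * \<i> * \<tau>) + of_int n * (2 * of_real pi * \<i>) | m n :: int. True}"

(* For \<tau> in the upper half-plane the lattice is discrete, so this infimum is the minimum. *)
definition lattice_min :: "complex \<Rightarrow> real" where
  "lattice_min \<tau> = (INF w \<in> period_lattice \<tau> - {0}. norm w)"

definition D_eps :: "(complex \<times> complex \<times> complex) set" where
  "D_eps = {(\<tau>1, \<tau>2, \<epsilon>). \<tau>1 \<in> upper_half_plane \<and> \<tau>2 \<in> upper_half_plane \<and>
                          norm \<epsilon> < 1/4 * lattice_min \<tau>1 * lattice_min \<tau>2}"

definition D_eps_0 :: "(complex \<times> complex \<times> complex) set" where
  "D_eps_0 = {(\<tau>1, \<tau>2, \<epsilon>) \<in> D_eps. \<epsilon> = 0}"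

(* B_k / k! is the coefficient of X^k in X / (exp X - 1), so B_1 = -1/2. *)
definition bernoulli_number :: "nat \<Rightarrow> real" where
  "bernoulli_number k = fact k * fps_nth (fps_X / (fps_exp 1 - 1)) k"

definition divisor_sum :: "nat \<Rightarrow> nat \<Rightarrow> nat" where
  "divisor_sum k n = (\<Sum>d | d dvd n. d ^ k)"

(* The series over n \<ge> 1 is indexed by n = Suc m. *)
definition eisenstein_E :: "nat \<Rightarrow> complex \<Rightarrow> complex" where
  "eisenstein_E k \<tau> =
     (if odd k then 0
      else - of_real (bernoulli_number k) / fact k
           + 2 / fact (k - 1) *
             (\<Sum>m. of_nat (divisor_sum (k - 1) (Suc m)) *
                  exp (2 * of_real pi * \<i> * of_nat (Suc m) * \<tau>)))"

text \<open>
  Matrices with rows and columns indexed by the positive integers; values at index 0 are irrelevant.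
\<close>

type_synonym inf_matrix = "nat \<Rightarrow> nat \<Rightarrow> complex"

definition im_mult :: "inf_matrix \<Rightarrow> inf_matrix \<Rightarrow> inf_matrix" where
  "im_mult A B = (\<lambda>k l. \<Sum>\<^sub>\<infinity>m\<in>{1..}. A k m * B m l)"

fun im_power :: "inf_matrix \<Rightarrow> nat \<Rightarrow> inf_matrix" where
  "im_power A 0 = (\<lambda>k l. if k = l then 1 else 0)"
| "im_power A (Suc n) = im_mult A (im_power A n)"

(* The inverse of I - A, as the geometric series of the powers of A. *)
definition im_geometric_inverse :: "inf_matrix \<Rightarrow> inf_matrix" where
  "im_geometric_inverse A = (\<lambda>k l. \<Sum>n. im_power A n k l)"

(* E_{k+l} vanishes for k + l odd, so \<epsilon>^((k+l)/2) only matters for k + l even and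
   no choice of a square root of \<epsilon> is involved. *)
definition A_matrix :: "complex \<Rightarrow> complex \<Rightarrow> inf_matrix" where
  "A_matrix \<tau> \<epsilon> = (\<lambda>k l.
     \<epsilon> ^ ((k + l) div 2) / of_real (sqrt (real k * real l)) * (-1) ^ (k + 1) *
     (fact (k + l - 1) / (fact (k - 1) * fact (l - 1))) * eisenstein_E (k + l) \<tau>)"

text \<open>
  The period matrix of the genus two surface sewn from the two tori by \<open>z\<^sub>1 z\<^sub>2 = \<epsilon>\<close>, through its
  explicit expression in \<open>\<tau>\<^sub>1\<close>, \<open>\<tau>\<^sub>2\<close>, \<open>\<epsilon>\<close>.
\<close>

definition Omega_11 :: "complex \<Rightarrow> complex \<Rightarrow> complex \<Rightarrow> complex" where
  "Omega_11 \<tau>1 \<tau>2 \<epsilon> = (let A1 = A_matrix \<tau>1 \<epsilon>; A2 = A_matrix \<tau>2 \<epsilon> in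
     (2 * of_real pi * \<i> * \<tau>1 + \<epsilon> * im_mult A2 (im_geometric_inverse (im_mult A1 A2)) 1 1)
       / (2 * of_real pi * \<i>))"

definition Omega_22 :: "complex \<Rightarrow> complex \<Rightarrow> complex \<Rightarrow> complex" where
  "Omega_22 \<tau>1 \<tau>2 \<epsilon> = (let A1 = A_matrix \<tau>1 \<epsilon>; A2 = A_matrix \<tau>2 \<epsilon> in
     (2 * of_real pi * \<i> * \<tau>2 + \<epsilon> * im_mult A1 (im_geometric_inverse (im_mult A2 A1)) 1 1)
       / (2 * of_real pi * \<i>))"

definition Omega_12 :: "complex \<Rightarrow> complex \<Rightarrow> complex \<Rightarrow> complex" where
  "Omega_12 \<tau>1 \<tau>2 \<epsilon> = (let A1 = A_matrix \<tau>1 \<epsilon>; A2 = A_matrix \<tau>2 \<epsilon> in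
     - \<epsilon> * im_geometric_inverse (im_mult A1 A2) 1 1 / (2 * of_real pi * \<i>))"

fun F_eps :: "complex \<times> complex \<times> complex \<Rightarrow> complex^2^2" where
  "F_eps (\<tau>1, \<tau>2, \<epsilon>) =
     vector [vector [Omega_11 \<tau>1 \<tau>2 \<epsilon>, Omega_12 \<tau>1 \<tau>2 \<epsilon>],
             vector [Omega_12 \<tau>1 \<tau>2 \<epsilon>, Omega_22 \<tau>1 \<tau>2 \<epsilon>]]"

definition SL2Z :: "(int^2^2) set" where
  "SL2Z = {\<gamma>. det \<gamma> = 1}"

definition aut_factor :: "int^2^2 \<Rightarrow> complex \<Rightarrow> complex" where
  "aut_factor \<gamma> \<tau> = of_int (\<gamma> $ 2 $ 1) * \<tau> + of_int (\<gamma> $ 2 $ 2)"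

definition moebius :: "int^2^2 \<Rightarrow> complex \<Rightarrow> complex" where
  "moebius \<gamma> \<tau> = (of_int (\<gamma> $ 1 $ 1) * \<tau> + of_int (\<gamma> $ 1 $ 2)) / aut_factor \<gamma> \<tau>"

fun act_1 :: "int^2^2 \<Rightarrow> complex \<times> complex \<times> complex \<Rightarrow> complex \<times> complex \<times> complex" where
  "act_1 \<gamma> (\<tau>1, \<tau>2, \<epsilon>) = (moebius \<gamma> \<tau>1, \<tau>2, \<epsilon> / aut_factor \<gamma> \<tau>1)"

fun act_2 :: "int^2^2 \<Rightarrow> complex \<times> complex \<times> complex \<Rightarrow> complex \<times> complex \<times> complex" where
  "act_2 \<gamma> (\<tau>1, \<tau>2, \<epsilon>) = (\<tau>1, moebius \<gamma> \<tau>2, \<epsilon> / aut_factor \<gamma> \<tau>2)"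

fun act_beta :: "complex \<times> complex \<times> complex \<Rightarrow> complex \<times> complex \<times> complex" where
  "act_beta (\<tau>1, \<tau>2, \<epsilon>) = (\<tau>2, \<tau>1, \<epsilon>)"

(* Every element of the semidirect product (SL(2,Z) x SL(2,Z)) : Z_2 is uniquely a product
   \<gamma>1 \<gamma>2 \<beta>^s with s = 0 or 1, represented by the triple (\<gamma>1, \<gamma>2, s = 1). *)
definition G_group :: "((int^2^2) \<times> (int^2^2) \<times> bool) set" where
  "G_group = SL2Z \<times> SL2Z \<times> UNIV"

fun G_act :: "(int^2^2) \<times> (int^2^2) \<times> bool \<Rightarrow>
              complex \<times> complex \<times> complex \<Rightarrow> complex \<times> complex \<times> complex" where
  "G_act (\<gamma>1, \<gamma>2, s) x = act_1 \<gamma>1 (act_2 \<gamma>2 (if s then act_beta x else x))"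

end

theory Submission
  imports Defs "HOL-Complex_Analysis.Complex_Analysis"
begin

text \<open>
  Every point of \<open>D_eps_0\<close> has the form \<open>(p, q, 0)\<close>.  Near it the period matrix is
  \<open>diag(\<tau>1, \<tau>2)\<close> with off-diagonal entry \<open>- \<epsilon> / (2 \<pi> i)\<close>, up to a perturbation with a small
  Lipschitz constant, so \<open>F_eps\<close> is injective near the point for an elementary reason.  The real
  issue is injectivity on a neighbourhood that is invariant under \<open>G\<close>, and this rests on the
  compatibility of \<open>F_eps\<close> with the actions of \<open>G\<close>.

  Equivariance.  The Eisenstein series of weight \<open>k > 2\<close> are modular, and that of weight 2 is
  modular up to the term \<open>c (c \<tau> + d) / (2 \<pi> i)\<close>.  In terms of the infinite matrices, an element of
  the first factor \<open>SL(2, Z)\<close> therefore conjugates \<open>A_2\<close> by a diagonal matrix and \<open>A_1\<close> likewise,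
  except that the entry \<open>(1, 1)\<close> of \<open>A_1\<close> receives a correction.  Such a rank-one update changes
  \<open>(I - A_1 A_2)^{-1}\<close> in an explicit way (\<open>neumann_column_rank_one_update\<close>), and the result is
  the usual action of \<open>SL(2, Z)\<close>, embedded in \<open>Sp(4, Z)\<close>, on the period matrix (\<open>Omega_moebius\<close>).
  Hence, as long as the geometric series converge, \<open>F_eps u = F_eps u'\<close> implies
  \<open>F_eps (g u) = F_eps (g u')\<close>.

  Modularity in all weights at once.  The numbers \<open>- E_k(\<tau>)\<close> are the Taylor coefficients at 0, after
  removal of the pole \<open>1 / z\<close>, of a function that is holomorphic off the lattice and acquires
  additive constants under lattice translations.  For \<open>\<tau>\<close> and \<open>(a \<tau> + b) / (c \<tau> + d)\<close> the suitably
  rescaled functions have the same poles and differ by a linear function plus an entire doubly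
  periodic one.  The latter is constant by Liouville's theorem, and comparison of coefficients gives
  the transformation law (\<open>eisenstein_modular\<close>).

  The neighbourhood.  Choose a strip \<open>y < Im \<tau> < Y\<close> that contains \<open>p\<close> and \<open>q\<close>, let both \<open>\<tau>1\<close> and
  \<open>\<tau>2\<close> range over its \<open>SL(2, Z)\<close>-orbit, and require \<open>|\<epsilon>| < \<eta> sqrt (Im \<tau>1 Im \<tau>2)\<close>; the last condition
  is invariant because \<open>Im \<tau>\<close> and \<open>\<epsilon>\<close> are divided by \<open>|c \<tau> + d|^2\<close> and by \<open>c \<tau> + d\<close>.  On this region
  the matrices are small in weighted norms which transform in the same way, uniformly over the
  orbit, and \<open>|Omega_11 - \<tau>1| \<le> \<eta> Im \<tau>1\<close>, \<open>|Omega_22 - \<tau>2| \<le> \<eta> Im \<tau>2\<close>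
  (\<open>region_small_pair\<close>, \<open>Omega_estimates\<close>).  The image lies in the Siegel upper half-space by these
  estimates.

  Injectivity.  Let \<open>F_eps u = F_eps u'\<close>.  By equivariance one may move \<open>u\<close> by an element of \<open>G\<close> until
  its first two coordinates lie in the strip, moving \<open>u'\<close> along by the same element.  The estimates
  show that the heights of the moved \<open>u'\<close> are comparable to those of \<open>u\<close>.  So both points have
  heights bounded below and \<open>\<epsilon>\<close> bounded by a small constant, and on such a product of half-planes
  \<open>F_eps\<close> is injective by the Lipschitz argument (\<open>F_eps_injective_half_planes\<close>).
\<close>

section \<open>Bernoulli numbers and the growth of Eisenstein series\<close>

abbreviation two_pi_i :: complex where
  "two_pi_i \<equiv> 2 * of_real pi * \<i>"

text \<open>
  This is \<open>B_k / k!\<close>, the form in which Bernoulli numbers enter the constant terms of the Eisenstein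
  series.
\<close>

definition bernoulli_coeff :: "nat \<Rightarrow> real" where
  "bernoulli_coeff k = fps_nth (fps_X / (fps_exp 1 - 1)) k"

lemma bernoulli_number_over_fact: "bernoulli_number k / fact k = bernoulli_coeff k"
  by (simp add: bernoulli_number_def bernoulli_coeff_def)

lemma bernoulli_coeff_recurrence:
  "(\<Sum>i\<le>n. bernoulli_coeff i / fact (Suc (n - i))) = (if n = 0 then 1 else 0)"
proof -
  define f :: "real fps" where "f = fps_X / (fps_exp 1 - 1)"
  define g :: "real fps" where "g = fps_exp 1 - 1"
  have g: "fps_nth g 0 = 0" "fps_nth g (Suc j) = 1 / fact (Suc j)" for j
    by (simp_all add: g_def del: fact_Suc)
  have "g \<noteq> 0" using g(2)[of 0] by auto
  moreover have "subdegree g = 1"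
    by (rule subdegreeI) (use g in \<open>auto simp: g(2)[of 0, simplified]\<close>)
  ultimately have fg: "f * g = fps_X"
    unfolding f_def g_def[symmetric] by (intro dvd_div_mult_self) (simp add: fps_dvd_iff)
  have "(\<Sum>i\<le>n. bernoulli_coeff i / fact (Suc (n - i))) = (\<Sum>i=0..n. fps_nth f i * fps_nth g (Suc n - i))"
    by (intro sum.cong) (auto simp: bernoulli_coeff_def f_def Suc_diff_le g(2))
  also have "\<dots> = fps_nth (f * g) (Suc n)"
    by (simp add: fps_mult_nth g)
  also have "\<dots> = (if n = 0 then 1 else 0)" by (simp add: fg)
  finally show ?thesis .
qed

text \<open>
  In the recurrence, the coefficients that multiply the earlier values are \<open>1 / 2!, 1 / 3!, \<dots>\<close>, whose
  sum is less than \<open>1 / 2 + 1 / 4 + \<dots> = 1\<close>.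
\<close>

lemma abs_bernoulli_coeff_le_1: "\<bar>bernoulli_coeff n\<bar> \<le> 1"
proof (induction n rule: less_induct)
  case (less n)
  show ?case
  proof (cases n)
    case 0
    then show ?thesis using bernoulli_coeff_recurrence[of 0] by simp
  next
    case (Suc m)
    have half: "1 / (fact (Suc (Suc k)) :: real) \<le> (1/2) ^ Suc k" for k
    proof (induction k)
      case (Suc k)
      have "1 / (fact (Suc (Suc (Suc k))) :: real) = (1 / (real k + 3)) * (1 / fact (Suc (Suc k)))"
        unfolding fact_Suc[of "Suc (Suc k)"] by simp
      also have "\<dots> \<le> (1/2) * (1/2) ^ Suc k"
        using Suc by (intro mult_mono) (auto simp del: fact_Suc)
      finally show ?case by (simp del: fact_Suc)
    qed simp
    have "bernoulli_coeff n = - (\<Sum>i\<le>m. bernoulli_coeff i / fact (Suc (n - i)))"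
      using bernoulli_coeff_recurrence[of n] Suc by simp
    also have "\<bar>\<dots>\<bar> \<le> (\<Sum>i\<le>m. (1/2) ^ Suc (m - i))"
      unfolding abs_minus_cancel
    proof (rule sum_abs[THEN order_trans], rule sum_mono)
      fix i assume "i \<in> {..m}"
      then have "\<bar>bernoulli_coeff i\<bar> \<le> 1" "n - i = Suc (m - i)" using less Suc by auto
      moreover have "\<bar>bernoulli_coeff i / fact (Suc (Suc (m - i)))\<bar>
          = \<bar>bernoulli_coeff i\<bar> * (1 / fact (Suc (Suc (m - i))))"
        by (simp add: abs_divide)
      moreover have "\<dots> \<le> 1 * (1/2) ^ Suc (m - i)"
        using calculation half[of "m-i"] by (intro mult_mono) auto
      ultimately show "\<bar>bernoulli_coeff i / fact (Suc (n - i))\<bar> \<le> (1/2) ^ Suc (m - i)" by simp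
    qed
    also have "\<dots> = (\<Sum>i\<le>m. (1/2) ^ Suc i)"
      using sum.nat_diff_reindex[of "\<lambda>i. (1/2::real) ^ Suc i" "Suc m"] by (simp add: lessThan_Suc_atMost)
    also have "\<dots> = 1 - (1/2) ^ Suc m" by (induction m) auto
    also have "\<dots> \<le> 1" by simp
    finally show ?thesis .
  qed
qed

lemma bernoulli_generating_function:
  fixes z :: complex
  assumes "norm z < 1"
  shows "summable (\<lambda>k. norm (of_real (bernoulli_coeff k) * z ^ k))"
    and "(\<Sum>k. of_real (bernoulli_coeff k) * z ^ k) * (exp z - 1) = z"
proof -
  show s1: "summable (\<lambda>k. norm (of_real (bernoulli_coeff k) * z ^ k))"
    using assms abs_bernoulli_coeff_le_1
    by (intro summable_comparison_test'[OF summable_geometric[of "norm z"]])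
       (auto simp: norm_mult norm_power mult_left_le_one_le)
  define e where "e n = z ^ n / fact (Suc n)" for n
  have se: "summable (\<lambda>n. norm (e n))"
    unfolding e_def
  proof (intro summable_comparison_test'[OF summable_norm_exp[of z]])
    fix n
    have "norm z ^ n / fact (Suc n) \<le> norm z ^ n / (fact n :: real)"
      by (intro divide_left_mono fact_mono mult_pos_pos) auto
    then show "norm (norm (z ^ n / fact (Suc n))) \<le> norm (z ^ n /\<^sub>R fact n)"
      by (simp add: norm_divide norm_mult norm_power norm_inverse divide_inverse mult.commute del: fact_Suc)
  qed
  have "(\<lambda>n. z ^ Suc n / fact (Suc n)) sums (exp z - 1)"
    using exp_converges[of z] by (subst sums_Suc_iff) (simp add: scaleR_conv_of_real divide_inverse mult.commute)
  then have ez: "exp z - 1 = z * suminf e"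
    using suminf_mult[of e z] se unfolding e_def
    by (simp add: sums_iff summable_norm_cancel algebra_simps del: fact_Suc)
  have "(\<Sum>k. of_real (bernoulli_coeff k) * z ^ k) * suminf e
      = (\<Sum>k. \<Sum>i\<le>k. of_real (bernoulli_coeff i) * z ^ i * e (k - i))"
    by (rule Cauchy_product[OF s1 se])
  also have "(\<lambda>k. \<Sum>i\<le>k. of_real (bernoulli_coeff i) * z ^ i * e (k - i)) = (\<lambda>k. if k = 0 then 1 else 0)"
  proof
    fix k
    have "(\<Sum>i\<le>k. of_real (bernoulli_coeff i) * z ^ i * e (k - i))
        = (\<Sum>i\<le>k. of_real (bernoulli_coeff i / fact (Suc (k - i))) * z ^ k)"
      by (intro sum.cong) (auto simp: e_def power_add[symmetric] simp del: fact_Suc)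
    also have "\<dots> = of_real (\<Sum>i\<le>k. bernoulli_coeff i / fact (Suc (k - i))) * z ^ k"
      by (simp only: of_real_sum sum_distrib_right)
    finally show "(\<Sum>i\<le>k. of_real (bernoulli_coeff i) * z ^ i * e (k - i)) = (if k = 0 then 1 else 0)"
      unfolding bernoulli_coeff_recurrence by simp
  qed
  also have "suminf (\<lambda>k. if k = 0 then 1 else 0 :: complex) = 1"
    using sums_single[of 0 "\<lambda>_. 1::complex"] by (simp add: sums_iff)
  finally show "(\<Sum>k. of_real (bernoulli_coeff k) * z ^ k) * (exp z - 1) = z"
    by (simp add: ez algebra_simps)
qed

lemma power_le_fact_exp:
  fixes y :: real assumes "y \<ge> 0" shows "y ^ k \<le> fact k * exp y"
proof -
  have "sum (\<lambda>n. y ^ n /\<^sub>R fact n) {k} \<le> (\<Sum>n. y ^ n /\<^sub>R fact n)"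
    using assms by (intro sum_le_suminf summable_exp_generic) auto
  also have "\<dots> = exp y" by (simp add: exp_def)
  finally show ?thesis by (simp add: field_simps)
qed

lemma divisor_sum_le: "divisor_sum k n \<le> n * n ^ k"
proof (cases "n = 0")
  case False
  then have "{d. d dvd n} \<subseteq> {1..n}" by (auto simp: dvd_imp_le intro!: Nat.gr0I)
  then have c: "card {d. d dvd n} \<le> n" using card_mono[of "{1..n}"] by simp
  have "divisor_sum k n \<le> card {d. d dvd n} * n ^ k"
    unfolding divisor_sum_def
    using sum_bounded_above[of "{d. d dvd n}" "\<lambda>d. d ^ k" "n ^ k"] False
    by (simp add: power_mono dvd_imp_le)
  also have "\<dots> \<le> n * n ^ k" using c by simp
  finally show ?thesis .
qed (auto simp: divisor_sum_def)

definition eisenstein_term :: "nat \<Rightarrow> complex \<Rightarrow> nat \<Rightarrow> complex" where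
  "eisenstein_term k \<tau> m = of_nat (divisor_sum (k - 1) (Suc m)) *
                  exp (two_pi_i * of_nat (Suc m) * \<tau>)"

lemma eisenstein_E_even:
  "even k \<Longrightarrow> eisenstein_E k \<tau> = - of_real (bernoulli_coeff k) + 2 / fact (k - 1) * (\<Sum>m. eisenstein_term k \<tau> m)"
  unfolding eisenstein_E_def eisenstein_term_def bernoulli_number_over_fact[symmetric] by simp

lemma norm_exp_nome: "norm (exp (two_pi_i * of_nat n * \<tau>)) = exp (- (2 * pi * real n * Im \<tau>))"
  by (simp add: norm_exp_eq_Re)

lemma norm_exp_nome_diff:
  assumes "Im \<tau> \<ge> y" "Im \<tau>' \<ge> y"
  shows "norm (exp (two_pi_i * of_nat n * \<tau>) - exp (two_pi_i * of_nat n * \<tau>'))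
     \<le> 2 * pi * real n * exp (- (2 * pi * real n * y)) * norm (\<tau> - \<tau>')"
proof (rule field_differentiable_bound[of "{\<tau>. Im \<tau> \<ge> y}"])
  show "convex {\<tau>. Im \<tau> \<ge> y}" by (rule convex_halfspace_Im_ge)
next
  fix z assume "z \<in> {\<tau>. Im \<tau> \<ge> y}"
  show "((\<lambda>z. exp (two_pi_i * of_nat n * z)) has_field_derivative
     (two_pi_i * of_nat n) * exp (two_pi_i * of_nat n * z)) (at z within {\<tau>. Im \<tau> \<ge> y})"
    by (auto intro!: derivative_eq_intros)
  show "norm ((two_pi_i * of_nat n) * exp (two_pi_i * of_nat n * z))
     \<le> 2 * pi * real n * exp (- (2 * pi * real n * y))"
    unfolding norm_mult[of _ "exp _"] norm_exp_nome using \<open>z \<in> _\<close>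
    by (intro mult_mono) (auto simp: norm_mult mult_left_mono)
qed (use assms in auto)

text \<open>
  Writing \<open>n = Suc m\<close>, one half of the decay of \<open>exp (- 2 \<pi> n y)\<close> absorbs the power of \<open>n\<close>, at the
  price of a factorial; the other half leaves a geometric series in \<open>n\<close>.
\<close>

lemma eisenstein_term_bound:
  assumes "y > 0" "k \<ge> 1" "Im \<tau> \<ge> y"
  shows "norm (eisenstein_term k \<tau> m) \<le> fact k * (1 / (pi * y)) ^ k * exp (- (pi * y)) ^ Suc m"
    and "Im \<tau>' \<ge> y \<Longrightarrow> norm (eisenstein_term k \<tau> m - eisenstein_term k \<tau>' m)
      \<le> (2 * pi * fact (Suc k) * (1 / (pi * y)) ^ Suc k * norm (\<tau> - \<tau>')) * exp (- (pi * y)) ^ Suc m"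
proof -
  define n where "n = Suc m"
  \<comment> \<open>Apply \<open>x^l \<le> l! exp x\<close> to \<open>x = \<pi> n y\<close>.\<close>
  have key: "real n ^ l * exp (- (2 * pi * real n * y)) \<le> fact l * (1 / (pi * y)) ^ l * exp (- (pi * y)) ^ n" for l
  proof -
    have "(real n * (pi * y)) ^ l * exp (- (2 * pi * real n * y))
         \<le> fact l * exp (real n * (pi * y)) * exp (- (2 * pi * real n * y))"
      using assms by (intro mult_right_mono power_le_fact_exp) auto
    also have "\<dots> = fact l * exp (- (pi * y)) ^ n"
      by (simp add: exp_of_nat_mult[symmetric] mult.assoc exp_add[symmetric])
    finally show ?thesis using assms by (simp add: power_mult_distrib field_simps)
  qed
  have ds: "real (divisor_sum (k - 1) n) \<le> real n ^ k"
  proof -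
    have "real (divisor_sum (k - 1) n) \<le> real (n * n ^ (k - 1))"
      using divisor_sum_le by (simp only: of_nat_le_iff)
    also have "\<dots> = real n ^ k" using assms by (cases k) auto
    finally show ?thesis .
  qed
  have "norm (eisenstein_term k \<tau> m) \<le> real n ^ k * exp (- (2 * pi * real n * Im \<tau>))"
    unfolding eisenstein_term_def norm_mult norm_exp_nome n_def[symmetric] using ds
    by (intro mult_mono) auto
  also have "\<dots> \<le> real n ^ k * exp (- (2 * pi * real n * y))"
    using assms by (intro mult_mono) (auto intro!: mult_left_mono)
  also note key
  finally show "norm (eisenstein_term k \<tau> m) \<le> fact k * (1 / (pi * y)) ^ k * exp (- (pi * y)) ^ Suc m"
    unfolding n_def .
  assume "Im \<tau>' \<ge> y"
  have "norm (eisenstein_term k \<tau> m - eisenstein_term k \<tau>' m)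
     = real (divisor_sum (k - 1) n) * norm (exp (two_pi_i * of_nat n * \<tau>) - exp (two_pi_i * of_nat n * \<tau>'))"
    unfolding eisenstein_term_def n_def[symmetric] right_diff_distrib[symmetric] norm_mult by simp
  also have "\<dots> \<le> real n ^ k * (2 * pi * real n * exp (- (2 * pi * real n * y)) * norm (\<tau> - \<tau>'))"
    using ds norm_exp_nome_diff[OF assms(3) \<open>Im \<tau>' \<ge> y\<close>] by (intro mult_mono) auto
  also have "\<dots> = (2 * pi * norm (\<tau> - \<tau>')) * (real n ^ Suc k * exp (- (2 * pi * real n * y)))" by simp
  also have "\<dots> \<le> (2 * pi * norm (\<tau> - \<tau>')) * (fact (Suc k) * (1 / (pi * y)) ^ Suc k * exp (- (pi * y)) ^ n)"
    by (intro mult_left_mono key) auto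
  finally show "norm (eisenstein_term k \<tau> m - eisenstein_term k \<tau>' m)
      \<le> (2 * pi * fact (Suc k) * (1 / (pi * y)) ^ Suc k * norm (\<tau> - \<tau>')) * exp (- (pi * y)) ^ Suc m"
    unfolding n_def by (simp only: mult_ac)
qed

lemma suminf_norm_le_geometric:
  fixes f :: "nat \<Rightarrow> complex"
  assumes "0 < x" "x < 1" "\<And>m. norm (f m) \<le> C * x ^ Suc m"
  shows "summable f" "norm (suminf f) \<le> C * (x / (1 - x))"
proof -
  have *: "(\<lambda>m. C * x ^ Suc m) sums (C * (x / (1 - x)))"
    using sums_mult[OF geometric_sums[of x], of "C * x"] assms by (simp add: mult_ac)
  show "summable f"
    by (rule summable_comparison_test'[OF sums_summable[OF *]]) (use assms in auto)
  show "norm (suminf f) \<le> C * (x / (1 - x))"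
    by (rule norm_sums_le[OF summable_sums[OF \<open>summable f\<close>] *]) (use assms in auto)
qed

lemma summable_eisenstein_term:
  assumes "Im \<tau> > 0" "k \<ge> 1" shows "summable (eisenstein_term k \<tau>)"
  by (rule suminf_norm_le_geometric(1)[of "exp (- (pi * Im \<tau>))"])
     (use assms eisenstein_term_bound(1)[of "Im \<tau>" k \<tau>] in auto)

text \<open>
  The factorial \<open>k!\<close> from the \<open>q\<close>-series is compensated by the normalising factor \<open>1 / (k - 1)!\<close>, so
  growth is geometric in \<open>k\<close>.  The same holds for the Lipschitz constants in \<open>\<tau>\<close>, because a derivative
  costs one more power of \<open>n\<close>.
\<close>

lemma eisenstein_growth:
  fixes y :: real
  assumes y: "y > 0"
  obtains K b where "K > 0" "b \<ge> 1"
    "\<And>k \<tau>. k \<ge> 1 \<Longrightarrow> Im \<tau> \<ge> y \<Longrightarrow> norm (eisenstein_E k \<tau>) \<le> K * b ^ k"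
    "\<And>k \<tau> \<tau>'. k \<ge> 1 \<Longrightarrow> Im \<tau> \<ge> y \<Longrightarrow> Im \<tau>' \<ge> y \<Longrightarrow>
       norm (eisenstein_E k \<tau> - eisenstein_E k \<tau>') \<le> K * b ^ k * norm (\<tau> - \<tau>')"
proof -
  define x where "x = exp (- (pi * y))"
  define S where "S = x / (1 - x)"
  define p where "p = 1 / (pi * y)"
  define b where "b = max 1 (4 * p)"
  define K where "K = 1 + 2 * S + 4 * pi * S * p"
  have x: "0 < x" "x < 1" using y by (auto simp: x_def)
  have S: "S > 0" using x by (simp add: S_def)
  have p: "p > 0" using y by (simp add: p_def)
  have b: "b \<ge> 1" "4 * p \<le> b" by (auto simp: b_def)
  have K: "1 + 2 * S \<le> K" "4 * pi * S * p \<le> K" "K > 0"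
    using S p by (auto simp: K_def add_pos_pos)
  have kf: "fact k / fact (k - 1) = real k" if "k \<ge> 1" for k :: nat
    using that by (cases k) auto
  have k2: "real k \<le> 2 ^ k" for k :: nat using less_exp[of k] by (metis less_imp_le of_nat_le_iff of_nat_numeral of_nat_power)
  have bound: "norm (eisenstein_E k \<tau>) \<le> K * b ^ k" if k: "k \<ge> 1" "Im \<tau> \<ge> y" for k \<tau>
  proof (cases "even k")
    case True
    have "norm (\<Sum>m. eisenstein_term k \<tau> m) \<le> fact k * p ^ k * S"
      unfolding S_def using eisenstein_term_bound(1)[OF y k(1) k(2)]
      by (intro suminf_norm_le_geometric(2)[OF x]) (simp add: x_def p_def)
    then have "norm (2 / fact (k - 1) * (\<Sum>m. eisenstein_term k \<tau> m)) \<le> 2 / fact (k - 1) * (fact k * p ^ k * S)"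
      unfolding norm_mult by (intro mult_mono) (auto simp: norm_divide)
    also have "\<dots> = 2 * S * (real k * p ^ k)"
      using kf[OF k(1)] by (simp add: field_simps)
    also have "\<dots> \<le> 2 * S * (2 ^ k * (2 * p) ^ k)"
      using k2[of k] S p by (intro mult_left_mono mult_mono power_mono) auto
    also have "\<dots> = 2 * S * (4 * p) ^ k" unfolding power_mult_distrib[of 2 "2 * p" k, symmetric] by simp
    also have "\<dots> \<le> 2 * S * b ^ k" using b p S by (intro mult_left_mono power_mono) auto
    finally have "norm (eisenstein_E k \<tau>) \<le> 1 + 2 * S * b ^ k"
      unfolding eisenstein_E_even[OF True]
      by (intro norm_triangle_le add_mono) (auto simp: abs_bernoulli_coeff_le_1)
    also have "\<dots> \<le> 1 * b ^ k + 2 * S * b ^ k" using one_le_power[OF b(1), of k] by simp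
    also have "\<dots> = (1 + 2 * S) * b ^ k" by (simp only: distrib_right)
    also have "\<dots> \<le> K * b ^ k" using K b by (intro mult_right_mono) auto
    finally show ?thesis .
  qed (use K b in \<open>auto simp: eisenstein_E_def\<close>)
  have lip: "norm (eisenstein_E k \<tau> - eisenstein_E k \<tau>') \<le> K * b ^ k * norm (\<tau> - \<tau>')"
    if k: "k \<ge> 1" "Im \<tau> \<ge> y" "Im \<tau>' \<ge> y" for k \<tau> \<tau>'
  proof (cases "even k")
    case True
    have sm: "summable (eisenstein_term k \<tau>)" "summable (eisenstein_term k \<tau>')"
      using k y by (auto intro!: summable_eisenstein_term)
    have "norm (\<Sum>m. eisenstein_term k \<tau> m - eisenstein_term k \<tau>' m)
         \<le> (2 * pi * fact (Suc k) * p ^ Suc k * norm (\<tau> - \<tau>')) * S"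
      unfolding S_def using eisenstein_term_bound(2)[OF y k]
      by (intro suminf_norm_le_geometric(2)[OF x]) (simp add: x_def p_def)
    then have "norm (2 / fact (k - 1) * (\<Sum>m. eisenstein_term k \<tau> m - eisenstein_term k \<tau>' m))
         \<le> 2 / fact (k - 1) * ((2 * pi * fact (Suc k) * p ^ Suc k * norm (\<tau> - \<tau>')) * S)"
      unfolding norm_mult by (intro mult_mono) (auto simp: norm_divide)
    also have "\<dots> = (4 * pi * S * p * norm (\<tau> - \<tau>')) * (real k * (real k + 1) * p ^ k)"
      using kf[OF k(1)] by (simp add: field_simps)
    also have "\<dots> \<le> (4 * pi * S * p * norm (\<tau> - \<tau>')) * (2 ^ k * 2 ^ k * p ^ k)"
    proof -
      have "real k + 1 \<le> 2 ^ k" using less_exp[of k] by (metis Suc_leI of_nat_Suc of_nat_le_iff of_nat_numeral of_nat_power add.commute)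
      then show ?thesis using k2[of k] S p by (intro mult_left_mono mult_mono) auto
    qed
    also have "\<dots> = (4 * pi * S * p * norm (\<tau> - \<tau>')) * (4 * p) ^ k"
      unfolding power_mult_distrib[symmetric] by simp
    also have "\<dots> \<le> (4 * pi * S * p * norm (\<tau> - \<tau>')) * b ^ k"
      using b p S by (intro mult_left_mono power_mono) auto
    also have "\<dots> \<le> (K * norm (\<tau> - \<tau>')) * b ^ k"
      using K b by (intro mult_right_mono) auto
    also have "2 / fact (k - 1) * (\<Sum>m. eisenstein_term k \<tau> m - eisenstein_term k \<tau>' m)
        = eisenstein_E k \<tau> - eisenstein_E k \<tau>'"
      unfolding eisenstein_E_even[OF True] suminf_diff[OF sm, symmetric] right_diff_distrib by simp
    finally show ?thesis by (simp add: mult_ac)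
  qed (use K b in \<open>auto simp: eisenstein_E_def\<close>)
  show thesis using that[OF K(3) b(1) bound lip] by blast
qed

section \<open>A quasi-periodic function with poles on the period lattice\<close>

lemma period_lattice_diff:
  assumes "v \<in> period_lattice \<tau>" "w \<in> period_lattice \<tau>" shows "v - w \<in> period_lattice \<tau>"
proof -
  obtain m n m' n' :: int where "v = of_int m * (two_pi_i * \<tau>) + of_int n * two_pi_i"
    "w = of_int m' * (two_pi_i * \<tau>) + of_int n' * two_pi_i"
    using assms unfolding period_lattice_def by blast
  then have "v - w = of_int (m - m') * (two_pi_i * \<tau>) + of_int (n - n') * two_pi_i"
    by (simp add: algebra_simps)
  then show ?thesis unfolding period_lattice_def by blast
qed

lemma zero_in_period_lattice [simp]: "0 \<in> period_lattice \<tau>"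
  unfolding period_lattice_def by (auto intro!: exI[of _ "0::int"])

lemma period_lattice_norm_ge:
  assumes "Im \<tau> > 0" "w \<in> period_lattice \<tau>" "w \<noteq> 0"
  shows "norm w \<ge> 2 * pi * min 1 (Im \<tau>)"
proof -
  obtain m n :: int where w: "w = of_int m * (two_pi_i * \<tau>) + of_int n * two_pi_i"
    using assms unfolding period_lattice_def by blast
  then have w': "w = two_pi_i * (of_int m * \<tau> + of_int n)" by (simp add: algebra_simps)
  have "norm (of_int m * \<tau> + of_int n :: complex) \<ge> min 1 (Im \<tau>)"
  proof (cases "m = 0")
    case True
    then have "n \<noteq> 0" using w assms by auto
    then have "1 \<le> \<bar>real_of_int n\<bar>" by linarith
    then show ?thesis using True by simp
  next
    case False
    then have "1 \<le> \<bar>real_of_int m\<bar>" by linarith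
    then have "1 * Im \<tau> \<le> \<bar>real_of_int m\<bar> * Im \<tau>" using assms by (intro mult_right_mono) auto
    also have "\<dots> = \<bar>Im (of_int m * \<tau> + of_int n)\<bar>" using assms by (simp add: abs_mult)
    also have "\<dots> \<le> norm (of_int m * \<tau> + of_int n :: complex)" by (rule abs_Im_le_cmod)
    finally show ?thesis by simp
  qed
  then show ?thesis unfolding w' by (simp add: norm_mult)
qed

lemma closed_period_lattice:
  assumes "Im \<tau> > 0" shows "closed (period_lattice \<tau>)"
proof (rule discrete_imp_closed)
  show "0 < 2 * pi * min 1 (Im \<tau>)" using assms by simp
  show "\<forall>x\<in>period_lattice \<tau>. \<forall>y\<in>period_lattice \<tau>. dist y x < 2 * pi * min 1 (Im \<tau>) \<longrightarrow> y = x"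
    using period_lattice_norm_ge[OF assms period_lattice_diff] by (force simp: dist_norm)
qed

definition geom_exp :: "complex \<Rightarrow> complex" where
  "geom_exp w = exp w / (1 - exp w)"

text \<open>
  With \<open>u = exp z\<close> and \<open>q = exp (2 \<pi> i \<tau>)\<close> this is
  \<open>1/2 + 1 / (u - 1) - \<Sum>\<^sub>m (q^m u / (1 - q^m u) - q^m u^{-1} / (1 - q^m u^{-1}))\<close> with \<open>m \<ge> 1\<close>.  It is the Weierstrass
  zeta function of the period lattice plus a linear term that makes it periodic under \<open>2 \<pi> i\<close>.
\<close>

definition quasi_elliptic :: "complex \<Rightarrow> complex \<Rightarrow> complex" where
  "quasi_elliptic \<tau> z = 1 / 2 + 1 / (exp z - 1) -
     (\<Sum>m. geom_exp (two_pi_i * of_nat (Suc m) * \<tau> + z)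
         - geom_exp (two_pi_i * of_nat (Suc m) * \<tau> - z))"

lemma norm_geom_exp_le:
  assumes "norm (exp w) \<le> 1 / 2" shows "norm (geom_exp w) \<le> 2 * norm (exp w)"
proof -
  have "1 - norm (exp w) \<le> norm (1 - exp w)" by (metis norm_one norm_triangle_ineq2)
  then have "1 / 2 \<le> norm (1 - exp w)" using assms by simp
  then have "norm (exp w) / norm (1 - exp w) \<le> norm (exp w) / (1 / 2)"
    by (intro divide_left_mono) auto
  then show ?thesis by (simp add: geom_exp_def norm_divide)
qed

lemma exp_eq_1_period_lattice:
  assumes "exp (two_pi_i * of_nat m * \<tau> + z) = 1"
  shows "z \<in> period_lattice \<tau>"
proof -
  obtain n :: int where "Re (two_pi_i * of_nat m * \<tau> + z) = 0"
      "Im (two_pi_i * of_nat m * \<tau> + z) = of_int (2 * n) * pi"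
    using assms unfolding exp_eq_1 by blast
  then have "two_pi_i * of_nat m * \<tau> + z = of_int n * two_pi_i"
    by (intro complex_eqI) auto
  then have "z = of_int (- int m) * (two_pi_i * \<tau>) + of_int n * two_pi_i"
    by (simp add: algebra_simps add_eq_0_iff2)
  then show ?thesis unfolding period_lattice_def by blast
qed

lemma uminus_period_lattice: "- z \<in> period_lattice \<tau> \<Longrightarrow> z \<in> period_lattice \<tau>"
  using period_lattice_diff[OF zero_in_period_lattice, of "-z" \<tau>] by simp

text \<open>
  The estimate is uniform on vertical strips, as needed for locally uniform convergence; finitely many
  terms have to be excluded because they may have poles in the strip.
\<close>

lemma eventually_geom_exp_le:
  assumes "Im \<tau> > 0"
  shows "eventually (\<lambda>m. \<forall>z. \<bar>Re z\<bar> \<le> R \<longrightarrow>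
     norm (geom_exp (two_pi_i * of_nat m * \<tau> + z)) \<le> 2 * exp R * exp (- (2 * pi * Im \<tau>)) ^ m) sequentially"
proof -
  define r where "r = exp (- (2 * pi * Im \<tau>))"
  have r: "0 < r" "r < 1" using assms by (auto simp: r_def)
  have "(\<lambda>m. exp R * r ^ m) \<longlonglongrightarrow> exp R * 0"
    using r by (intro tendsto_mult tendsto_const LIMSEQ_power_zero) auto
  then have "eventually (\<lambda>m. exp R * r ^ m < 1 / 2) sequentially"
    by (intro order_tendstoD(2)[of _ "exp R * 0"]) auto
  then show ?thesis
  proof eventually_elim
    case (elim m)
    show ?case
    proof safe
      fix z assume z: "\<bar>Re z\<bar> \<le> R"
      have "norm (exp (two_pi_i * of_nat m * \<tau> + z)) = r ^ m * exp (Re z)"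
        unfolding exp_add norm_mult norm_exp_nome r_def exp_of_nat_mult[symmetric]
        by (simp add: mult_ac)
      also have "\<dots> \<le> r ^ m * exp R" using z r by (intro mult_left_mono) auto
      finally have "norm (exp (two_pi_i * of_nat m * \<tau> + z)) \<le> exp R * r ^ m" by (simp add: mult.commute)
      with elim norm_geom_exp_le[of "two_pi_i * of_nat m * \<tau> + z"]
      show "norm (geom_exp (two_pi_i * of_nat m * \<tau> + z)) \<le> 2 * exp R * exp (- (2 * pi * Im \<tau>)) ^ m"
        unfolding r_def by simp
    qed
  qed
qed

lemma summable_geom_exp:
  assumes "Im \<tau> > 0"
  shows "summable (\<lambda>m. geom_exp (two_pi_i * of_nat m * \<tau> + z))"
proof (rule summable_comparison_test_ev)
  show "eventually (\<lambda>m. norm (geom_exp (two_pi_i * of_nat m * \<tau> + z)) \<le> 2 * exp \<bar>Re z\<bar> * exp (- (2 * pi * Im \<tau>)) ^ m) sequentially"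
    using eventually_geom_exp_le[OF assms, of "\<bar>Re z\<bar>"] by (rule eventually_mono) auto
  show "summable (\<lambda>m. 2 * exp \<bar>Re z\<bar> * exp (- (2 * pi * Im \<tau>)) ^ m)"
    using assms by (intro summable_mult summable_geometric) auto
qed

lemma quasi_elliptic_holomorphic:
  assumes "Im \<tau> > 0"
  shows "quasi_elliptic \<tau> holomorphic_on - period_lattice \<tau>"
proof -
  let ?t = "\<lambda>m z. geom_exp (two_pi_i * of_nat (Suc m) * \<tau> + z)
         - geom_exp (two_pi_i * of_nat (Suc m) * \<tau> - z)"
  have op: "open (- period_lattice \<tau>)" using closed_period_lattice[OF assms] by auto
  have "(\<lambda>z. \<Sum>m. ?t m z) holomorphic_on - period_lattice \<tau>"
  proof (rule holomorphic_uniform_sequence[OF op])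
    fix n
    have "exp (two_pi_i * of_nat m * \<tau> + z) \<noteq> 1" "exp (two_pi_i * of_nat m * \<tau> - z) \<noteq> 1"
      if "z \<in> - period_lattice \<tau>" for m z
      using that exp_eq_1_period_lattice[of m \<tau> z] exp_eq_1_period_lattice[of m \<tau> "-z"] uminus_period_lattice
      by auto
    note ne = this
    have "(\<lambda>z. geom_exp (w + z)) holomorphic_on A" if "\<And>z. z \<in> A \<Longrightarrow> exp (w + z) \<noteq> 1" for w A
      unfolding geom_exp_def using that[symmetric] by (intro holomorphic_intros) auto
    moreover have "(\<lambda>z. geom_exp (w - z)) holomorphic_on A" if "\<And>z. z \<in> A \<Longrightarrow> exp (w - z) \<noteq> 1" for w A
      unfolding geom_exp_def using that[symmetric] by (intro holomorphic_intros) auto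
    ultimately show "(\<lambda>z. \<Sum>m<n. ?t m z) holomorphic_on - period_lattice \<tau>"
      by (intro holomorphic_on_sum holomorphic_on_diff) (use ne in blast)+
  next
    fix x assume "x \<in> - period_lattice \<tau>"
    then obtain d where d: "d > 0" "cball x d \<subseteq> - period_lattice \<tau>"
      using op open_contains_cball by blast
    define R where "R = norm x + d"
    have R: "\<bar>Re z\<bar> \<le> R" if "z \<in> cball x d" for z
      using that abs_Re_le_cmod[of z] norm_triangle_ineq2[of z x] by (auto simp: R_def dist_norm norm_minus_commute)
    define r where "r = exp (- (2 * pi * Im \<tau>))"
    have "uniform_limit (cball x d) (\<lambda>n z. \<Sum>m<n. ?t m z) (\<lambda>z. \<Sum>m. ?t m z) sequentially"
    proof (rule Weierstrass_m_test_ev)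
      have "eventually (\<lambda>m. \<forall>z. \<bar>Re z\<bar> \<le> R \<longrightarrow>
         norm (geom_exp (two_pi_i * of_nat (Suc m) * \<tau> + z)) \<le> 2 * exp R * r ^ Suc m) sequentially"
        using eventually_geom_exp_le[OF assms, of R] unfolding r_def
        by (subst eventually_sequentially_Suc)
      then show "eventually (\<lambda>m. \<forall>z\<in>cball x d. norm (?t m z) \<le> 4 * exp R * r ^ Suc m) sequentially"
      proof eventually_elim
        case (elim m)
        show ?case
        proof
          fix z assume "z \<in> cball x d"
          then have "\<bar>Re z\<bar> \<le> R" "\<bar>Re (-z)\<bar> \<le> R" using R by auto
          then have "norm (geom_exp (two_pi_i * of_nat (Suc m) * \<tau> + z)) \<le> 2 * exp R * r ^ Suc m"
             "norm (geom_exp (two_pi_i * of_nat (Suc m) * \<tau> + (-z))) \<le> 2 * exp R * r ^ Suc m"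
            using elim by blast+
          then show "norm (?t m z) \<le> 4 * exp R * r ^ Suc m"
            by (intro norm_triangle_le_diff) simp
        qed
      qed
      show "summable (\<lambda>m. 4 * exp R * r ^ Suc m)"
        using assms unfolding r_def by (subst summable_Suc_iff) (intro summable_mult summable_geometric, auto)
    qed
    then show "\<exists>d>0. cball x d \<subseteq> - period_lattice \<tau> \<and>
      uniform_limit (cball x d) (\<lambda>n z. \<Sum>m<n. ?t m z) (\<lambda>z. \<Sum>m. ?t m z) sequentially"
      using d by blast
  qed
  moreover have "exp z \<noteq> 1" if "z \<in> - period_lattice \<tau>" for z
    using that exp_eq_1_period_lattice[of 0 \<tau> z] by auto
  ultimately show ?thesis
    unfolding quasi_elliptic_def[abs_def] by (intro holomorphic_intros) auto
qed

lemma exp_add_2pi_int: "exp (w + of_int n * two_pi_i) = exp (w :: complex)"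
  by (simp add: exp_add exp_integer_2pi mult.commute mult.left_commute)

lemma quasi_elliptic_add_2pi_int:
  "quasi_elliptic \<tau> (z + of_int n * two_pi_i) = quasi_elliptic \<tau> z"
proof -
  have "geom_exp (w + of_int n * two_pi_i) = geom_exp w" for w n
    unfolding geom_exp_def exp_add_2pi_int ..
  from this[of _ n] this[of _ "-n"] show ?thesis
    unfolding quasi_elliptic_def exp_add_2pi_int add.assoc[symmetric] diff_diff_add[symmetric]
    by simp
qed

text \<open>
  Translation by \<open>2 \<pi> i \<tau>\<close> shifts the index of both series.  Only the two terms with index 0 are left
  over, and they add up to \<open>u / (1 - u) + u^{-1} / (1 - u^{-1}) = - 1\<close>.
\<close>

lemma quasi_elliptic_add_tau:
  assumes "Im \<tau> > 0" "z \<notin> period_lattice \<tau>"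
  shows "quasi_elliptic \<tau> (z + two_pi_i * \<tau>) = quasi_elliptic \<tau> z - 1"
proof -
  define c where "c = two_pi_i * \<tau>"
  define a where "a m = geom_exp (two_pi_i * of_nat m * \<tau> + z)" for m
  define b where "b m = geom_exp (two_pi_i * of_nat m * \<tau> - z)" for m
  have s: "summable a" "summable b"
    using summable_geom_exp[OF assms(1), of z] summable_geom_exp[OF assms(1), of "-z"]
    unfolding a_def[abs_def] b_def[abs_def] by simp_all
  have s1: "summable (\<lambda>m. a (Suc m))" "summable (\<lambda>m. b (Suc m))" "summable (\<lambda>m. a (Suc (Suc m)))"
    using s summable_Suc_iff[of "\<lambda>m. a (Suc m)"] by (simp_all add: summable_Suc_iff)
  have e: "exp z \<noteq> 1" "exp (z + c) \<noteq> 1"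
    using assms(2) exp_eq_1_period_lattice[of 0 \<tau> z] exp_eq_1_period_lattice[of 1 \<tau> z]
    by (auto simp: c_def add.commute)
  have inv: "1 / (exp w - 1) = - 1 - geom_exp w" if "exp w \<noteq> 1" for w :: complex
    using that by (simp add: geom_exp_def divide_simps)
  have "quasi_elliptic \<tau> z = 1 / 2 - 1 - a 0 - (\<Sum>m. a (Suc m) - b (Suc m))"
    unfolding quasi_elliptic_def inv[OF e(1)] a_def b_def by simp
  also have "(\<Sum>m. a (Suc m) - b (Suc m)) = (suminf a - a 0) - (suminf b - b 0)"
    using s s1 by (simp add: suminf_diff[symmetric] suminf_split_head)
  finally have 1: "quasi_elliptic \<tau> z = - 1 / 2 - suminf a + suminf b - b 0" by simp
  have "quasi_elliptic \<tau> (z + c) = 1 / 2 - 1 - a 1 - (\<Sum>m. a (Suc (Suc m)) - b m)"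
    unfolding quasi_elliptic_def inv[OF e(2)] a_def b_def by (simp add: c_def algebra_simps)
  also have "(\<Sum>m. a (Suc (Suc m)) - b m) = (suminf a - a 0 - a 1) - suminf b"
    using s s1 suminf_split_head[of "\<lambda>m. a (Suc m)"] by (simp add: suminf_diff[symmetric] suminf_split_head)
  finally have 2: "quasi_elliptic \<tau> (z + c) = - 1 / 2 - suminf a + suminf b + a 0" by simp
  have "quasi_elliptic \<tau> (z + c) = quasi_elliptic \<tau> z + (a 0 + b 0)" unfolding 1 2 by simp
  also have "a 0 + b 0 = - 1"
    using e(1) by (simp add: a_def b_def geom_exp_def exp_minus divide_simps) (simp add: algebra_simps)
  finally show ?thesis unfolding c_def by simp
qed

lemma quasi_elliptic_add_lattice:
  assumes "Im \<tau> > 0" "z \<notin> period_lattice \<tau>"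
  shows "quasi_elliptic \<tau> (z + (of_int m * (two_pi_i * \<tau>) + of_int n * two_pi_i))
       = quasi_elliptic \<tau> z - of_int m"
proof -
  have nat: "w + of_nat k * (two_pi_i * \<tau>) \<notin> period_lattice \<tau> \<and>
     quasi_elliptic \<tau> (w + of_nat k * (two_pi_i * \<tau>)) = quasi_elliptic \<tau> w - of_nat k"
    if "w \<notin> period_lattice \<tau>" for k :: nat and w
  proof
    have "of_nat k * (two_pi_i * \<tau>) \<in> period_lattice \<tau>" for k
      unfolding period_lattice_def by (rule CollectI, rule exI[of _ "int k"], rule exI[of _ 0]) simp
    then have notin: "w + of_nat k * (two_pi_i * \<tau>) \<notin> period_lattice \<tau>" for k
      using that period_lattice_diff[of "w + of_nat k * (two_pi_i * \<tau>)" \<tau> "of_nat k * (two_pi_i * \<tau>)"]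
      by auto
    then show "w + of_nat k * (two_pi_i * \<tau>) \<notin> period_lattice \<tau>" .
    show "quasi_elliptic \<tau> (w + of_nat k * (two_pi_i * \<tau>)) = quasi_elliptic \<tau> w - of_nat k"
    proof (induction k)
      case (Suc k)
      have "w + of_nat (Suc k) * (two_pi_i * \<tau>)
          = w + of_nat k * (two_pi_i * \<tau>) + two_pi_i * \<tau>" by (simp add: distrib_right)
      then show ?case using quasi_elliptic_add_tau[OF assms(1) notin[of k]] Suc by (simp only: of_nat_Suc) simp
    qed simp
  qed
  have "quasi_elliptic \<tau> (z + of_int m * (two_pi_i * \<tau>)) = quasi_elliptic \<tau> z - of_int m"
  proof (cases "m \<ge> 0")
    case True
    then show ?thesis using nat[OF assms(2), of "nat m"] by simp
  next
    case False
    define w where "w = z + of_int m * (two_pi_i * \<tau>)"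
    have wz: "z = w + of_nat (nat (- m)) * (two_pi_i * \<tau>)" using False by (simp add: w_def)
    have "of_int m * (two_pi_i * \<tau>) \<in> period_lattice \<tau>"
      unfolding period_lattice_def by (rule CollectI, rule exI[of _ m], rule exI[of _ 0]) simp
    then have "w \<notin> period_lattice \<tau>" using assms(2) period_lattice_diff[of w \<tau>] by (force simp: w_def)
    from nat[OF this, of "nat (-m)"] show ?thesis unfolding wz[symmetric] w_def[symmetric] using False by simp
  qed
  then show ?thesis using quasi_elliptic_add_2pi_int by (simp add: add.assoc[symmetric])
qed

section \<open>Eisenstein series as Taylor coefficients\<close>

text \<open>
  The function \<open>z / (exp z - 1) + z / 2\<close> is even, so it is the even part of the generating function of
  the Bernoulli coefficients.  Only the even part matters, since \<open>E_k\<close> is 0 for odd \<open>k\<close>.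
\<close>

lemma bernoulli_even_part:
  fixes z :: complex
  assumes "norm z < 1" "z \<noteq> 0" "exp z \<noteq> 1"
  shows "(\<lambda>k. (if even k then of_real (bernoulli_coeff k) else 0) * z ^ k) sums (z / 2 + z / (exp z - 1))"
proof -
  let ?B = "\<lambda>z::complex. \<Sum>k. of_real (bernoulli_coeff k) * z ^ k"
  have B: "?B w = w / (exp w - 1)" if "norm w < 1" "exp w \<noteq> 1" for w :: complex
    using bernoulli_generating_function(2)[OF that(1)] that(2) by (simp add: field_simps)
  have e': "exp (- z) \<noteq> 1" using assms by (simp add: exp_minus)
  have s: "summable (\<lambda>k. of_real (bernoulli_coeff k) * w ^ k :: complex)" if "norm w < 1" for w :: complex
    using bernoulli_generating_function(1)[OF that] by (rule summable_norm_cancel)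
  have "(\<lambda>k. (of_real (bernoulli_coeff k) * z ^ k + of_real (bernoulli_coeff k) * (- z) ^ k) / 2)
      sums ((?B z + ?B (- z)) / 2)"
    using assms by (intro sums_divide sums_add summable_sums s) auto
  moreover have "(\<lambda>k. (of_real (bernoulli_coeff k) * z ^ k + of_real (bernoulli_coeff k) * (- z) ^ k) / 2)
     = (\<lambda>k. (if even k then of_real (bernoulli_coeff k) else 0) * z ^ k)"
    by (auto simp: power_minus_odd)
  moreover have "(?B z + ?B (- z)) / 2 = z / 2 + z / (exp z - 1)"
  proof -
    have "?B (- z) = z * exp z / (exp z - 1)"
      using assms e' B[of "-z"] by (simp add: exp_minus divide_simps) (simp add: algebra_simps)
    then show ?thesis unfolding B[OF assms(1,3)] using assms(3) by (simp add: field_simps)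
  qed
  ultimately show ?thesis by simp
qed

lemma exp_diff_minus_sums:
  fixes w :: complex
  shows "(\<lambda>j. (if odd j then 2 / fact j else 0) * w ^ j) sums (exp w - exp (- w))"
proof -
  have "(\<lambda>j. w ^ j /\<^sub>R fact j - (- w) ^ j /\<^sub>R fact j) sums (exp w - exp (- w))"
    by (intro sums_diff exp_converges)
  also have "(\<lambda>j. w ^ j /\<^sub>R fact j - (- w) ^ j /\<^sub>R fact j) = (\<lambda>j. (if odd j then 2 / fact j else 0) * w ^ j)"
    by (auto simp: power_minus_odd scaleR_conv_of_real divide_inverse)
  finally show ?thesis .
qed

lemma geom_exp_has_sum:
  assumes "norm (exp w) < 1"
  shows "((\<lambda>n. exp w ^ Suc n) has_sum geom_exp w) UNIV"
proof (rule norm_summable_imp_has_sum)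
  show "summable (\<lambda>n. norm (exp w ^ Suc n))"
    using assms by (simp add: norm_mult norm_power summable_mult summable_geometric)
  show "(\<lambda>n. exp w ^ Suc n) sums geom_exp w"
    using sums_mult[OF geometric_sums[OF assms], of "exp w"] by (simp add: geom_exp_def)
qed

text \<open>
  Pairs \<open>(m, n)\<close> of positive integers correspond to pairs \<open>(N, d)\<close> with \<open>d\<close> a divisor of \<open>N\<close>, through
  \<open>N = m n\<close> and \<open>d = n\<close>.
\<close>

lemma divisor_pairs_has_sum:
  fixes f :: "nat \<Rightarrow> nat \<Rightarrow> complex"
  assumes "((\<lambda>(m, n). f (Suc n) (Suc m * Suc n)) has_sum S) (UNIV \<times> UNIV)"
  shows "((\<lambda>N. \<Sum>d | d dvd Suc N. f d (Suc N)) has_sum S) UNIV"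
proof -
  have "((\<lambda>(m, n). f (Suc n) (Suc m * Suc n)) has_sum S) (UNIV \<times> UNIV)
    = ((\<lambda>(N, d). f d (Suc N)) has_sum S) (SIGMA N:UNIV. {d. d dvd Suc N})"
  proof (rule has_sum_reindex_bij_witness[where i = "\<lambda>(N, d). (Suc N div d - 1, d - 1)"
        and j = "\<lambda>(m, n). (Suc m * Suc n - 1, Suc n)"])
    fix b assume "b \<in> (SIGMA N:UNIV. {d. d dvd Suc N})"
    then obtain N d where b: "b = (N, d)" "d dvd Suc N" by auto
    then obtain e where e: "Suc N = d * e" by (auto elim: dvdE)
    then obtain d' e' where de: "d = Suc d'" "e = Suc e'" by (cases d; cases e) auto
    have "Suc N div d = e" "Suc e' * Suc d' - 1 = N" using e unfolding de by (simp_all del: mult_Suc mult_Suc_right add: mult.commute[of "Suc e'"])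
    then show "(case (case b of (N, d) \<Rightarrow> (Suc N div d - 1, d - 1)) of (m, n) \<Rightarrow> (Suc m * Suc n - 1, Suc n)) = b"
      unfolding b(1) by (simp add: de del: mult_Suc mult_Suc_right)
  next
    fix a :: "nat \<times> nat" assume "a \<in> UNIV \<times> UNIV"
    obtain m n where a: "a = (m, n)" by (cases a)
    have "Suc (Suc m * Suc n - 1) = Suc m * Suc n" by simp
    then show "(case (case a of (m, n) \<Rightarrow> (Suc m * Suc n - 1, Suc n)) of (N, d) \<Rightarrow> (Suc N div d - 1, d - 1)) = a"
      "(case a of (m, n) \<Rightarrow> (Suc m * Suc n - 1, Suc n)) \<in> (SIGMA N:UNIV. {d. d dvd Suc N})"
      "(case (case a of (m, n) \<Rightarrow> (Suc m * Suc n - 1, Suc n)) of (N, d) \<Rightarrow> f d (Suc N)) = (case a of (m, n) \<Rightarrow> f (Suc n) (Suc m * Suc n))"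
      unfolding a prod.case by (simp_all del: mult_Suc mult_Suc_right)
  qed auto
  with assms have "((\<lambda>(N, d). f d (Suc N)) has_sum S) (SIGMA N:UNIV. {d. d dvd Suc N})" by simp
  then show ?thesis
    by (rule has_sum_SigmaD) (auto intro!: has_sum_finite)
qed

text \<open>
  Expanding first the geometric series and then the exponentials turns the sum in the definition of
  \<open>quasi_elliptic\<close> into a triple series.  Absolute convergence for small \<open>z\<close> is what permits summing it
  in another order.
\<close>

lemma quasi_elliptic_triple_sum:
  fixes z \<tau> :: complex
  defines "q \<equiv> exp (two_pi_i * \<tau>)"
  defines "T \<equiv> \<lambda>(m, n) j. q ^ (Suc m * Suc n) * ((if odd j then 2 / fact j else 0) * (of_nat (Suc n) * z) ^ j)"
  assumes conv: "norm q * exp (norm z) < 1"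
  obtains S where "((\<lambda>(p, j). T p j) has_sum S) ((UNIV \<times> UNIV) \<times> UNIV)"
proof -
  define r where "r = norm q"
  define E where "E = exp (norm z)"
  have rE: "r * E < 1" "1 \<le> E" using conv by (auto simp: r_def E_def)
  have r0: "0 < r" by (simp add: r_def q_def)
  have r1: "r < 1" using rE r0 by (smt (verit) mult_left_le mult_le_cancel_left1)
  define x where "x m = r ^ Suc m * E" for m
  have x: "0 < x m" "x m \<le> r * E" "x m < 1" for m
  proof -
    show "0 < x m" using r0 rE by (simp add: x_def)
    have "r ^ Suc m \<le> r" using r0 r1 by (simp add: mult_left_le power_le_one)
    then show "x m \<le> r * E" using rE by (simp add: x_def mult_right_mono)
    then show "x m < 1" using rE by linarith
  qed
  define P where "P = (\<lambda>(m, n). r ^ (Suc m * Suc n) * (2 * exp (real (Suc n) * norm z)))"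
  have P: "P (m, n) = 2 * x m ^ Suc n" for m n
    unfolding P_def x_def E_def power_mult_distrib power_mult exp_of_nat_mult[symmetric] prod.case by simp
  have "P summable_on (UNIV \<times> UNIV)"
  proof (rule summable_on_SigmaI)
    fix m :: nat
    have "(\<lambda>n. 2 * x m ^ Suc n) sums (2 * x m * (1 / (1 - x m)))"
      using sums_mult[OF geometric_sums[of "x m"], of "2 * x m"] x[of m] by (simp add: mult_ac)
    then show "((\<lambda>n. P (m, n)) has_sum (2 * x m * (1 / (1 - x m)))) UNIV"
      unfolding P using x(1)[of m] by (intro sums_nonneg_imp_has_sum) (auto intro: less_imp_le)
  next
    have "(\<lambda>m. 2 * E * (1 / (1 - r * E)) * r ^ Suc m) summable_on UNIV"
      using r0 r1 rE by (intro norm_summable_imp_summable_on)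
        (simp add: norm_mult norm_power abs_mult summable_mult summable_geometric)
    then show "(\<lambda>m. 2 * x m * (1 / (1 - x m))) summable_on UNIV"
    proof (rule summable_on_comparison_test)
      fix m
      have "2 * x m * (1 / (1 - x m)) \<le> 2 * x m * (1 / (1 - r * E))"
        using x[of m] rE by (intro mult_left_mono divide_left_mono) auto
      then show "2 * x m * (1 / (1 - x m)) \<le> 2 * E * (1 / (1 - r * E)) * r ^ Suc m"
        by (simp add: x_def mult_ac)
      show "0 \<le> 2 * x m * (1 / (1 - x m))" using x[of m] by simp
    qed
  next
    fix m n show "0 \<le> P (m, n)" using x(1)[of m] by (simp add: P)
  qed
  moreover have "((\<lambda>j. r ^ (Suc (fst p) * Suc (snd p)) * (2 * ((real (Suc (snd p)) * norm z) ^ j /\<^sub>R fact j))) has_sum P p) UNIV" for p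
    unfolding P_def case_prod_unfold using r0
    by (intro sums_nonneg_imp_has_sum sums_mult exp_converges) auto
  ultimately have "(\<lambda>(p, j). r ^ (Suc (fst p) * Suc (snd p)) * (2 * ((real (Suc (snd p)) * norm z) ^ j /\<^sub>R fact j)))
     summable_on ((UNIV \<times> UNIV) \<times> UNIV)"
    using r0 by (intro summable_on_SigmaI[where g = P]) auto
  then have "(\<lambda>(p, j). T p j) summable_on ((UNIV \<times> UNIV) \<times> UNIV)"
  proof (rule abs_summable_summable[OF Infinite_Sum.abs_summable_on_comparison_test'])
    fix y :: "(nat \<times> nat) \<times> nat"
    obtain m n j where y: "y = ((m, n), j)" by (metis prod.collapse)
    have "norm (T (m, n) j) \<le> r ^ (Suc m * Suc n) * (2 * ((real (Suc n) * norm z) ^ j / fact j))"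
      unfolding T_def prod.case norm_mult norm_power r_def
      by (intro mult_left_mono) (auto simp: norm_mult norm_power norm_divide simp del: of_nat_Suc)
    then show "norm (case y of (p, j) \<Rightarrow> T p j) \<le> (case y of (p, j) \<Rightarrow> r ^ (Suc (fst p) * Suc (snd p)) * (2 * ((real (Suc (snd p)) * norm z) ^ j /\<^sub>R fact j)))"
      by (simp add: y divide_inverse mult_ac)
  qed
  then show thesis using that unfolding summable_on_def by blast
qed

text \<open>
  The triple series is summed in two ways.  Summation over \<open>j\<close> first gives back the function; summation
  over \<open>(m, n)\<close> first gives, for each \<open>j\<close>, the divisor sums of the Eisenstein series of weight
  \<open>j + 1\<close>.  The remaining part \<open>1/2 + 1 / (exp z - 1)\<close> supplies the Bernoulli numbers.
\<close>

lemma quasi_elliptic_expansion: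
  assumes "Im \<tau> > 0" "norm z < min 1 (Im \<tau>)" "z \<noteq> 0"
  shows "(\<lambda>k. - eisenstein_E (Suc k) \<tau> * z ^ k) sums (quasi_elliptic \<tau> z - 1 / z)"
proof -
  define q where "q = exp (two_pi_i * \<tau>)"
  define c where "c j = (if odd j then 2 / fact j else 0 :: complex)" for j :: nat
  define T where "T = (\<lambda>(m, n) j. q ^ (Suc m * Suc n) * (c j * (of_nat (Suc n) * z) ^ j))"
  have ez: "exp z \<noteq> 1"
  proof
    assume "exp z = 1"
    then have "z \<in> period_lattice \<tau>" using exp_eq_1_period_lattice[of 0 \<tau> z] by simp
    note period_lattice_norm_ge[OF assms(1) this assms(3)]
    moreover have "2 * pi * min 1 (Im \<tau>) \<ge> 1 * min 1 (Im \<tau>)"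
      using assms(1) pi_gt3 by (intro mult_right_mono) auto
    ultimately show False using assms(2) by linarith
  qed
  have nq: "norm q = exp (- (2 * pi * Im \<tau>))" unfolding q_def by (simp add: norm_exp_eq_Re)
  have "norm z < 2 * pi * Im \<tau>"
  proof -
    have "1 * Im \<tau> \<le> 2 * pi * Im \<tau>" using assms(1) pi_gt3 by (intro mult_right_mono) auto
    then show ?thesis using assms(2) by simp
  qed
  then have conv: "norm q * exp (norm z) < 1" unfolding nq exp_add[symmetric] by simp
  obtain S where S: "((\<lambda>(p, j). T p j) has_sum S) ((UNIV \<times> UNIV) \<times> UNIV)"
    using quasi_elliptic_triple_sum[OF conv[unfolded q_def]] unfolding T_def c_def q_def by blast
  have c_sums: "((\<lambda>j. c j * w ^ j) has_sum (exp w - exp (- w))) UNIV" for w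
  proof (rule norm_summable_imp_has_sum)
    show "(\<lambda>j. c j * w ^ j) sums (exp w - exp (- w))" unfolding c_def by (rule exp_diff_minus_sums)
    show "summable (\<lambda>j. norm (c j * w ^ j))"
      by (rule summable_comparison_test'[OF summable_mult[OF summable_norm_exp[of w], of 2]])
         (simp add: c_def norm_mult norm_power norm_divide norm_inverse divide_inverse)
  qed
  \<comment> \<open>Summation over \<open>j\<close>, then \<open>n\<close>, then \<open>m\<close>.\<close>
  have "((\<lambda>(m, n). q ^ (Suc m * Suc n) * (exp (of_nat (Suc n) * z) - exp (- (of_nat (Suc n) * z)))) has_sum S) (UNIV \<times> UNIV)"
    by (rule has_sum_SigmaD[OF S]) (auto simp: T_def simp del: of_nat_Suc intro!: has_sum_cmult_right c_sums)
  then have "((\<lambda>m. geom_exp (two_pi_i * of_nat (Suc m) * \<tau> + z)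
         - geom_exp (two_pi_i * of_nat (Suc m) * \<tau> - z)) has_sum S) UNIV"
  proof (rule has_sum_SigmaD)
    fix m :: nat
    define w where "w = two_pi_i * of_nat (Suc m) * \<tau>"
    have w: "exp w = q ^ Suc m" unfolding w_def q_def exp_of_nat_mult[symmetric] by (simp only: mult_ac)
    have "norm (exp w) \<le> norm q"
      unfolding w norm_power using assms(1) nq by (auto simp: mult_left_le power_le_one)
    then have nw: "norm (exp (w + z)) < 1" "norm (exp (w - z)) < 1"
    proof -
      have "norm (exp (w + v)) \<le> norm q * exp (norm z)" if "norm v = norm z" for v
        unfolding exp_add norm_mult norm_exp_eq_Re[of v] using \<open>norm (exp w) \<le> norm q\<close> complex_Re_le_cmod[of v] that
        by (intro mult_mono) auto
      note le_less_trans[OF this conv]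
      from this[of z] this[of "-z"] show "norm (exp (w + z)) < 1" "norm (exp (w - z)) < 1" by (simp_all del: norm_exp_eq_Re)
    qed
    have "((\<lambda>n. exp (w + z) ^ Suc n - exp (w - z) ^ Suc n) has_sum (geom_exp (w + z) - geom_exp (w - z))) UNIV"
      using has_sum_add[OF geom_exp_has_sum[OF nw(1)] has_sum_cmult_right[OF geom_exp_has_sum[OF nw(2)], of "-1"]]
      by simp
    moreover have "exp (w + v) ^ Suc n = q ^ (Suc m * Suc n) * exp (of_nat (Suc n) * v)" for n v
      unfolding exp_add power_mult_distrib w power_mult exp_of_nat_mult[symmetric] ..
    from this[of z] this[of "-z"] have "exp (w + z) ^ Suc n - exp (w - z) ^ Suc n
       = q ^ (Suc m * Suc n) * (exp (of_nat (Suc n) * z) - exp (- (of_nat (Suc n) * z)))" for n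
      by (simp only: right_diff_distrib) simp
    ultimately show "((\<lambda>n. case (m, n) of (m, n) \<Rightarrow> q ^ (Suc m * Suc n) * (exp (of_nat (Suc n) * z) - exp (- (of_nat (Suc n) * z))))
       has_sum (geom_exp (two_pi_i * of_nat (Suc m) * \<tau> + z)
         - geom_exp (two_pi_i * of_nat (Suc m) * \<tau> - z))) UNIV"
      unfolding w_def[symmetric] prod.case by simp
  qed
  then have 1: "(\<Sum>m. geom_exp (two_pi_i * of_nat (Suc m) * \<tau> + z)
         - geom_exp (two_pi_i * of_nat (Suc m) * \<tau> - z)) = S"
    by (simp add: has_sum_imp_sums sums_unique[symmetric])
  \<comment> \<open>Summation over \<open>(m, n)\<close>, then \<open>j\<close>.\<close>
  have sw: "((\<lambda>(j, p). T p j) has_sum S) (UNIV \<times> (UNIV \<times> UNIV))"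
    using S by (subst (asm) has_sum_swap) (simp add: case_prod_unfold)
  have inner: "((\<lambda>p. T p j) has_sum (c j * z ^ j * (\<Sum>m. eisenstein_term (Suc j) \<tau> m))) (UNIV \<times> UNIV)" for j
  proof -
    have "(\<lambda>p. T p j) summable_on (UNIV \<times> UNIV)"
      using summable_on_SigmaD1[of "\<lambda>j p. T p j" UNIV "\<lambda>_. UNIV \<times> UNIV" j] sw unfolding summable_on_def by auto
    then obtain s where s: "((\<lambda>p. T p j) has_sum s) (UNIV \<times> UNIV)" unfolding summable_on_def by blast
    then have "((\<lambda>(m, n). q ^ (Suc m * Suc n) * (c j * (of_nat (Suc n) * z) ^ j)) has_sum s) (UNIV \<times> UNIV)"
      unfolding T_def by (simp add: case_prod_unfold)
    from divisor_pairs_has_sum[of "\<lambda>d N. q ^ N * (c j * (of_nat d * z) ^ j)", OF this]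
    have "((\<lambda>N. \<Sum>d | d dvd Suc N. q ^ Suc N * (c j * (of_nat d * z) ^ j)) has_sum s) UNIV" .
    also have "(\<lambda>N. \<Sum>d | d dvd Suc N. q ^ Suc N * (c j * (of_nat d * z) ^ j)) = (\<lambda>N. c j * z ^ j * eisenstein_term (Suc j) \<tau> N)"
    proof
      fix N
      have "q ^ Suc N = exp (two_pi_i * of_nat (Suc N) * \<tau>)"
        unfolding q_def exp_of_nat_mult[symmetric] by (simp only: mult_ac)
      then show "(\<Sum>d | d dvd Suc N. q ^ Suc N * (c j * (of_nat d * z) ^ j)) = c j * z ^ j * eisenstein_term (Suc j) \<tau> N"
        unfolding eisenstein_term_def divisor_sum_def
        by (simp add: power_mult_distrib sum_distrib_left sum_distrib_right mult_ac del: power_Suc of_nat_Suc)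
    qed
    finally have "(\<lambda>N. c j * z ^ j * eisenstein_term (Suc j) \<tau> N) sums s" by (rule has_sum_imp_sums)
    moreover have "(\<lambda>N. c j * z ^ j * eisenstein_term (Suc j) \<tau> N) sums (c j * z ^ j * (\<Sum>m. eisenstein_term (Suc j) \<tau> m))"
      using assms by (intro sums_mult summable_sums summable_eisenstein_term) auto
    ultimately show ?thesis using s sums_unique2 by blast
  qed
  have "((\<lambda>j. c j * z ^ j * (\<Sum>m. eisenstein_term (Suc j) \<tau> m)) has_sum S) UNIV"
    by (rule has_sum_SigmaD[OF sw]) (use inner in auto)
  then have 2: "(\<lambda>j. c j * z ^ j * (\<Sum>m. eisenstein_term (Suc j) \<tau> m)) sums S" by (rule has_sum_imp_sums)
  define a where "a k = (if even k then of_real (bernoulli_coeff k) else 0 :: complex)" for k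
  have "a 0 = 1" using bernoulli_coeff_recurrence[of 0] by (simp add: a_def)
  have "(\<lambda>k. a k * z ^ k) sums (z / 2 + z / (exp z - 1))"
    unfolding a_def using assms ez by (intro bernoulli_even_part) auto
  then have "(\<lambda>k. a (Suc k) * z ^ Suc k) sums (z / 2 + z / (exp z - 1) - 1)"
    using \<open>a 0 = 1\<close> by (subst sums_Suc_iff) simp
  then have "(\<lambda>k. a (Suc k) * z ^ Suc k / z) sums ((z / 2 + z / (exp z - 1) - 1) / z)"
    by (rule sums_divide)
  then have 3: "(\<lambda>k. a (Suc k) * z ^ k) sums (1 / 2 + 1 / (exp z - 1) - 1 / z)"
    using assms(3) by (simp add: add_divide_distrib diff_divide_distrib)
  have "(\<lambda>k. a (Suc k) * z ^ k - c k * z ^ k * (\<Sum>m. eisenstein_term (Suc k) \<tau> m))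
     sums (1 / 2 + 1 / (exp z - 1) - 1 / z - S)"
    by (rule sums_diff[OF 3 2])
  also have "1 / 2 + 1 / (exp z - 1) - 1 / z - S = quasi_elliptic \<tau> z - 1 / z"
    unfolding quasi_elliptic_def 1 by simp
  also have "(\<lambda>k. a (Suc k) * z ^ k - c k * z ^ k * (\<Sum>m. eisenstein_term (Suc k) \<tau> m))
      = (\<lambda>k. - eisenstein_E (Suc k) \<tau> * z ^ k)"
  proof
    fix k
    show "a (Suc k) * z ^ k - c k * z ^ k * (\<Sum>m. eisenstein_term (Suc k) \<tau> m) = - eisenstein_E (Suc k) \<tau> * z ^ k"
    proof (cases "even k")
      case True
      then show ?thesis by (simp add: a_def c_def eisenstein_E_def)
    next
      case False
      then have "even (Suc k)" by simp
      then show ?thesis using False unfolding eisenstein_E_even[OF \<open>even (Suc k)\<close>]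
        by (simp add: a_def c_def algebra_simps)
    qed
  qed
  finally show ?thesis .
qed

section \<open>The modular transformation of Eisenstein series\<close>

lemma Im_moebius_int:
  fixes a b c d :: int
  assumes "a * d - b * c = 1" "Im \<tau> > 0"
  shows "of_int c * \<tau> + of_int d \<noteq> 0"
    and "Im ((of_int a * \<tau> + of_int b) / (of_int c * \<tau> + of_int d)) = Im \<tau> / (norm (of_int c * \<tau> + of_int d))\<^sup>2"
proof -
  show "of_int c * \<tau> + of_int d \<noteq> 0"
  proof
    assume *: "of_int c * \<tau> + of_int d = 0"
    then have "Im (of_int c * \<tau> + of_int d) = 0" by simp
    then have "c = 0" using assms by simp
    then have "d = 0" using * by simp
    then show False using \<open>c = 0\<close> assms by simp
  qed
  have "real_of_int a * real_of_int d - real_of_int b * real_of_int c = 1"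
    using assms(1) by (metis of_int_1 of_int_diff of_int_mult)
  then have "(real_of_int a * Im \<tau>) * (real_of_int c * Re \<tau> + real_of_int d) - (real_of_int a * Re \<tau> + real_of_int b) * (real_of_int c * Im \<tau>) = Im \<tau>"
    by (simp add: algebra_simps)
  then show "Im ((of_int a * \<tau> + of_int b) / (of_int c * \<tau> + of_int d)) = Im \<tau> / (norm (of_int c * \<tau> + of_int d))\<^sup>2"
    unfolding Im_divide cmod_power2 by simp
qed

text \<open>
  The lattice of \<open>\<tau>' = (a \<tau> + b) / j\<close> is the lattice of \<open>\<tau>\<close> divided by \<open>j\<close>.  The first part gives the new
  coordinates of a lattice vector, which decide how the quasi-periods transform.
\<close>

lemma period_lattice_moebius:
  fixes a b c d :: int
  assumes "a * d - b * c = 1" "Im \<tau> > 0"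
  defines "j \<equiv> of_int c * \<tau> + of_int d"
  shows "(of_int m * (two_pi_i * \<tau>) + of_int n * two_pi_i) / j
     = of_int (d * m - c * n) * (two_pi_i * ((of_int a * \<tau> + of_int b) / j))
       + of_int (a * n - b * m) * two_pi_i"
    and "z / j \<in> period_lattice ((of_int a * \<tau> + of_int b) / j) \<longleftrightarrow> z \<in> period_lattice \<tau>"
proof -
  have j: "j \<noteq> 0" unfolding j_def using Im_moebius_int(1)[OF assms(1,2)] .
  have det: "of_int a * of_int d - of_int b * of_int c = (1 :: complex)"
    using assms(1) by (metis of_int_1 of_int_diff of_int_mult)
  have *: "of_int m * \<tau> + of_int n = of_int (d * m - c * n) * (of_int a * \<tau> + of_int b) + of_int (a * n - b * m) * j" for m n :: int
  proof -
    have "of_int (d * m - c * n) * (of_int a * \<tau> + of_int b) + of_int (a * n - b * m) * j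
       = (of_int a * of_int d - of_int b * of_int c) * (of_int m * \<tau> + of_int n)"
      unfolding j_def by (simp add: algebra_simps)
    then show ?thesis using det by simp
  qed
  show 1: "(of_int m * (two_pi_i * \<tau>) + of_int n * two_pi_i) / j
     = of_int (d * m - c * n) * (two_pi_i * ((of_int a * \<tau> + of_int b) / j))
       + of_int (a * n - b * m) * two_pi_i" for m n
  proof -
    have "(of_int m * (two_pi_i * \<tau>) + of_int n * two_pi_i) / j
        = two_pi_i * (of_int m * \<tau> + of_int n) / j" by (simp add: algebra_simps)
    also have "\<dots> = two_pi_i * (of_int (d * m - c * n) * ((of_int a * \<tau> + of_int b) / j) + of_int (a * n - b * m))"
      unfolding *[of m n] using j by (simp add: field_simps)
    finally show ?thesis by (simp only: distrib_left mult_ac)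
  qed
  show "z / j \<in> period_lattice ((of_int a * \<tau> + of_int b) / j) \<longleftrightarrow> z \<in> period_lattice \<tau>"
  proof
    assume "z \<in> period_lattice \<tau>"
    then obtain m n :: int where "z = of_int m * (two_pi_i * \<tau>) + of_int n * two_pi_i"
      unfolding period_lattice_def by blast
    then show "z / j \<in> period_lattice ((of_int a * \<tau> + of_int b) / j)"
      unfolding period_lattice_def using 1 by blast
  next
    assume "z / j \<in> period_lattice ((of_int a * \<tau> + of_int b) / j)"
    then obtain k l :: int where kl: "z / j = of_int k * (two_pi_i * ((of_int a * \<tau> + of_int b) / j)) + of_int l * two_pi_i"
      unfolding period_lattice_def by blast
    have "d * (a * k + c * l) - c * (b * k + d * l) = (a * d - b * c) * k" "a * (b * k + d * l) - b * (a * k + c * l) = (a * d - b * c) * l"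
      by (simp_all add: algebra_simps)
    then have "(of_int (a * k + c * l) * (two_pi_i * \<tau>) + of_int (b * k + d * l) * two_pi_i) / j = z / j"
      unfolding 1 kl assms(1) by simp
    then have "z = of_int (a * k + c * l) * (two_pi_i * \<tau>) + of_int (b * k + d * l) * two_pi_i"
      using j by simp
    then show "z \<in> period_lattice \<tau>" unfolding period_lattice_def by blast
  qed
qed

lemma period_lattice_reduce:
  assumes "Im \<tau> > 0"
  obtains w where "w \<in> period_lattice \<tau>" "norm (z - w) \<le> 2 * pi * (norm \<tau> + 1)"
proof -
  define s where "s = Im (z / two_pi_i) / Im \<tau>"
  define t where "t = Re (z / two_pi_i) - s * Re \<tau>"
  have "z / two_pi_i = of_real s * \<tau> + of_real t"
    using assms by (intro complex_eqI) (simp_all add: s_def t_def)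
  then have z: "z = two_pi_i * (of_real s * \<tau> + of_real t)" by (simp add: divide_simps mult_ac)
  define w where "w = of_int \<lfloor>s\<rfloor> * (two_pi_i * \<tau>) + of_int \<lfloor>t\<rfloor> * two_pi_i"
  have "z - w = two_pi_i * (of_real (frac s) * \<tau> + of_real (frac t))"
    unfolding z w_def frac_def by (simp add: algebra_simps)
  moreover have "norm (of_real (frac s) * \<tau> + of_real (frac t)) \<le> norm \<tau> + 1"
    using frac_ge_0[of s] frac_lt_1[of s] frac_ge_0[of t] frac_lt_1[of t]
    by (intro norm_triangle_le add_mono) (auto simp: norm_mult mult_left_le_one_le)
  ultimately have "norm (z - w) \<le> 2 * pi * (norm \<tau> + 1)" by (simp add: norm_mult mult_left_mono)
  moreover have "w \<in> period_lattice \<tau>" unfolding period_lattice_def w_def by blast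
  ultimately show thesis using that by blast
qed

lemma entire_lattice_periodic_constant:
  assumes "Im \<tau> > 0" and hol: "f holomorphic_on UNIV"
    and per: "\<And>z w. w \<in> period_lattice \<tau> \<Longrightarrow> f (z - w) = f z"
  shows "f z = f 0"
proof -
  have "compact (f ` cball 0 (2 * pi * (norm \<tau> + 1)))"
    using hol by (intro compact_continuous_image holomorphic_on_imp_continuous_on) (auto intro: holomorphic_on_subset)
  moreover have "range f \<subseteq> f ` cball 0 (2 * pi * (norm \<tau> + 1))"
  proof
    fix y assume "y \<in> range f"
    then obtain z where z: "y = f z" by blast
    obtain w where "w \<in> period_lattice \<tau>" "norm (z - w) \<le> 2 * pi * (norm \<tau> + 1)"
      using period_lattice_reduce[OF assms(1)] .
    then show "y \<in> f ` cball 0 (2 * pi * (norm \<tau> + 1))"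
      unfolding z using per[of w z, symmetric] by (auto intro!: imageI)
  qed
  ultimately have "bounded (range f)" using bounded_subset compact_imp_bounded by blast
  with hol have "f constant_on UNIV" by (rule Liouville_theorem)
  then show ?thesis unfolding constant_on_def by auto
qed

text \<open>
  Both \<open>quasi_elliptic \<tau>' (z / j)\<close> and \<open>j * quasi_elliptic \<tau> z\<close> have the principal part \<open>j / z\<close> at 0.  The
  quasi-periods of their difference are those of the linear function \<open>c z / (2 \<pi> i)\<close>.  Hence the
  difference minus this function extends to an entire doubly periodic function, which is constant,
  and its Taylor coefficients at 0 vanish.  The linear function accounts for the anomaly in weight 2.
\<close>

lemma eisenstein_modular:
  fixes a b c d :: int
  assumes det: "a * d - b * c = 1" and \<tau>: "Im \<tau> > 0"
  defines "j \<equiv> of_int c * \<tau> + of_int d"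
  shows "eisenstein_E (Suc k) ((of_int a * \<tau> + of_int b) / j)
    = j ^ Suc k * eisenstein_E (Suc k) \<tau> - (if k = 1 then of_int c * j / two_pi_i else 0)"
proof -
  define \<tau>' where "\<tau>' = (of_int a * \<tau> + of_int b) / j"
  let ?L = "period_lattice \<tau>"
  let ?c = "of_int c / two_pi_i :: complex"
  have j: "j \<noteq> 0" unfolding j_def by (rule Im_moebius_int(1)[OF det \<tau>])
  have \<tau>': "Im \<tau>' > 0" unfolding \<tau>'_def j_def Im_moebius_int(2)[OF det \<tau>] using j \<tau> by (simp add: j_def)
  have lat: "z / j \<in> period_lattice \<tau>' \<longleftrightarrow> z \<in> ?L" for z
    unfolding \<tau>'_def j_def by (rule period_lattice_moebius(2)[OF det \<tau>])
  define h where "h z = quasi_elliptic \<tau>' (z / j) - j * quasi_elliptic \<tau> z - ?c * z" for z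
  \<comment> \<open>At lattice points 0 is the right value: the Taylor series of \<open>h\<close> at 0 has no constant term,
     because \<open>E_1\<close> is 0.\<close>
  define f where "f z = (if z \<in> ?L then 0 else h z)" for z
  have per: "f (z + w) = f z" if "w \<in> ?L" for z w
  proof -
    obtain m n :: int where w: "w = of_int m * (two_pi_i * \<tau>) + of_int n * two_pi_i"
      using \<open>w \<in> ?L\<close> unfolding period_lattice_def by blast
    have "z + w \<in> ?L \<longleftrightarrow> z \<in> ?L"
      using that period_lattice_diff[of "z + w" \<tau> w] period_lattice_diff[of z \<tau> "-w"]
        uminus_period_lattice[of "-w" \<tau>] by auto
    moreover have "h (z + w) = h z" if "z \<notin> ?L"
    proof -
      have wj: "w / j = of_int (d * m - c * n) * (two_pi_i * \<tau>') + of_int (a * n - b * m) * two_pi_i"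
        unfolding w \<tau>'_def j_def by (rule period_lattice_moebius(1)[OF det \<tau>])
      have q1: "quasi_elliptic \<tau>' ((z + w) / j) = quasi_elliptic \<tau>' (z / j) - of_int (d * m - c * n)"
        unfolding add_divide_distrib wj using that lat by (intro quasi_elliptic_add_lattice \<tau>') auto
      have q2: "quasi_elliptic \<tau> (z + w) = quasi_elliptic \<tau> z - of_int m"
        unfolding w using that by (intro quasi_elliptic_add_lattice \<tau>) auto
      have q3: "?c * w = of_int c * (of_int m * \<tau> + of_int n)" unfolding w by (simp add: field_simps)
      show ?thesis unfolding h_def distrib_left[of ?c] q1 q2 q3 by (simp add: j_def algebra_simps)
    qed
    ultimately show ?thesis by (simp add: f_def)
  qed
  have per': "f (z - w) = f z" if "w \<in> ?L" for z w using per[of w "z - w"] that by simp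
  define D where "D = Abs_fps (\<lambda>k. j * eisenstein_E (Suc k) \<tau> - eisenstein_E (Suc k) \<tau>' / j ^ k - (if k = 1 then ?c else 0))"
  \<comment> \<open>Within this radius the expansions at \<open>z\<close> and at \<open>z / j\<close> are both available.\<close>
  define r where "r = min (min 1 (Im \<tau>)) (min 1 (Im \<tau>') * norm j)"
  have r: "r > 0" using \<tau> \<tau>' j by (simp add: r_def)
  have D_sums: "(\<lambda>k. fps_nth D k * z ^ k) sums f z" if "norm z < r" for z
  proof (cases "z = 0")
    case True
    then have "(\<lambda>k. fps_nth D k * z ^ k) = (\<lambda>k. if k = 0 then 0 else 0)"
      by (auto simp: D_def eisenstein_E_def)
    then show ?thesis using True by (simp add: f_def)
  next
    case False
    have "z \<notin> ?L"
    proof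
      assume "z \<in> ?L"
      from period_lattice_norm_ge[OF \<tau> this False] have "2 * pi * min 1 (Im \<tau>) \<le> norm z" .
      moreover have "2 * pi * min 1 (Im \<tau>) \<ge> 1 * min 1 (Im \<tau>)"
        using \<tau> pi_gt3 by (intro mult_right_mono) auto
      moreover have "norm z < min 1 (Im \<tau>)" using that by (simp add: r_def)
      ultimately show False by linarith
    qed
    have "norm z < min 1 (Im \<tau>') * norm j" using that by (simp add: r_def)
    then have "norm (z / j) < min 1 (Im \<tau>')"
      unfolding norm_divide using j by (subst divide_less_eq) auto
    then have "(\<lambda>k. - eisenstein_E (Suc k) \<tau>' * (z / j) ^ k) sums (quasi_elliptic \<tau>' (z / j) - 1 / (z / j))"
      using \<tau>' False j by (intro quasi_elliptic_expansion) auto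
    moreover have "(\<lambda>k. - eisenstein_E (Suc k) \<tau> * z ^ k) sums (quasi_elliptic \<tau> z - 1 / z)"
      using \<tau> False that by (intro quasi_elliptic_expansion) (auto simp: r_def)
    moreover have "(\<lambda>k. (if k = 1 then ?c else 0) * z ^ k) sums (?c * z)"
      using sums_single[of 1 "\<lambda>k. ?c * z ^ k"] by (simp add: if_distrib[of "\<lambda>x. x * _"] cong: if_cong)
    ultimately have "(\<lambda>k. - eisenstein_E (Suc k) \<tau>' * (z / j) ^ k - j * (- eisenstein_E (Suc k) \<tau> * z ^ k) - (if k = 1 then ?c else 0) * z ^ k)
      sums (quasi_elliptic \<tau>' (z / j) - 1 / (z / j) - j * (quasi_elliptic \<tau> z - 1 / z) - ?c * z)"
      by (intro sums_diff sums_mult)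
    also have "quasi_elliptic \<tau>' (z / j) - 1 / (z / j) - j * (quasi_elliptic \<tau> z - 1 / z) - ?c * z = h z"
      using False j by (simp add: h_def field_simps)
    also have "(\<lambda>k. - eisenstein_E (Suc k) \<tau>' * (z / j) ^ k - j * (- eisenstein_E (Suc k) \<tau> * z ^ k) - (if k = 1 then ?c else 0) * z ^ k)
      = (\<lambda>k. fps_nth D k * z ^ k)"
      by (auto simp: D_def power_divide algebra_simps)
    finally show ?thesis using \<open>z \<notin> ?L\<close> by (simp add: f_def)
  qed
  have rad: "fps_conv_radius D \<ge> r / 2"
  proof -
    have "summable (\<lambda>k. fps_nth D k * of_real (r / 2) ^ k)"
      using D_sums[of "of_real (r / 2)"] r by (auto simp: sums_iff)
    then have "fps_conv_radius D \<ge> norm (of_real (r / 2) :: complex)"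
      unfolding fps_conv_radius_def by (rule conv_radius_geI)
    then show ?thesis using r by simp
  qed
  have rad0: "fps_conv_radius D > 0" using rad r by (metis ereal_less(2) half_gt_zero less_le_trans)
  have eval: "eval_fps D z = f z" if "norm z < r" for z
    using D_sums[OF that] by (simp add: eval_fps_def sums_iff)
  have hol0: "f holomorphic_on ball 0 (r / 2)"
  proof -
    have "eval_fps D holomorphic_on ball 0 (r / 2)"
    proof (intro holomorphic_on_eval_fps subsetI)
      fix z :: complex assume "z \<in> ball 0 (r / 2)"
      then have "ereal (norm z) < ereal (r / 2)" by simp
      from less_le_trans[OF this] rad show "z \<in> eball 0 (fps_conv_radius D)" by (simp add: in_eball_iff)
    qed
    then show ?thesis by (rule holomorphic_transform) (use eval r in auto)
  qed
  have "f holomorphic_on UNIV"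
  proof -
    have "f field_differentiable at z" for z
    proof (cases "z \<in> ?L")
      case True
      have "f field_differentiable at 0"
        using hol0 r by (intro holomorphic_on_imp_differentiable_at[of _ "ball 0 (r / 2)"]) auto
      then have "(f \<circ> (\<lambda>u. u - z)) field_differentiable at z"
        by (intro field_differentiable_compose derivative_intros) simp
      also have "f \<circ> (\<lambda>u. u - z) = f" using per' True by auto
      finally show ?thesis .
    next
      case False
      have "h holomorphic_on - ?L"
      proof -
        have "(\<lambda>z. quasi_elliptic \<tau>' (z / j)) holomorphic_on - ?L"
        proof (rule holomorphic_on_compose_gen[of _ _ "quasi_elliptic \<tau>'", unfolded o_def])
          show "(\<lambda>z. z / j) holomorphic_on - ?L" using j by (intro holomorphic_intros) auto
        qed (use quasi_elliptic_holomorphic[OF \<tau>'] lat in auto)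
        then show ?thesis unfolding h_def[abs_def] using quasi_elliptic_holomorphic[OF \<tau>]
          by (intro holomorphic_intros) auto
      qed
      then have "f holomorphic_on - ?L" by (rule holomorphic_transform) (simp add: f_def)
      then show ?thesis using False closed_period_lattice[OF \<tau>]
        by (intro holomorphic_on_imp_differentiable_at[of _ "- ?L"]) auto
    qed
    then show ?thesis by (simp add: holomorphic_on_def field_differentiable_at_within)
  qed
  then have f0: "f z = 0" for z
    using entire_lattice_periodic_constant[OF \<tau> \<open>f holomorphic_on UNIV\<close> per', of z] by (simp add: f_def[of 0])
  have "D = 0"
  proof (rule eval_fps_eqD)
    have "eventually (\<lambda>z :: complex. norm z < r) (nhds 0)"
      using eventually_nhds_in_open[of "ball (0::complex) r" 0] r by (simp add: dist_norm)
    then show "eventually (\<lambda>z. eval_fps D z = eval_fps 0 z) (nhds 0)"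
      by eventually_elim (simp add: eval f0)
  qed (use rad0 in auto)
  then have "fps_nth D k = 0" by simp
  then have "eisenstein_E (Suc k) \<tau>' / j ^ k = j * eisenstein_E (Suc k) \<tau> - (if k = 1 then ?c else 0)"
    by (simp add: D_def diff_eq_eq add.commute split: if_splits)
  then have "eisenstein_E (Suc k) \<tau>' = j ^ k * (j * eisenstein_E (Suc k) \<tau> - (if k = 1 then ?c else 0))"
    using j by (simp add: field_simps)
  then show ?thesis unfolding \<tau>'_def by (auto simp: algebra_simps)
qed

section \<open>Infinite matrices with geometric decay\<close>

text \<open>
  All vectors and matrices that occur decay (or grow) at most geometrically, and a diagonal conjugation
  only changes the ratio \<open>r\<close>.  Weighted norms with a free ratio are therefore the natural setting.
\<close>

definition vec_bound :: "(nat \<Rightarrow> complex) \<Rightarrow> real \<Rightarrow> real \<Rightarrow> bool" where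
  "vec_bound v C r \<longleftrightarrow> (\<forall>k\<ge>1. norm (v k) \<le> C * r ^ k)"

definition mat_bound :: "inf_matrix \<Rightarrow> real \<Rightarrow> real \<Rightarrow> bool" where
  "mat_bound A d r \<longleftrightarrow> (\<forall>k\<ge>1. \<forall>l\<ge>1. norm (A k l) \<le> d * r ^ (k + l))"

definition pairing :: "(nat \<Rightarrow> complex) \<Rightarrow> (nat \<Rightarrow> complex) \<Rightarrow> complex" where
  "pairing x y = (\<Sum>\<^sub>\<infinity>m\<in>{1..}. x m * y m)"

definition mat_vec :: "inf_matrix \<Rightarrow> (nat \<Rightarrow> complex) \<Rightarrow> nat \<Rightarrow> complex" where
  "mat_vec A v k = pairing (A k) v"

definition unit_vec :: "nat \<Rightarrow> complex" where
  "unit_vec k = (if k = 1 then 1 else 0)"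

lemma im_mult_eq_mat_vec: "im_mult A B k l = mat_vec A (\<lambda>m. B m l) k"
  by (simp add: im_mult_def mat_vec_def pairing_def)

lemma mat_vec_cong: "(\<And>m. m \<ge> 1 \<Longrightarrow> x m = y m) \<Longrightarrow> mat_vec A x k = mat_vec A y k"
  unfolding mat_vec_def pairing_def by (rule infsum_cong) auto

lemma vec_bound_nonneg: "vec_bound v C r \<Longrightarrow> r > 0 \<Longrightarrow> C \<ge> 0"
  unfolding vec_bound_def by (metis le_refl norm_ge_zero order_trans power_one_right zero_le_mult_iff linorder_not_less)

lemma vec_bound_mono: "vec_bound v C r \<Longrightarrow> C \<le> C' \<Longrightarrow> r \<ge> 0 \<Longrightarrow> vec_bound v C' r"
  unfolding vec_bound_def by (meson mult_right_mono order_trans zero_le_power)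

lemma vec_bound_add_scaled:
  assumes "vec_bound x C r" "vec_bound y C' r"
  shows "vec_bound (\<lambda>k. x k + c * y k) (C + norm c * C') r"
  unfolding vec_bound_def
proof safe
  fix k :: nat assume "1 \<le> k"
  then have "norm (x k) \<le> C * r ^ k" "norm (c * y k) \<le> norm c * (C' * r ^ k)"
    using assms unfolding vec_bound_def norm_mult by (auto intro: mult_left_mono)
  then show "norm (x k + c * y k) \<le> (C + norm c * C') * r ^ k"
    by (intro norm_triangle_le) (simp add: algebra_simps)
qed

text \<open>
  The condition \<open>r * s \<le> 1 / 2\<close> on two ratios is chosen so that the pairing of vectors of ratios \<open>r\<close>
  and \<open>s\<close> is dominated by this series, whose sum is 1; no constants then appear in the estimates.
\<close>

lemma half_powers_has_sum: "((\<lambda>m. (1 / 2) ^ m) has_sum (1 :: real)) {1..}"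
proof -
  have "((\<lambda>m. (1 / 2) ^ m) has_sum (1 :: real)) (Suc ` UNIV)"
    using sums_mult[OF geometric_sums[of "1 / 2 :: real"], of "1 / 2"]
    by (subst has_sum_reindex) (auto simp: o_def intro!: sums_nonneg_imp_has_sum)
  also have "Suc ` UNIV = {1..}" by (auto simp: image_def Suc_le_eq gr0_conv_Suc)
  finally show ?thesis .
qed

lemma prod_bound_half:
  assumes "vec_bound x C r" "vec_bound y C' s" "0 < r" "0 < s" "r * s \<le> 1 / 2" "m \<ge> 1"
  shows "norm (x m * y m) \<le> C * C' * (1 / 2) ^ m"
proof -
  have C: "C \<ge> 0" "C' \<ge> 0" using assms vec_bound_nonneg by blast+
  have "norm (x m * y m) \<le> (C * r ^ m) * (C' * s ^ m)"
    unfolding norm_mult using assms C by (intro mult_mono) (auto simp: vec_bound_def)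
  also have "\<dots> = C * C' * (r * s) ^ m" by (simp add: power_mult_distrib)
  also have "\<dots> \<le> C * C' * (1 / 2) ^ m" using assms C by (intro mult_left_mono power_mono) auto
  finally show ?thesis .
qed

lemma pairing_summable:
  assumes "vec_bound x C r" "vec_bound y C' s" "0 < r" "0 < s" "r * s \<le> 1 / 2"
  shows "(\<lambda>m. x m * y m) summable_on {1..}"
proof (rule abs_summable_summable[OF Infinite_Sum.abs_summable_on_comparison_test'])
  show "(\<lambda>m. C * C' * (1 / 2) ^ m) summable_on {1..}"
    using half_powers_has_sum by (intro summable_on_cmult_right) (auto simp: summable_on_def)
qed (use prod_bound_half[OF assms] in auto)

lemma pairing_norm_le:
  assumes "vec_bound x C r" "vec_bound y C' s" "0 < r" "0 < s" "r * s \<le> 1 / 2"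
  shows "norm (pairing x y) \<le> C * C'"
proof -
  have "((\<lambda>m. x m * y m) has_sum pairing x y) {1..}"
    unfolding pairing_def using pairing_summable[OF assms] by (rule has_sum_infsum)
  moreover have "((\<lambda>m. C * C' * (1 / 2) ^ m) has_sum (C * C' * 1)) {1..}"
    by (intro has_sum_cmult_right half_powers_has_sum)
  ultimately show ?thesis using norm_infsum_le prod_bound_half[OF assms] by fastforce
qed

lemma pairing_add_scaled:
  assumes "vec_bound a D r" "vec_bound x C s" "vec_bound y C' s" "0 < r" "0 < s" "r * s \<le> 1 / 2"
  shows "pairing a (\<lambda>m. x m + c * y m) = pairing a x + c * pairing a y"
proof -
  have "pairing a (\<lambda>m. x m + c * y m) = (\<Sum>\<^sub>\<infinity>m\<in>{1..}. a m * x m + c * (a m * y m))"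
    unfolding pairing_def by (intro infsum_cong) (simp add: algebra_simps)
  also have "\<dots> = pairing a x + (\<Sum>\<^sub>\<infinity>m\<in>{1..}. c * (a m * y m))"
    unfolding pairing_def using assms
    by (intro infsum_add summable_on_cmult_right pairing_summable)
  finally show ?thesis by (simp add: pairing_def infsum_cmult_right')
qed

lemma pairing_commute: "pairing x y = pairing y x"
  by (simp add: pairing_def mult.commute)

lemma pairing_unit_vec: "pairing unit_vec y = y 1"
proof -
  have "pairing unit_vec y = (\<Sum>\<^sub>\<infinity>m\<in>{1}. unit_vec m * y m)"
    unfolding pairing_def by (intro infsum_cong_neutral) (auto simp: unit_vec_def)
  then show ?thesis by (simp add: unit_vec_def)
qed

lemma mat_bound_row: "mat_bound A d r \<Longrightarrow> k \<ge> 1 \<Longrightarrow> vec_bound (A k) (d * r ^ k) r"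
  unfolding mat_bound_def vec_bound_def by (simp add: power_add mult.assoc)

lemma mat_vec_bound:
  assumes "mat_bound A d r" "vec_bound v C s" "0 < r" "0 < s" "r * s \<le> 1 / 2"
  shows "vec_bound (mat_vec A v) (d * C) r"
  unfolding vec_bound_def mat_vec_def
  using pairing_norm_le[OF mat_bound_row[OF assms(1)] assms(2-)] by (simp add: mult_ac)

lemma mat_vec_add_scaled:
  assumes "mat_bound A d r" "vec_bound x C s" "vec_bound y C' s" "0 < r" "0 < s" "r * s \<le> 1 / 2" "k \<ge> 1"
  shows "mat_vec A (\<lambda>m. x m + c * y m) k = mat_vec A x k + c * mat_vec A y k"
  unfolding mat_vec_def by (rule pairing_add_scaled[OF mat_bound_row[OF assms(1,7)] assms(2-6)])

lemma pairing_mat_vec_Fubini: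
  assumes "vec_bound a Ca s" "mat_bound A d r" "vec_bound v Cv s" "0 < r" "0 < s" "r * s \<le> 1 / 2"
  shows "pairing (\<lambda>l. pairing a (\<lambda>m. A m l)) v = pairing a (mat_vec A v)"
proof -
  have h: "(\<lambda>m. (1 / 2) ^ m :: real) summable_on {1..}"
    using half_powers_has_sum unfolding summable_on_def by blast
  have "(\<lambda>(m, l). (1 / 2) ^ m * (1 / 2) ^ l :: real) summable_on {1..} \<times> {1..}"
  proof (rule summable_on_SigmaI)
    fix m :: nat
    show "((\<lambda>l. case (m, l) of (m, l) \<Rightarrow> ((1 / 2) ^ m * (1 / 2) ^ l :: real)) has_sum ((1 / 2) ^ m * 1)) {1..}"
      unfolding prod.case by (intro has_sum_cmult_right half_powers_has_sum)
  qed (use h in auto)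
  then have "(\<lambda>p. Ca * d * Cv * (case p of (m, l) \<Rightarrow> (1 / 2) ^ m * (1 / 2) ^ l)) summable_on {1..} \<times> {1..}"
    by (rule summable_on_cmult_right)
  then have s: "(\<lambda>(m, l). a m * A m l * v l) summable_on {1..} \<times> {1..}"
  proof (rule abs_summable_summable[OF Infinite_Sum.abs_summable_on_comparison_test'])
    fix p :: "nat \<times> nat" assume "p \<in> {1..} \<times> {1..}"
    then obtain m l where p: "p = (m, l)" "m \<ge> 1" "l \<ge> 1" by auto
    have nn: "Ca \<ge> 0" "Cv \<ge> 0" using assms vec_bound_nonneg by blast+
    have "norm (A 1 1) \<le> d * r ^ (1 + 1)" using assms(2) unfolding mat_bound_def by blast
    then have "0 \<le> d * r ^ (1 + 1)" using norm_ge_zero order_trans by blast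
    moreover have "0 < r ^ (1 + 1)" using assms(4) by simp
    ultimately have d: "d \<ge> 0" by (meson mult_neg_pos not_less)
    have "norm (a m * A m l * v l) \<le> (Ca * s ^ m) * (d * r ^ (m + l)) * (Cv * s ^ l)"
      unfolding norm_mult using assms p nn d
      by (intro mult_mono) (auto simp: vec_bound_def mat_bound_def)
    also have "\<dots> = Ca * d * Cv * ((r * s) ^ m * (r * s) ^ l)" by (simp add: power_mult_distrib power_add)
    also have "\<dots> \<le> Ca * d * Cv * ((1 / 2) ^ m * (1 / 2) ^ l)"
      using assms nn d by (intro mult_left_mono mult_mono power_mono) auto
    finally show "norm (case p of (m, l) \<Rightarrow> a m * A m l * v l) \<le> Ca * d * Cv * (case p of (m, l) \<Rightarrow> (1 / 2) ^ m * (1 / 2) ^ l)"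
      by (simp add: p)
  qed
  have "pairing (\<lambda>l. pairing a (\<lambda>m. A m l)) v = (\<Sum>\<^sub>\<infinity>l\<in>{1..}. \<Sum>\<^sub>\<infinity>m\<in>{1..}. a m * A m l * v l)"
    unfolding pairing_def by (simp add: infsum_cmult_left'[symmetric])
  also have "\<dots> = (\<Sum>\<^sub>\<infinity>m\<in>{1..}. \<Sum>\<^sub>\<infinity>l\<in>{1..}. a m * A m l * v l)"
    by (rule infsum_swap_banach[OF s, symmetric])
  also have "\<dots> = pairing a (mat_vec A v)"
    unfolding pairing_def mat_vec_def by (simp add: infsum_cmult_right'[symmetric] mult.assoc)
  finally show ?thesis .
qed

text \<open>
  If \<open>A\<close> is applied to vectors of ratio \<open>s\<close> and \<open>B\<close> to vectors of ratio \<open>r\<close>, then \<open>A B\<close> acts on vectors of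
  ratio \<open>r\<close> with norm at most \<open>d^2 \<le> 1 / 4\<close>.
\<close>

definition small_pair :: "inf_matrix \<Rightarrow> inf_matrix \<Rightarrow> real \<Rightarrow> real \<Rightarrow> real \<Rightarrow> bool" where
  "small_pair A B d r s \<longleftrightarrow> mat_bound A d r \<and> mat_bound B d s \<and> 0 < r \<and> 0 < s \<and> r * s \<le> 1 / 2 \<and> 0 \<le> d \<and> d \<le> 1 / 2"

lemma small_pairD:
  assumes "small_pair A B d r s"
  shows "mat_bound A d r" "mat_bound B d s" "0 < r" "0 < s" "r * s \<le> 1 / 2" "s * r \<le> 1 / 2" "0 \<le> d" "d \<le> 1 / 2"
  using assms by (auto simp: small_pair_def mult.commute)

lemma small_pair_swap: "small_pair A B d r s \<Longrightarrow> small_pair B A d s r"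
  by (auto simp: small_pair_def mult.commute)

lemma mat_vec_mat_vec_bound:
  assumes "small_pair A B d r s" "vec_bound z C r"
  shows "vec_bound (mat_vec A (mat_vec B z)) (C / 4) r"
proof -
  note P = small_pairD[OF assms(1)]
  have C: "C \<ge> 0" using vec_bound_nonneg assms P by blast
  have "vec_bound (mat_vec A (mat_vec B z)) (d * (d * C)) r"
    using mat_vec_bound[OF P(1) mat_vec_bound[OF P(2) assms(2)]] P by blast
  moreover have "d * d \<le> 1 / 2 * (1 / 2)" using P by (intro mult_mono) auto
  then have "d * (d * C) \<le> C / 4" using C mult_right_mono[of "d * d" "1/4" C] by (simp add: mult.assoc)
  ultimately show ?thesis using P vec_bound_mono by (meson less_imp_le)
qed

text \<open>
  The a priori bound \<open>C\<close> is improved by iteration: \<open>C\<close> may be replaced by \<open>c + C / 4\<close>.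
\<close>

lemma fixed_point_bound:
  assumes "small_pair A B d r s" "vec_bound z C r" "vec_bound f c r"
    and eq: "\<And>k. k \<ge> 1 \<Longrightarrow> z k = f k + mat_vec A (mat_vec B z) k"
  shows "vec_bound z (2 * c) r"
proof -
  note P = small_pairD[OF assms(1)]
  have c: "c \<ge> 0" using vec_bound_nonneg assms P by blast
  have *: "vec_bound z (2 * c + C * (1 / 4) ^ n) r" for n
  proof (induction n)
    case 0
    show ?case using assms(2) c P by (auto intro: vec_bound_mono)
  next
    case (Suc n)
    have "vec_bound (\<lambda>k. f k + 1 * mat_vec A (mat_vec B z) k) (c + norm (1::complex) * ((2 * c + C * (1 / 4) ^ n) / 4)) r"
      by (rule vec_bound_add_scaled[OF assms(3) mat_vec_mat_vec_bound[OF assms(1) Suc]])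
    then have "vec_bound z (c + (2 * c + C * (1 / 4) ^ n) / 4) r"
      unfolding vec_bound_def using eq by simp
    then show ?case using c P by (auto intro: vec_bound_mono)
  qed
  show ?thesis unfolding vec_bound_def
  proof safe
    fix k :: nat assume k: "1 \<le> k"
    have "(\<lambda>n. (2 * c + C * (1 / 4) ^ n) * r ^ k) \<longlonglongrightarrow> (2 * c + C * 0) * r ^ k"
      by (intro tendsto_intros LIMSEQ_power_zero) auto
    moreover have "\<forall>n\<ge>0. norm (z k) \<le> (2 * c + C * (1 / 4) ^ n) * r ^ k"
      using * k unfolding vec_bound_def by blast
    ultimately show "norm (z k) \<le> 2 * c * r ^ k" using LIMSEQ_le_const by fastforce
  qed
qed

lemma fixed_point_unique:
  assumes "small_pair A B d r s" "vec_bound z C r"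
    and eq: "\<And>k. k \<ge> 1 \<Longrightarrow> z k = mat_vec A (mat_vec B z) k" and "k \<ge> 1"
  shows "z k = 0"
proof -
  have "vec_bound z (2 * 0) r"
    using assms by (intro fixed_point_bound[OF assms(1,2), of "\<lambda>_. 0"]) (auto simp: vec_bound_def)
  then show ?thesis using assms(4) unfolding vec_bound_def by fastforce
qed

text \<open>
  The first column of \<open>(I - A B)^{-1}\<close>.
\<close>

definition neumann_column :: "inf_matrix \<Rightarrow> inf_matrix \<Rightarrow> nat \<Rightarrow> complex" where
  "neumann_column A B k = im_geometric_inverse (im_mult A B) k 1"

lemma mat_vec_im_mult:
  assumes "small_pair A B d r s" "vec_bound v C r" "k \<ge> 1"
  shows "mat_vec (im_mult A B) v k = mat_vec A (mat_vec B v) k"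
proof -
  note P = small_pairD[OF assms(1)]
  have "mat_vec (im_mult A B) v k = pairing (\<lambda>l. pairing (A k) (\<lambda>m. B m l)) v"
    by (simp add: mat_vec_def im_mult_eq_mat_vec[abs_def])
  also have "\<dots> = pairing (A k) (mat_vec B v)"
    by (rule pairing_mat_vec_Fubini[OF mat_bound_row[OF P(1) assms(3)] P(2) assms(2) P(4,3,6)])
  finally show ?thesis by (simp add: mat_vec_def)
qed

text \<open>
  The partial sums \<open>V N\<close> of the geometric series satisfy \<open>V (N + 1) = e + A B V N\<close> with \<open>e\<close> the first
  unit vector, and converge geometrically in the weighted norm, so the limit is a fixed point.
\<close>

lemma neumann_column:
  assumes "small_pair A B d r s"
  shows "vec_bound (neumann_column A B) (2 / r) r"
    and "k \<ge> 1 \<Longrightarrow> neumann_column A B k = unit_vec k + mat_vec A (mat_vec B (neumann_column A B)) k"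
proof -
  note P = small_pairD[OF assms(1)]
  let ?X = "im_mult A B" and ?v = "neumann_column A B"
  define w where "w n k = im_power ?X n k 1" for n k
  have w0: "w 0 = unit_vec" by (auto simp: w_def unit_vec_def)
  have wS: "w (Suc n) k = mat_vec ?X (w n) k" for n k
    by (simp add: w_def[abs_def] im_mult_eq_mat_vec)
  have wb: "vec_bound (w n) ((1 / r) * (1 / 4) ^ n) r" for n
  proof (induction n)
    case 0
    show ?case using P by (auto simp: w0 unit_vec_def vec_bound_def)
  next
    case (Suc n)
    have "vec_bound (mat_vec A (mat_vec B (w n))) ((1 / r) * (1 / 4) ^ n / 4) r"
      by (rule mat_vec_mat_vec_bound[OF assms Suc])
    then show ?case unfolding vec_bound_def wS using mat_vec_im_mult[OF assms Suc] by simp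
  qed
  have v: "?v k = (\<Sum>n. w n k)" for k
    by (simp add: neumann_column_def im_geometric_inverse_def w_def)
  have geo: "(\<lambda>n. (1 / r) * (1 / 4) ^ n * r ^ k) sums ((1 / r) * (4 / 3) * r ^ k)" for k
    using sums_mult2[OF sums_mult[OF geometric_sums[of "1 / 4 :: real"], of "1 / r"], of "r ^ k"] by simp
  have tail: "summable (\<lambda>n. w n k)" "norm (?v k - (\<Sum>n<N. w n k)) \<le> (2 / r) * (1 / 4) ^ N * r ^ k" if "k \<ge> 1" for k N
  proof -
    have b: "norm (w n k) \<le> (1 / r) * (1 / 4) ^ n * r ^ k" for n
      using wb[of n] that unfolding vec_bound_def by blast
    show s: "summable (\<lambda>n. w n k)"
      by (rule summable_comparison_test'[OF sums_summable[OF geo] b])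
    have "?v k - (\<Sum>n<N. w n k) = (\<Sum>n. w (n + N) k)"
      unfolding v using suminf_minus_initial_segment[OF s, of N] by simp
    moreover have "norm (\<Sum>n. w (n + N) k) \<le> (1 / r) * (4 / 3) * r ^ k * (1 / 4) ^ N"
    proof (rule norm_sums_le)
      show "(\<lambda>n. w (n + N) k) sums (\<Sum>n. w (n + N) k)"
        using s by (intro summable_sums summable_ignore_initial_segment)
      show "(\<lambda>n. (1 / r) * (1 / 4) ^ n * r ^ k * (1 / 4) ^ N) sums ((1 / r) * (4 / 3) * r ^ k * (1 / 4) ^ N)"
        by (rule sums_mult2[OF geo])
      show "norm (w (n + N) k) \<le> (1 / r) * (1 / 4) ^ n * r ^ k * (1 / 4) ^ N" for n
        using b[of "n + N"] by (simp add: power_add mult_ac)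
    qed
    moreover have "(1 / r) * (4 / 3) * r ^ k * (1 / 4) ^ N \<le> (1 / r) * 2 * r ^ k * (1 / 4) ^ N"
      using P by (intro mult_right_mono mult_left_mono) auto
    ultimately show "norm (?v k - (\<Sum>n<N. w n k)) \<le> (2 / r) * (1 / 4) ^ N * r ^ k" by (simp add: mult_ac)
  qed
  show vb: "vec_bound ?v (2 / r) r"
    using tail(2)[of _ 0] by (simp add: vec_bound_def)
  define V where "V N k = (\<Sum>n<N. w n k)" for N k
  have Vb: "vec_bound (\<lambda>k. ?v k + (-1) * V N k) ((2 / r) * (1 / 4) ^ N) r" for N
    using tail(2) by (simp add: vec_bound_def V_def)
  have Vb': "\<exists>C. vec_bound (V N) C r" for N
  proof (induction N)
    case 0
    have "vec_bound (V 0) 0 r" by (simp add: vec_bound_def V_def)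
    then show ?case by blast
  next
    case (Suc N)
    then obtain C where "vec_bound (V N) C r" by blast
    from vec_bound_add_scaled[OF this wb[of N], of 1] show ?case by (auto simp: V_def)
  qed
  have V: "V (Suc N) k = unit_vec k + mat_vec ?X (V N) k" if "k \<ge> 1" for N k
  proof (induction N)
    case 0
    show ?case by (simp add: V_def w0 mat_vec_def pairing_def)
  next
    case (Suc N)
    obtain C where C: "vec_bound (V N) C r" using Vb' by blast
    have lin: "mat_vec ?X (\<lambda>k. V N k + 1 * w N k) k = mat_vec ?X (V N) k + 1 * mat_vec ?X (w N) k"
    proof -
      have "mat_vec ?X (\<lambda>k. V N k + 1 * w N k) k = mat_vec A (mat_vec B (\<lambda>k. V N k + 1 * w N k)) k"
        using that by (intro mat_vec_im_mult[OF assms vec_bound_add_scaled[OF C wb]])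
      also have "\<dots> = mat_vec A (\<lambda>k. mat_vec B (V N) k + 1 * mat_vec B (w N) k) k"
        using P by (intro mat_vec_cong mat_vec_add_scaled[OF P(2) C wb]) auto
      also have "\<dots> = mat_vec A (mat_vec B (V N)) k + 1 * mat_vec A (mat_vec B (w N)) k"
        using P that by (intro mat_vec_add_scaled[OF P(1) mat_vec_bound[OF P(2) C] mat_vec_bound[OF P(2) wb]]) auto
      finally show ?thesis unfolding mat_vec_im_mult[OF assms C that] mat_vec_im_mult[OF assms wb that] .
    qed
    have "V (Suc (Suc N)) k = V (Suc N) k + w (Suc N) k" by (simp add: V_def)
    also have "\<dots> = unit_vec k + mat_vec ?X (V (Suc N)) k"
      unfolding Suc wS using lin by (simp add: V_def[abs_def])
    finally show ?case .
  qed
  assume k: "k \<ge> 1"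
  have "(\<lambda>N. V (Suc N) k) \<longlonglongrightarrow> ?v k"
    unfolding V_def v using summable_LIMSEQ[OF tail(1)[OF k]] by (rule LIMSEQ_Suc)
  moreover have "(\<lambda>N. V (Suc N) k) \<longlonglongrightarrow> unit_vec k + mat_vec A (mat_vec B ?v) k"
  proof -
    have "(\<lambda>N. mat_vec A (mat_vec B ?v) k - mat_vec ?X (V N) k) \<longlonglongrightarrow> 0"
    proof (rule Lim_null_comparison)
      show "eventually (\<lambda>N. norm (mat_vec A (mat_vec B ?v) k - mat_vec ?X (V N) k) \<le> ((2 / r) * (1 / 4) ^ N / 4) * r ^ k) sequentially"
      proof (intro always_eventually allI)
        fix N
        obtain C where C: "vec_bound (V N) C r" using Vb' by blast
        have "mat_vec A (mat_vec B (\<lambda>k. ?v k + (-1) * V N k)) k = mat_vec A (\<lambda>k. mat_vec B ?v k + (-1) * mat_vec B (V N) k) k"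
          using P by (intro mat_vec_cong mat_vec_add_scaled[OF P(2) vb C]) auto
        also have "\<dots> = mat_vec A (mat_vec B ?v) k + (-1) * mat_vec A (mat_vec B (V N)) k"
          using P k by (intro mat_vec_add_scaled[OF P(1) mat_vec_bound[OF P(2) vb] mat_vec_bound[OF P(2) C]]) auto
        finally have "mat_vec A (mat_vec B ?v) k - mat_vec ?X (V N) k = mat_vec A (mat_vec B (\<lambda>k. ?v k + (-1) * V N k)) k"
          unfolding mat_vec_im_mult[OF assms C k] by simp
        then show "norm (mat_vec A (mat_vec B ?v) k - mat_vec ?X (V N) k) \<le> ((2 / r) * (1 / 4) ^ N / 4) * r ^ k"
          using mat_vec_mat_vec_bound[OF assms Vb] k unfolding vec_bound_def by simp
      qed
      have "(\<lambda>N. ((2 / r) * (1 / 4) ^ N / 4) * r ^ k) \<longlonglongrightarrow> ((2 / r) * 0 / 4) * r ^ k"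
        by (intro tendsto_intros LIMSEQ_power_zero) auto
      then show "(\<lambda>N. ((2 / r) * (1 / 4) ^ N / 4) * r ^ k) \<longlonglongrightarrow> 0" by simp
    qed
    from tendsto_diff[OF tendsto_const[of "unit_vec k + mat_vec A (mat_vec B ?v) k"] this] show ?thesis
      unfolding V[OF k] by simp
  qed
  ultimately show "?v k = unit_vec k + mat_vec A (mat_vec B ?v) k" by (rule LIMSEQ_unique)
qed

section \<open>Symmetry, rank-one updates and Lipschitz dependence\<close>

text \<open>
  For symmetric \<open>A\<close> and \<open>B\<close> the transpose of \<open>(I - A B)^{-1}\<close> is \<open>(I - B A)^{-1}\<close>; pairing with the first
  column of the latter thus recovers the first entry of a vector \<open>x\<close> from \<open>(I - A B) x\<close>.
\<close>

lemma neumann_column_row_one: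
  assumes "small_pair A B d r s" "vec_bound x C r"
    and sym: "\<And>k l. k \<ge> 1 \<Longrightarrow> l \<ge> 1 \<Longrightarrow> A k l = A l k" "\<And>k l. k \<ge> 1 \<Longrightarrow> l \<ge> 1 \<Longrightarrow> B k l = B l k"
  shows "pairing (neumann_column B A) (\<lambda>k. x k - mat_vec A (mat_vec B x) k) = x 1"
proof -
  note P = small_pairD[OF assms(1)]
  let ?u = "neumann_column B A"
  note u = neumann_column[OF small_pair_swap[OF assms(1)]]
  have adj: "pairing (mat_vec M x) y = pairing x (mat_vec M y)"
    if "mat_bound M e \<rho>" "vec_bound x C \<sigma>" "vec_bound y C' \<sigma>" "0 < \<rho>" "0 < \<sigma>" "\<rho> * \<sigma> \<le> 1 / 2"
      and sym: "\<And>k l. k \<ge> 1 \<Longrightarrow> l \<ge> 1 \<Longrightarrow> M k l = M l k" for M e \<rho> \<sigma> C C' x y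
  proof -
    have "mat_vec M x l = pairing x (\<lambda>m. M m l)" if "l \<ge> 1" for l
      unfolding pairing_def mat_vec_def using sym[OF that] by (intro infsum_cong) (simp add: mult.commute)
    then have "pairing (mat_vec M x) y = pairing (\<lambda>l. pairing x (\<lambda>m. M m l)) y"
      unfolding pairing_def[of _ y] by (intro infsum_cong) simp
    also have "\<dots> = pairing x (mat_vec M y)"
      by (rule pairing_mat_vec_Fubini[OF that(2,1,3-6)])
    finally show ?thesis .
  qed
  have Bx: "vec_bound (mat_vec B x) (d * C) s" using mat_vec_bound[OF P(2) assms(2)] P by blast
  have ABx: "vec_bound (mat_vec A (mat_vec B x)) (C / 4) r" by (rule mat_vec_mat_vec_bound[OF assms(1,2)])
  have Au: "vec_bound (mat_vec A ?u) (d * (2 / s)) r" using mat_vec_bound[OF P(1) u(1)] P by blast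
  have BAu: "vec_bound (mat_vec B (mat_vec A ?u)) (2 / s / 4) s"
    by (rule mat_vec_mat_vec_bound[OF small_pair_swap[OF assms(1)] u(1)])
  have "pairing ?u (mat_vec A (mat_vec B x)) = pairing (mat_vec A ?u) (mat_vec B x)"
    using sym(1) P by (intro adj[symmetric, OF P(1) u(1) Bx]) auto
  also have "\<dots> = pairing (mat_vec B (mat_vec A ?u)) x"
    using sym(2) P by (intro adj[symmetric, OF P(2) Au assms(2)]) auto
  finally have 1: "pairing ?u (mat_vec A (mat_vec B x)) = pairing x (mat_vec B (mat_vec A ?u))"
    by (simp add: pairing_commute)
  have ub: "vec_bound unit_vec (1 / s) s" using P by (auto simp: vec_bound_def unit_vec_def)
  have "pairing x ?u = pairing x (\<lambda>k. unit_vec k + 1 * mat_vec B (mat_vec A ?u) k)"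
    unfolding pairing_def using u(2) by (intro infsum_cong) auto
  also have "\<dots> = pairing x unit_vec + 1 * pairing x (mat_vec B (mat_vec A ?u))"
    using P by (intro pairing_add_scaled[OF assms(2) ub BAu]) auto
  finally have 2: "pairing ?u x = x 1 + pairing x (mat_vec B (mat_vec A ?u))"
    by (simp add: pairing_unit_vec pairing_commute[of x unit_vec] pairing_commute[of x ?u])
  have "pairing ?u (\<lambda>k. x k + (-1) * mat_vec A (mat_vec B x) k) = pairing ?u x + (-1) * pairing ?u (mat_vec A (mat_vec B x))"
    using P by (intro pairing_add_scaled[OF u(1) assms(2) ABx]) auto
  then show ?thesis using 1 2 by simp
qed

lemma neumann_column_swap:
  assumes "small_pair A B d r s"
    and sym: "\<And>k l. k \<ge> 1 \<Longrightarrow> l \<ge> 1 \<Longrightarrow> A k l = A l k" "\<And>k l. k \<ge> 1 \<Longrightarrow> l \<ge> 1 \<Longrightarrow> B k l = B l k"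
  shows "neumann_column B A 1 = neumann_column A B 1"
proof -
  have "pairing (neumann_column B A) (\<lambda>k. neumann_column A B k - mat_vec A (mat_vec B (neumann_column A B)) k)
      = pairing unit_vec (neumann_column B A)"
    unfolding pairing_def using neumann_column(2)[OF assms(1)]
    by (intro infsum_cong) (auto simp: mult.commute)
  then show ?thesis
    using neumann_column_row_one[OF assms(1) neumann_column(1)[OF assms(1)] sym] by (simp add: pairing_unit_vec)
qed

lemma mat_vec_scaled:
  fixes \<sigma> :: complex
  assumes "\<sigma> \<noteq> 0" "k \<ge> 1" "\<And>k l. k \<ge> 1 \<Longrightarrow> l \<ge> 1 \<Longrightarrow> M' k l = \<sigma> ^ (k + l) * M k l"
    and "\<And>k. k \<ge> 1 \<Longrightarrow> x' k = c * x k / \<sigma> ^ k"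
  shows "mat_vec M' x' k = c * \<sigma> ^ k * mat_vec M x k"
proof -
  have "mat_vec M' x' k = (\<Sum>\<^sub>\<infinity>m\<in>{1..}. c * \<sigma> ^ k * (M k m * x m))"
    unfolding mat_vec_def pairing_def using assms by (intro infsum_cong) (simp add: power_add)
  then show ?thesis unfolding mat_vec_def pairing_def by (simp add: infsum_cmult_right')
qed

lemma mat_vec_corner:
  assumes "mat_bound M d r" "vec_bound x C s" "0 < r" "0 < s" "r * s \<le> 1 / 2" "k \<ge> 1"
  shows "mat_vec (\<lambda>k l. M k l + (if k = 1 \<and> l = 1 then \<kappa> else 0)) x k = mat_vec M x k + \<kappa> * x 1 * unit_vec k"
proof -
  have u: "vec_bound unit_vec (1 / r) r" using assms by (auto simp: vec_bound_def unit_vec_def)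
  have "mat_vec (\<lambda>k l. M k l + (if k = 1 \<and> l = 1 then \<kappa> else 0)) x k
    = pairing x (\<lambda>m. M k m + (\<kappa> * unit_vec k) * unit_vec m)"
    unfolding mat_vec_def pairing_def by (intro infsum_cong) (auto simp: unit_vec_def)
  also have "\<dots> = pairing x (M k) + (\<kappa> * unit_vec k) * pairing x unit_vec"
    using assms by (intro pairing_add_scaled[OF assms(2) mat_bound_row[OF assms(1)] u]) (auto simp: mult.commute)
  finally show ?thesis by (simp add: mat_vec_def pairing_commute[of x] pairing_unit_vec)
qed

text \<open>
  After the diagonal conjugation has been undone, \<open>A\<close> is replaced by \<open>A\<close> with \<open>\<kappa>\<close> added to the corner,
  and the first columns \<open>Vt\<close> and \<open>Ut\<close> of the two new inverses satisfy the old fixed point equations with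
  a modified inhomogeneity.  By uniqueness, \<open>Vt\<close> is a multiple \<open>t\<close> of the old column, and \<open>A Ut\<close> plus the
  corner term is a linear combination of old vectors.  Evaluation at the first index determines the
  coefficients; in particular \<open>t = 1 / (1 - \<kappa> w)\<close>, as in the Sherman-Morrison formula.  That
  \<open>1 - \<kappa> w\<close> is nonzero is part of the conclusion: it follows from the existence of the new inverse.
\<close>

lemma neumann_column_rank_one_update:
  fixes \<sigma> \<kappa> :: complex
  assumes AB: "small_pair A B d r s"
    and AB': "small_pair A' B' d' (norm \<sigma> * r) (s / norm \<sigma>)"
    and \<sigma>: "\<sigma> \<noteq> 0"
    and sym: "\<And>k l. k \<ge> 1 \<Longrightarrow> l \<ge> 1 \<Longrightarrow> A k l = A l k" "\<And>k l. k \<ge> 1 \<Longrightarrow> l \<ge> 1 \<Longrightarrow> B k l = B l k"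
    and A': "\<And>k l. k \<ge> 1 \<Longrightarrow> l \<ge> 1 \<Longrightarrow> A' k l = \<sigma> ^ (k + l) * (A k l + (if k = 1 \<and> l = 1 then \<kappa> else 0))"
    and B': "\<And>k l. k \<ge> 1 \<Longrightarrow> l \<ge> 1 \<Longrightarrow> B' k l = B k l / \<sigma> ^ (k + l)"
  defines "v \<equiv> neumann_column A B 1" and "w \<equiv> mat_vec B (neumann_column A B) 1"
    and "p \<equiv> mat_vec A (neumann_column B A) 1"
  obtains t where "t * (1 - \<kappa> * w) = 1" "neumann_column A' B' 1 = t * v"
    "mat_vec B' (neumann_column A' B') 1 = t * w / \<sigma>\<^sup>2"
    "mat_vec A' (neumann_column B' A') 1 = \<sigma>\<^sup>2 * (p + \<kappa> * t * v\<^sup>2)"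
proof -
  note P = small_pairD[OF AB]
  let ?A = "\<lambda>k l. A k l + (if k = 1 \<and> l = 1 then \<kappa> else 0)"
  define V where "V = neumann_column A B"
  define U where "U = neumann_column B A"
  define V' where "V' = neumann_column A' B'"
  define U' where "U' = neumann_column B' A'"
  note V = neumann_column[OF AB, folded V_def]
  note U = neumann_column[OF small_pair_swap[OF AB], folded U_def]
  note V' = neumann_column[OF AB', folded V'_def]
  note U' = neumann_column[OF small_pair_swap[OF AB'], folded U'_def]
  have n\<sigma>: "norm \<sigma> > 0" using \<sigma> by simp
  \<comment> \<open>The new columns, with the conjugation undone so that they have the old ratios.\<close>
  define Vt where "Vt k = \<sigma> * V' k / \<sigma> ^ k" for k
  define Ut where "Ut k = \<sigma> ^ k * U' k / \<sigma>" for k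
  have Vt_bound: "vec_bound Vt (norm \<sigma> * (2 / (norm \<sigma> * r))) r"
    unfolding vec_bound_def
  proof safe
    fix k :: nat assume "1 \<le> k"
    then have "norm (V' k) \<le> 2 / (norm \<sigma> * r) * (norm \<sigma> * r) ^ k" using V'(1) unfolding vec_bound_def by blast
    then show "norm (Vt k) \<le> norm \<sigma> * (2 / (norm \<sigma> * r)) * r ^ k"
      using n\<sigma> P(3) by (simp add: Vt_def norm_mult norm_divide norm_power power_mult_distrib field_simps)
  qed
  have Ut_bound: "vec_bound Ut (2 / (s / norm \<sigma>) / norm \<sigma>) s"
    unfolding vec_bound_def
  proof safe
    fix k :: nat assume "1 \<le> k"
    then have "norm (U' k) \<le> 2 / (s / norm \<sigma>) * (s / norm \<sigma>) ^ k" using U'(1) unfolding vec_bound_def by blast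
    then have "norm \<sigma> ^ k * norm (U' k) / norm \<sigma> \<le> norm \<sigma> ^ k * (2 / (s / norm \<sigma>) * (s / norm \<sigma>) ^ k) / norm \<sigma>"
      using n\<sigma> by (intro divide_right_mono mult_left_mono) auto
    also have "\<dots> = 2 / (s / norm \<sigma>) / norm \<sigma> * s ^ k"
      using n\<sigma> by (simp add: power_divide)
    finally show "norm (Ut k) \<le> 2 / (s / norm \<sigma>) / norm \<sigma> * s ^ k"
      by (simp add: Ut_def norm_mult norm_divide norm_power)
  qed
  have B'inv: "B' k l = inverse \<sigma> ^ (k + l) * B k l" if "k \<ge> 1" "l \<ge> 1" for k l
    using B'[OF that] by (simp add: divide_inverse power_inverse)
  have BV': "mat_vec B' V' k = inverse \<sigma> * inverse \<sigma> ^ k * mat_vec B Vt k" if "k \<ge> 1" for k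
    using \<sigma> that by (intro mat_vec_scaled B'inv) (auto simp: Vt_def field_simps)
  have ABV': "mat_vec A' (mat_vec B' V') k = inverse \<sigma> * \<sigma> ^ k * mat_vec ?A (mat_vec B Vt) k" if "k \<ge> 1" for k
    using \<sigma> that BV' A' by (intro mat_vec_scaled) (auto simp: field_simps)
  have AU': "mat_vec A' U' k = \<sigma> * \<sigma> ^ k * mat_vec ?A Ut k" if "k \<ge> 1" for k
    using \<sigma> that A' by (intro mat_vec_scaled) (auto simp: Ut_def field_simps)
  have BAU': "mat_vec B' (mat_vec A' U') k = \<sigma> * inverse \<sigma> ^ k * mat_vec B (mat_vec ?A Ut) k" if "k \<ge> 1" for k
    using \<sigma> that AU' by (intro mat_vec_scaled B'inv) (auto simp: field_simps)
  have BVt_bound: "vec_bound (mat_vec B Vt) (d * (norm \<sigma> * (2 / (norm \<sigma> * r)))) s"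
    using mat_vec_bound[OF P(2) Vt_bound] P by blast
  have BV_bound: "vec_bound (mat_vec B V) (d * (2 / r)) s" using mat_vec_bound[OF P(2) V(1)] P by blast
  define t where "t = 1 + \<kappa> * mat_vec B Vt 1"
  have Vt: "Vt k = t * unit_vec k + mat_vec A (mat_vec B Vt) k" if "k \<ge> 1" for k
  proof -
    have "Vt k = \<sigma> / \<sigma> ^ k * unit_vec k + mat_vec ?A (mat_vec B Vt) k"
      unfolding Vt_def V'(2)[OF that] ABV'[OF that] using \<sigma> by (simp add: field_simps)
    also have "\<sigma> / \<sigma> ^ k * unit_vec k = unit_vec k" using \<sigma> by (simp add: unit_vec_def)
    also have "mat_vec ?A (mat_vec B Vt) k = mat_vec A (mat_vec B Vt) k + \<kappa> * mat_vec B Vt 1 * unit_vec k"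
      using P that by (intro mat_vec_corner[OF P(1) BVt_bound]) auto
    finally show ?thesis by (simp add: t_def algebra_simps)
  qed
  have Vt_eq: "Vt k = t * V k" if "k \<ge> 1" for k
  proof -
    have "Vt k + (-t) * V k = 0"
    proof (rule fixed_point_unique[OF AB vec_bound_add_scaled[OF Vt_bound V(1)] _ that])
      fix k :: nat assume k: "k \<ge> 1"
      have "mat_vec A (mat_vec B (\<lambda>k. Vt k + (-t) * V k)) k = mat_vec A (\<lambda>k. mat_vec B Vt k + (-t) * mat_vec B V k) k"
        using P by (intro mat_vec_cong mat_vec_add_scaled[OF P(2) Vt_bound V(1)]) auto
      also have "\<dots> = mat_vec A (mat_vec B Vt) k + (-t) * mat_vec A (mat_vec B V) k"
        using P k by (intro mat_vec_add_scaled[OF P(1) BVt_bound BV_bound]) auto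
      finally show "Vt k + (-t) * V k = mat_vec A (mat_vec B (\<lambda>k. Vt k + (-t) * V k)) k"
        using Vt[OF k] V(2)[OF k] by (simp add: algebra_simps)
    qed
    then show ?thesis by simp
  qed
  have BVt: "mat_vec B Vt 1 = t * w"
  proof -
    have "mat_vec B Vt 1 = mat_vec B (\<lambda>k. 0 * V k + t * V k) 1"
      using Vt_eq by (intro mat_vec_cong) simp
    also have "\<dots> = mat_vec B (\<lambda>k. 0 * V k) 1 + t * mat_vec B V 1"
      using P by (intro mat_vec_add_scaled[OF P(2) _ V(1), where C = 0]) (auto simp: vec_bound_def)
    finally show ?thesis by (simp add: w_def V_def mat_vec_def pairing_def)
  qed
  have t: "t * (1 - \<kappa> * w) = 1" using t_def unfolding BVt by (simp add: algebra_simps)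
  have r1: "neumann_column A' B' 1 = t * v"
    using Vt_eq[of 1] \<sigma> by (simp add: Vt_def V'_def V_def v_def)
  have r2: "mat_vec B' (neumann_column A' B') 1 = t * w / \<sigma>\<^sup>2"
    using BV'[of 1] BVt \<sigma> by (simp add: V'_def power2_eq_square field_simps)
  \<comment> \<open>For the transposed system the natural unknown is \<open>A Ut\<close> plus the corner term, as it satisfies
     an equation for the same operator \<open>A B\<close>.\<close>
  define q where "q = Ut 1"
  have AUt_bound: "vec_bound (mat_vec A Ut) (d * (2 / (s / norm \<sigma>) / norm \<sigma>)) r"
    using mat_vec_bound[OF P(1) Ut_bound] P by blast
  have AU_bound: "vec_bound (mat_vec A U) (d * (2 / s)) r"
    using mat_vec_bound[OF P(1) U(1)] P by blast
  have ub: "vec_bound unit_vec (1 / r) r" using P by (auto simp: vec_bound_def unit_vec_def)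
  have ubs: "vec_bound unit_vec (1 / s) s" using P by (auto simp: vec_bound_def unit_vec_def)
  have AhUt: "mat_vec ?A Ut k = mat_vec A Ut k + \<kappa> * q * unit_vec k" if "k \<ge> 1" for k
    unfolding q_def using P that by (intro mat_vec_corner[OF P(1) Ut_bound]) auto
  define p' where "p' k = mat_vec A Ut k + \<kappa> * q * unit_vec k" for k
  have p'_bound: "vec_bound p' (d * (2 / (s / norm \<sigma>) / norm \<sigma>) + norm (\<kappa> * q) * (1 / r)) r"
    unfolding p'_def by (rule vec_bound_add_scaled[OF AUt_bound ub])
  have Bp'_bound: "vec_bound (mat_vec B p') (d * (d * (2 / (s / norm \<sigma>) / norm \<sigma>) + norm (\<kappa> * q) * (1 / r))) s"
    using mat_vec_bound[OF P(2) p'_bound] P by blast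
  have BAU_bound: "vec_bound (mat_vec B (mat_vec A U)) (d * (d * (2 / s))) s"
    using mat_vec_bound[OF P(2) AU_bound] P by blast
  have Ut: "Ut k = unit_vec k + 1 * mat_vec B p' k" if "k \<ge> 1" for k
  proof -
    have "mat_vec B (mat_vec ?A Ut) k = mat_vec B p' k"
      using AhUt by (intro mat_vec_cong) (auto simp: p'_def)
    then have "Ut k = \<sigma> ^ k / \<sigma> * unit_vec k + mat_vec B p' k"
      unfolding Ut_def U'(2)[OF that] BAU'[OF that] using \<sigma> by (simp add: field_simps)
    also have "\<sigma> ^ k / \<sigma> * unit_vec k = unit_vec k" using \<sigma> by (simp add: unit_vec_def)
    finally show ?thesis by simp
  qed
  have AUt: "mat_vec A Ut k = mat_vec A unit_vec k + mat_vec A (mat_vec B p') k" if "k \<ge> 1" for k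
  proof -
    have "mat_vec A Ut k = mat_vec A (\<lambda>k. unit_vec k + 1 * mat_vec B p' k) k"
      using Ut by (intro mat_vec_cong) auto
    also have "\<dots> = mat_vec A unit_vec k + 1 * mat_vec A (mat_vec B p') k"
      using P that by (intro mat_vec_add_scaled[OF P(1) ubs Bp'_bound]) auto
    finally show ?thesis by simp
  qed
  have AUk: "mat_vec A U k = mat_vec A unit_vec k + mat_vec A (mat_vec B (mat_vec A U)) k" if "k \<ge> 1" for k
  proof -
    have "mat_vec A U k = mat_vec A (\<lambda>k. unit_vec k + 1 * mat_vec B (mat_vec A U) k) k"
      using U(2) by (intro mat_vec_cong) auto
    also have "\<dots> = mat_vec A unit_vec k + 1 * mat_vec A (mat_vec B (mat_vec A U)) k"
      using P that by (intro mat_vec_add_scaled[OF P(1) ubs BAU_bound]) auto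
    finally show ?thesis by simp
  qed
  let ?diff = "\<lambda>k. (p' k + (-1) * mat_vec A U k) + (- \<kappa> * q) * V k"
  note diff1_bound = vec_bound_add_scaled[OF p'_bound AU_bound, of "-1"]
  have Bdiff: "mat_vec B ?diff k = (mat_vec B p' k + (-1) * mat_vec B (mat_vec A U) k) + (- \<kappa> * q) * mat_vec B V k" if "k \<ge> 1" for k
  proof -
    have "mat_vec B ?diff k = mat_vec B (\<lambda>k. p' k + (-1) * mat_vec A U k) k + (- \<kappa> * q) * mat_vec B V k"
      using P that by (intro mat_vec_add_scaled[OF P(2) diff1_bound V(1)]) auto
    also have "mat_vec B (\<lambda>k. p' k + (-1) * mat_vec A U k) k = mat_vec B p' k + (-1) * mat_vec B (mat_vec A U) k"
      using P that by (intro mat_vec_add_scaled[OF P(2) p'_bound AU_bound]) auto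
    finally show ?thesis .
  qed
  have p'_eq: "p' k = mat_vec A U k + \<kappa> * q * V k" if "k \<ge> 1" for k
  proof -
    have "?diff k = 0"
    proof (rule fixed_point_unique[OF AB vec_bound_add_scaled[OF diff1_bound V(1)] _ that])
      fix k :: nat assume k: "k \<ge> 1"
      note b1 = vec_bound_add_scaled[OF Bp'_bound BAU_bound, of "-1"]
      have "mat_vec A (mat_vec B ?diff) k
         = mat_vec A (\<lambda>k. (mat_vec B p' k + (-1) * mat_vec B (mat_vec A U) k) + (- \<kappa> * q) * mat_vec B V k) k"
        by (intro mat_vec_cong Bdiff)
      also have "\<dots> = mat_vec A (\<lambda>k. mat_vec B p' k + (-1) * mat_vec B (mat_vec A U) k) k + (- \<kappa> * q) * mat_vec A (mat_vec B V) k"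
        using P k by (intro mat_vec_add_scaled[OF P(1) b1 BV_bound]) auto
      also have "mat_vec A (\<lambda>k. mat_vec B p' k + (-1) * mat_vec B (mat_vec A U) k) k
         = mat_vec A (mat_vec B p') k + (-1) * mat_vec A (mat_vec B (mat_vec A U)) k"
        using P k by (intro mat_vec_add_scaled[OF P(1) Bp'_bound BAU_bound]) auto
      finally show "?diff k = mat_vec A (mat_vec B ?diff) k"
        using AUt[OF k] AUk[OF k] V(2)[OF k] by (simp add: p'_def algebra_simps)
    qed
    then show ?thesis by (simp add: algebra_simps)
  qed
  have "U 1 = v"
    unfolding U_def v_def by (rule neumann_column_swap[OF AB sym])
  have "q = 1 + mat_vec B p' 1" using Ut[of 1] by (simp add: q_def unit_vec_def)
  also have "mat_vec B p' 1 = mat_vec B (\<lambda>k. mat_vec A U k + (\<kappa> * q) * V k) 1"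
    using p'_eq by (intro mat_vec_cong) auto
  also have "\<dots> = mat_vec B (mat_vec A U) 1 + (\<kappa> * q) * mat_vec B V 1"
    using P by (intro mat_vec_add_scaled[OF P(2) AU_bound V(1)]) auto
  finally have "q = U 1 + \<kappa> * q * w" using U(2)[of 1] by (simp add: unit_vec_def w_def V_def add.assoc)
  then have "q * (1 - \<kappa> * w) = v" using \<open>U 1 = v\<close> by (simp add: algebra_simps)
  then have "q = t * v" using t by (metis mult.commute mult.left_commute mult_1)
  have r3: "mat_vec A' (neumann_column B' A') 1 = \<sigma>\<^sup>2 * (p + \<kappa> * t * v\<^sup>2)"
  proof -
    have "mat_vec A' U' 1 = \<sigma>\<^sup>2 * p' 1" using AU'[of 1] AhUt[of 1] by (simp add: p'_def power2_eq_square)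
    also have "p' 1 = p + \<kappa> * t * v\<^sup>2"
      using p'_eq[of 1] \<open>q = t * v\<close> by (simp add: p_def U_def V_def v_def power2_eq_square mult_ac)
    finally show ?thesis by (simp add: U'_def)
  qed
  show thesis using that[OF t r1 r2 r3] .
qed

lemma mat_vec_matrix_diff:
  assumes "mat_bound A d r" "mat_bound A' d' r" "vec_bound x C s" "0 < r" "0 < s" "r * s \<le> 1 / 2" "k \<ge> 1"
  shows "mat_vec (\<lambda>k l. A k l - A' k l) x k = mat_vec A x k - mat_vec A' x k"
proof -
  have "mat_vec (\<lambda>k l. A k l - A' k l) x k = pairing x (\<lambda>m. A k m + (-1) * A' k m)"
    by (simp add: mat_vec_def pairing_def mult.commute)
  also have "\<dots> = pairing x (A k) + (-1) * pairing x (A' k)"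
    using assms by (intro pairing_add_scaled[OF assms(3) mat_bound_row[OF assms(1)] mat_bound_row[OF assms(2)]])
      (auto simp: mult.commute)
  finally show ?thesis by (simp add: mat_vec_def pairing_commute[of x])
qed

text \<open>
  The difference of the two columns solves the fixed point equation of one of them, with an
  inhomogeneity of first order in the differences of the matrices.
\<close>

lemma neumann_column_Lipschitz:
  assumes AB: "small_pair A B d r s" and AB': "small_pair A' B' d r s"
    and dA: "mat_bound (\<lambda>k l. A k l - A' k l) e r" and dB: "mat_bound (\<lambda>k l. B k l - B' k l) e s"
  shows "norm (neumann_column A B 1 - neumann_column A' B' 1) \<le> 8 * d * e"
    and "norm (mat_vec B (neumann_column A B) 1 - mat_vec B' (neumann_column A' B') 1) \<le> 4 * e * s / r"
proof -
  note P = small_pairD[OF AB]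
  note P' = small_pairD[OF AB']
  define V where "V = neumann_column A B"
  define V' where "V' = neumann_column A' B'"
  note V = neumann_column[OF AB, folded V_def]
  note V' = neumann_column[OF AB', folded V'_def]
  let ?dA = "\<lambda>k l. A k l - A' k l" and ?dB = "\<lambda>k l. B k l - B' k l"
  have e: "e \<ge> 0"
  proof -
    have "norm (?dA 1 1) \<le> e * r ^ (1 + 1)" using dA unfolding mat_bound_def by blast
    then have "0 \<le> e * r ^ (1 + 1)" using norm_ge_zero order_trans by blast
    moreover have "0 < r ^ (1 + 1)" using P by simp
    ultimately show ?thesis by (meson mult_neg_pos not_less)
  qed
  have BV: "vec_bound (mat_vec B V) (d * (2 / r)) s" using mat_vec_bound[OF P(2) V(1)] P by blast
  have BV': "vec_bound (mat_vec B' V') (d * (2 / r)) s" using mat_vec_bound[OF P'(2) V'(1)] P by blast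
  have B'V: "vec_bound (mat_vec B' V) (d * (2 / r)) s" using mat_vec_bound[OF P'(2) V(1)] P by blast
  have dBV: "vec_bound (mat_vec ?dB V) (e * (2 / r)) s" using mat_vec_bound[OF dB V(1)] P by blast
  have dABV: "vec_bound (mat_vec ?dA (mat_vec B V)) (e * (d * (2 / r))) r" using mat_vec_bound[OF dA BV] P by blast
  have AdBV: "vec_bound (mat_vec A' (mat_vec ?dB V)) (d * (e * (2 / r))) r" using mat_vec_bound[OF P'(1) dBV] P by blast
  define f where "f k = mat_vec ?dA (mat_vec B V) k + 1 * mat_vec A' (mat_vec ?dB V) k" for k
  have f: "vec_bound f (e * (d * (2 / r)) + norm (1::complex) * (d * (e * (2 / r)))) r"
    unfolding f_def by (rule vec_bound_add_scaled[OF dABV AdBV])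
  define z where "z k = V k + (-1) * V' k" for k
  have z: "vec_bound z (2 / r + norm (-1::complex) * (2 / r)) r"
    unfolding z_def by (rule vec_bound_add_scaled[OF V(1) V'(1)])
  have B'z: "mat_vec B' z k = mat_vec B' V k + (-1) * mat_vec B' V' k" if "k \<ge> 1" for k
    unfolding z_def using P that by (intro mat_vec_add_scaled[OF P'(2) V(1) V'(1)]) auto
  have dBVk: "mat_vec ?dB V k = mat_vec B V k - mat_vec B' V k" if "k \<ge> 1" for k
    using P that by (intro mat_vec_matrix_diff[OF P(2) P'(2) V(1)]) auto
  have zb: "vec_bound z (2 * (e * (d * (2 / r)) + norm (1::complex) * (d * (e * (2 / r))))) r"
  proof (rule fixed_point_bound[OF AB' z f])
    fix k :: nat assume k: "k \<ge> 1"
    have "mat_vec A' (mat_vec B' z) k = mat_vec A' (\<lambda>k. mat_vec B' V k + (-1) * mat_vec B' V' k) k"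
      by (intro mat_vec_cong B'z)
    also have "\<dots> = mat_vec A' (mat_vec B' V) k + (-1) * mat_vec A' (mat_vec B' V') k"
      using P k by (intro mat_vec_add_scaled[OF P'(1) B'V BV']) auto
    moreover have "mat_vec A' (mat_vec ?dB V) k = mat_vec A' (\<lambda>k. mat_vec B V k + (-1) * mat_vec B' V k) k"
      using dBVk by (intro mat_vec_cong) auto
    moreover have "\<dots> = mat_vec A' (mat_vec B V) k + (-1) * mat_vec A' (mat_vec B' V) k"
      using P k by (intro mat_vec_add_scaled[OF P'(1) BV B'V]) auto
    moreover have "mat_vec ?dA (mat_vec B V) k = mat_vec A (mat_vec B V) k - mat_vec A' (mat_vec B V) k"
      using P k by (intro mat_vec_matrix_diff[OF P(1) P'(1) BV]) auto
    ultimately show "z k = f k + mat_vec A' (mat_vec B' z) k"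
      using V(2)[OF k] V'(2)[OF k] by (simp add: z_def f_def)
  qed
  have zb': "vec_bound z (8 * d * e / r) r" using zb by (simp add: mult_ac)
  then have "norm (z 1) \<le> 8 * d * e / r * r ^ 1" unfolding vec_bound_def by blast
  then show "norm (neumann_column A B 1 - neumann_column A' B' 1) \<le> 8 * d * e"
    using P by (simp add: z_def V_def V'_def)
  have "vec_bound (mat_vec B' z) (d * (8 * d * e / r)) s" using mat_vec_bound[OF P'(2) zb'] P by blast
  then have "norm (mat_vec B' z 1) \<le> d * (8 * d * e / r) * s" unfolding vec_bound_def by force
  moreover have "norm (mat_vec ?dB V 1) \<le> e * (2 / r) * s" using dBV unfolding vec_bound_def by force
  moreover have "mat_vec B V 1 - mat_vec B' V' 1 = mat_vec ?dB V 1 + mat_vec B' z 1"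
    using B'z[of 1] dBVk[of 1] by simp
  ultimately have "norm (mat_vec B V 1 - mat_vec B' V' 1) \<le> e * (2 / r) * s + d * (8 * d * e / r) * s"
    by (metis norm_triangle_mono)
  also have "d * (8 * d * e / r) * s = (d * d) * (8 * e / r * s)" by simp
  also have "\<dots> \<le> (1 / 2 * (1 / 2)) * (8 * e / r * s)"
    using P e by (intro mult_right_mono mult_mono) auto
  finally show "norm (mat_vec B (neumann_column A B) 1 - mat_vec B' (neumann_column A' B') 1) \<le> 4 * e * s / r"
    by (simp add: V_def V'_def mult_ac)
qed

lemma neumann_column_bounds:
  assumes "small_pair A B d r s"
  shows "norm (neumann_column A B 1) \<le> 2" "norm (neumann_column A B 1 - 1) \<le> 2 * d\<^sup>2"
    and "norm (mat_vec B (neumann_column A B) 1) \<le> 2 * d * s / r"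
proof -
  note P = small_pairD[OF assms]
  note V = neumann_column[OF assms]
  have "norm (neumann_column A B 1) \<le> 2 / r * r ^ 1" using V(1) unfolding vec_bound_def by blast
  then show "norm (neumann_column A B 1) \<le> 2" using P by simp
  have 1: "vec_bound (mat_vec B (neumann_column A B)) (d * (2 / r)) s" using mat_vec_bound[OF P(2) V(1)] P by blast
  then have "norm (mat_vec B (neumann_column A B) 1) \<le> d * (2 / r) * s ^ 1" unfolding vec_bound_def by blast
  then show "norm (mat_vec B (neumann_column A B) 1) \<le> 2 * d * s / r" by (simp add: mult_ac)
  have "vec_bound (mat_vec A (mat_vec B (neumann_column A B))) (d * (d * (2 / r))) r"
    using mat_vec_bound[OF P(1) 1] P by blast
  then have "norm (mat_vec A (mat_vec B (neumann_column A B)) 1) \<le> d * (d * (2 / r)) * r ^ 1" unfolding vec_bound_def by blast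
  then show "norm (neumann_column A B 1 - 1) \<le> 2 * d\<^sup>2"
    using V(2)[of 1] P by (simp add: unit_vec_def power2_eq_square)
qed

section \<open>The modular transformation of the period matrix\<close>

definition sewing_coeff :: "nat \<Rightarrow> nat \<Rightarrow> complex" where
  "sewing_coeff k l = (-1) ^ (k + 1) * (fact (k + l - 1) / (fact (k - 1) * fact (l - 1))) / of_real (sqrt (real k * real l))"

lemma A_matrix_eq: "A_matrix \<tau> \<epsilon> k l = \<epsilon> ^ ((k + l) div 2) * sewing_coeff k l * eisenstein_E (k + l) \<tau>"
  by (simp add: A_matrix_def sewing_coeff_def mult_ac)

lemma A_matrix_odd: "odd (k + l) \<Longrightarrow> A_matrix \<tau> \<epsilon> k l = 0"
  by (simp add: A_matrix_eq eisenstein_E_def)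

lemma sewing_coeff_1_1 [simp]: "sewing_coeff (Suc 0) (Suc 0) = 1"
  by (simp add: sewing_coeff_def)

text \<open>
  The factorials form the product \<open>(k + l - 1) * binomial (k + l - 2) (k - 1)\<close>.
\<close>

lemma norm_sewing_coeff_le:
  assumes "k \<ge> 1" "l \<ge> 1" shows "norm (sewing_coeff k l) \<le> 4 ^ (k + l)"
proof -
  obtain a b where ab: "k = Suc a" "l = Suc b" using assms by (metis Suc_le_D One_nat_def)
  have "fact a * fact b * ((a + b) choose a) = (fact (a + b) :: nat)"
    using binomial_fact_lemma[of a "a + b"] by simp
  then have "real (fact a * fact b * ((a + b) choose a)) = real (fact (a + b))" by (simp only:)
  then have f: "fact a * fact b * real ((a + b) choose a) = (fact (a + b) :: real)"
    by (simp only: of_nat_mult of_nat_fact)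
  have "fact (Suc (a + b)) = real (Suc (a + b)) * (fact a * fact b * real ((a + b) choose a))"
    unfolding f by (simp only: fact_Suc of_nat_mult)
  then have 1: "fact (Suc (a + b)) / (fact a * fact b) = real (Suc (a + b)) * real ((a + b) choose a)"
    by (simp del: fact_Suc of_nat_Suc)
  have "sqrt (real k * real l) \<ge> 1" using assms by (simp add: mult_ge1_I)
  then have "fact (Suc (a + b)) / (fact a * fact b) / sqrt (real k * real l) \<le> fact (Suc (a + b)) / (fact a * fact b) / 1"
    by (intro divide_left_mono) (auto simp del: fact_Suc)
  moreover have "norm (sewing_coeff k l) = fact (Suc (a + b)) / (fact a * fact b) / sqrt (real k * real l)"
    unfolding sewing_coeff_def ab by (simp add: norm_mult norm_divide norm_power del: fact_Suc of_nat_Suc)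
  ultimately have "norm (sewing_coeff k l) \<le> fact (Suc (a + b)) / (fact a * fact b) / 1" by simp
  also have "\<dots> \<le> 2 ^ Suc (a + b) * 2 ^ (a + b)"
    unfolding div_by_1 1
  proof (intro mult_mono)
    show "real (Suc (a + b)) \<le> 2 ^ Suc (a + b)" using less_exp[of "Suc (a + b)"] by (metis less_imp_le of_nat_le_iff of_nat_numeral of_nat_power)
    show "real ((a + b) choose a) \<le> 2 ^ (a + b)" using binomial_le_pow2[of "a + b" a] by (metis of_nat_le_iff of_nat_numeral of_nat_power)
  qed auto
  also have "\<dots> \<le> 2 ^ (k + l) * 2 ^ (k + l)" by (intro mult_mono power_increasing) (auto simp: ab)
  also have "\<dots> = (4 :: real) ^ (k + l)" unfolding power_mult_distrib[symmetric] by simp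
  finally show ?thesis .
qed

text \<open>
  Only entries with \<open>k + l\<close> even are nonzero, and for these the two signs agree.
\<close>

lemma A_matrix_sym: "k \<ge> 1 \<Longrightarrow> l \<ge> 1 \<Longrightarrow> A_matrix \<tau> \<epsilon> k l = A_matrix \<tau> \<epsilon> l k"
proof (cases "even (k + l)")
  case True
  then have "(-1 :: complex) ^ (k + 1) = (-1) ^ (l + 1)" by (auto simp: minus_one_power_iff)
  then show ?thesis by (simp add: A_matrix_eq sewing_coeff_def add.commute mult.commute)
qed (simp add: A_matrix_odd add.commute)

lemma Omega_11_eq: "Omega_11 \<tau>1 \<tau>2 \<epsilon> = \<tau>1 + \<epsilon> * mat_vec (A_matrix \<tau>2 \<epsilon>) (neumann_column (A_matrix \<tau>1 \<epsilon>) (A_matrix \<tau>2 \<epsilon>)) 1 / two_pi_i"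
  by (simp add: Omega_11_def Let_def im_mult_eq_mat_vec neumann_column_def[abs_def] add_divide_distrib)

lemma Omega_22_eq_swap: "Omega_22 \<tau>1 \<tau>2 \<epsilon> = Omega_11 \<tau>2 \<tau>1 \<epsilon>"
  by (simp add: Omega_11_def Omega_22_def)

lemma Omega_12_eq: "Omega_12 \<tau>1 \<tau>2 \<epsilon> = - \<epsilon> * neumann_column (A_matrix \<tau>1 \<epsilon>) (A_matrix \<tau>2 \<epsilon>) 1 / two_pi_i"
  by (simp add: Omega_12_def Let_def neumann_column_def)

lemma Omega_12_swap:
  assumes "small_pair (A_matrix \<tau>1 \<epsilon>) (A_matrix \<tau>2 \<epsilon>) d r s"
  shows "Omega_12 \<tau>2 \<tau>1 \<epsilon> = Omega_12 \<tau>1 \<tau>2 \<epsilon>"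
  unfolding Omega_12_eq using neumann_column_swap[OF assms A_matrix_sym A_matrix_sym] by simp

text \<open>
  With \<open>\<sigma>\<close> a square root of \<open>c \<tau> + d\<close>, the modular weight of \<open>E_{k+l}\<close> and the scaling of \<open>\<epsilon>\<close> combine to
  the conjugation factor \<open>\<sigma>^(k+l)\<close>.  The anomaly of \<open>E_2\<close> is felt in the corner only.
\<close>

lemma A_matrix_moebius:
  fixes a b c d :: int and \<sigma> :: complex
  assumes det: "a * d - b * c = 1" and \<tau>: "Im \<tau> > 0" and kl: "k \<ge> 1" "l \<ge> 1"
    and \<sigma>: "\<sigma>\<^sup>2 = of_int c * \<tau> + of_int d"
  shows "A_matrix ((of_int a * \<tau> + of_int b) / \<sigma>\<^sup>2) (\<epsilon> / \<sigma>\<^sup>2) k l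
     = \<sigma> ^ (k + l) * (A_matrix \<tau> \<epsilon> k l + (if k = 1 \<and> l = 1 then - \<epsilon> * of_int c / (two_pi_i * \<sigma>\<^sup>2) else 0))"
proof (cases "even (k + l)")
  case False
  then show ?thesis by (auto simp: A_matrix_odd)
next
  case True
  then obtain m where m: "k + l = 2 * m" by (elim evenE)
  define j where "j = of_int c * \<tau> + of_int d"
  have j: "j \<noteq> 0" unfolding j_def by (rule Im_moebius_int(1)[OF det \<tau>])
  have \<sigma>j: "\<sigma>\<^sup>2 = j" using \<sigma> by (simp add: j_def)
  obtain n where n: "2 * m = Suc n" using kl m by (cases "2 * m") auto
  have nm: "n = 1 \<longleftrightarrow> m = 1" using n by presburger
  have E: "eisenstein_E (2 * m) ((of_int a * \<tau> + of_int b) / j)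
      = j ^ (2 * m) * eisenstein_E (2 * m) \<tau> - (if m = 1 then of_int c * j / two_pi_i else 0)"
    using eisenstein_modular[OF det \<tau>, of n] nm unfolding j_def[symmetric] n by simp
  have "m = 1 \<longleftrightarrow> k = 1 \<and> l = 1" using m kl by auto
  moreover have "\<sigma> ^ (k + l) = j ^ m" unfolding m power_mult \<sigma>j ..
  ultimately show ?thesis
    unfolding A_matrix_eq \<sigma>j m E using j
    by (auto simp: power_divide field_simps power_mult power2_eq_square power_mult_distrib)
qed

lemma A_matrix_rescale:
  fixes \<sigma> :: complex
  assumes "\<sigma> \<noteq> 0"
  shows "A_matrix \<tau> (\<epsilon> / \<sigma>\<^sup>2) k l = A_matrix \<tau> \<epsilon> k l / \<sigma> ^ (k + l)"
proof (cases "even (k + l)")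
  case True
  then obtain m where m: "k + l = 2 * m" by (elim evenE)
  show ?thesis unfolding A_matrix_eq m by (simp add: power_divide power_mult)
qed (simp add: A_matrix_odd)

text \<open>
  The right-hand sides are the entries of the image of the period matrix under the element of
  \<open>Sp(4, Z)\<close> that acts as \<open>SL(2, Z)\<close> in the first variable.  The factor \<open>t\<close> of the rank-one update is
  \<open>j / D\<close>.  The denominator \<open>D\<close> is nonzero because \<open>t * D = j\<close>.
\<close>

lemma Omega_moebius:
  fixes a b c d :: int and \<tau>1 \<tau>2 \<epsilon> :: complex
  assumes det: "a * d - b * c = 1" and \<tau>: "Im \<tau>1 > 0"
  defines "j \<equiv> of_int c * \<tau>1 + of_int d"
  defines "\<tau>1' \<equiv> (of_int a * \<tau>1 + of_int b) / j" and "\<epsilon>' \<equiv> \<epsilon> / j"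
  assumes P: "small_pair (A_matrix \<tau>1 \<epsilon>) (A_matrix \<tau>2 \<epsilon>) \<delta> r s"
    and P': "small_pair (A_matrix \<tau>1' \<epsilon>') (A_matrix \<tau>2 \<epsilon>') \<delta>' (sqrt (norm j) * r) (s / sqrt (norm j))"
  defines "D \<equiv> of_int c * Omega_11 \<tau>1 \<tau>2 \<epsilon> + of_int d"
  shows "Omega_11 \<tau>1' \<tau>2 \<epsilon>' = (of_int a * Omega_11 \<tau>1 \<tau>2 \<epsilon> + of_int b) / D"
    and "Omega_12 \<tau>1' \<tau>2 \<epsilon>' = Omega_12 \<tau>1 \<tau>2 \<epsilon> / D"
    and "Omega_22 \<tau>1' \<tau>2 \<epsilon>' = Omega_22 \<tau>1 \<tau>2 \<epsilon> - of_int c * (Omega_12 \<tau>1 \<tau>2 \<epsilon>)\<^sup>2 / D"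
proof -
  let ?P = "two_pi_i :: complex"
  have j: "j \<noteq> 0" unfolding j_def by (rule Im_moebius_int(1)[OF det \<tau>])
  define \<sigma> where "\<sigma> = csqrt j"
  have \<sigma>: "\<sigma>\<^sup>2 = j" "\<sigma> \<noteq> 0" "norm \<sigma> = sqrt (norm j)" using j by (auto simp: \<sigma>_def norm_csqrt)
  \<comment> \<open>The correction to the corner of the first matrix.\<close>
  define \<kappa> where "\<kappa> = - \<epsilon> * of_int c / (?P * j)"
  define v where "v = neumann_column (A_matrix \<tau>1 \<epsilon>) (A_matrix \<tau>2 \<epsilon>) 1"
  define w where "w = mat_vec (A_matrix \<tau>2 \<epsilon>) (neumann_column (A_matrix \<tau>1 \<epsilon>) (A_matrix \<tau>2 \<epsilon>)) 1"
  define p where "p = mat_vec (A_matrix \<tau>1 \<epsilon>) (neumann_column (A_matrix \<tau>2 \<epsilon>) (A_matrix \<tau>1 \<epsilon>)) 1"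
  obtain t where t: "t * (1 - \<kappa> * w) = 1"
      "neumann_column (A_matrix \<tau>1' \<epsilon>') (A_matrix \<tau>2 \<epsilon>') 1 = t * v"
      "mat_vec (A_matrix \<tau>2 \<epsilon>') (neumann_column (A_matrix \<tau>1' \<epsilon>') (A_matrix \<tau>2 \<epsilon>')) 1 = t * w / \<sigma>\<^sup>2"
      "mat_vec (A_matrix \<tau>1' \<epsilon>') (neumann_column (A_matrix \<tau>2 \<epsilon>') (A_matrix \<tau>1' \<epsilon>')) 1 = \<sigma>\<^sup>2 * (p + \<kappa> * t * v\<^sup>2)"
    unfolding v_def w_def p_def
  proof (rule neumann_column_rank_one_update[OF P P'[folded \<sigma>(3)] \<sigma>(2) A_matrix_sym A_matrix_sym])
    fix k l :: nat assume "k \<ge> 1" "l \<ge> 1"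
    from A_matrix_moebius[OF det \<tau> this \<sigma>(1)[unfolded j_def], of \<epsilon>]
    show "A_matrix \<tau>1' \<epsilon>' k l = \<sigma> ^ (k + l) * (A_matrix \<tau>1 \<epsilon> k l + (if k = 1 \<and> l = 1 then \<kappa> else 0))"
      unfolding \<tau>1'_def \<epsilon>'_def \<kappa>_def \<sigma>(1)[symmetric] .
    show "A_matrix \<tau>2 \<epsilon>' k l = A_matrix \<tau>2 \<epsilon> k l / \<sigma> ^ (k + l)"
      unfolding \<epsilon>'_def \<sigma>(1)[symmetric] by (rule A_matrix_rescale[OF \<sigma>(2)])
  qed
  have O11: "Omega_11 \<tau>1 \<tau>2 \<epsilon> = \<tau>1 + \<epsilon> * w / ?P" by (simp add: Omega_11_eq w_def)
  have O12: "Omega_12 \<tau>1 \<tau>2 \<epsilon> = - \<epsilon> * v / ?P" by (simp add: Omega_12_eq v_def)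
  have O22: "Omega_22 \<tau>1 \<tau>2 \<epsilon> = \<tau>2 + \<epsilon> * p / ?P" by (simp add: Omega_22_eq_swap Omega_11_eq p_def)
  have "D = j + of_int c * (\<epsilon> * w / ?P)" unfolding D_def O11 by (simp add: j_def algebra_simps)
  then have "1 - \<kappa> * w = D / j" unfolding \<kappa>_def using j by (simp add: add_divide_distrib mult_ac)
  with t(1) have tD: "t * D = j" using j by (simp add: field_simps)
  then have D: "D \<noteq> 0" using j by auto
  have tj: "t = j / D" using tD D by (simp add: field_simps)
  show "Omega_12 \<tau>1' \<tau>2 \<epsilon>' = Omega_12 \<tau>1 \<tau>2 \<epsilon> / D"
    unfolding O12 unfolding Omega_12_eq t(2) unfolding tj \<epsilon>'_def using j D by (simp add: field_simps)
  have "Omega_22 \<tau>1' \<tau>2 \<epsilon>' = \<tau>2 + \<epsilon>' * (\<sigma>\<^sup>2 * (p + \<kappa> * t * v\<^sup>2)) / ?P"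
    unfolding Omega_22_eq_swap Omega_11_eq t(4) ..
  also have "\<dots> = \<tau>2 + \<epsilon> * p / ?P + \<epsilon> * \<kappa> * t * v\<^sup>2 / ?P"
    unfolding \<sigma> \<epsilon>'_def using j by (simp add: field_simps)
  also have "\<epsilon> * \<kappa> * t * v\<^sup>2 / ?P = - of_int c * (- \<epsilon> * v / ?P)\<^sup>2 / D"
    unfolding \<kappa>_def tj using j D by (simp add: field_simps power2_eq_square)
  finally show "Omega_22 \<tau>1' \<tau>2 \<epsilon>' = Omega_22 \<tau>1 \<tau>2 \<epsilon> - of_int c * (Omega_12 \<tau>1 \<tau>2 \<epsilon>)\<^sup>2 / D"
    unfolding O12 O22 by simp
  have det': "of_int a * of_int d - of_int b * of_int c = (1 :: complex)"
    using det by (metis of_int_1 of_int_diff of_int_mult)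
  have "Omega_11 \<tau>1' \<tau>2 \<epsilon>' = \<tau>1' + \<epsilon>' * (t * w / \<sigma>\<^sup>2) / ?P"
    unfolding Omega_11_eq t(3) ..
  also have "\<dots> = ((of_int a * \<tau>1 + of_int b) * D + \<epsilon> * w / ?P) / (j * D)"
    unfolding \<tau>1'_def \<epsilon>'_def \<sigma> tj using j D by (simp add: field_simps)
  also have "(of_int a * \<tau>1 + of_int b) * D + \<epsilon> * w / ?P = (of_int a * Omega_11 \<tau>1 \<tau>2 \<epsilon> + of_int b) * j"
  proof -
    define x where "x = \<epsilon> * w / ?P"
    have "(of_int a * \<tau>1 + of_int b) * (of_int c * (\<tau>1 + x) + of_int d) + x
       = (of_int a * (\<tau>1 + x) + of_int b) * (of_int c * \<tau>1 + of_int d) + (1 - (of_int a * of_int d - of_int b * of_int c)) * x"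
      by (simp add: algebra_simps)
    then show ?thesis unfolding D_def O11 x_def[symmetric] j_def using det' by simp
  qed
  also have "(of_int a * Omega_11 \<tau>1 \<tau>2 \<epsilon> + of_int b) * j / (j * D) = (of_int a * Omega_11 \<tau>1 \<tau>2 \<epsilon> + of_int b) / D"
    using j by simp
  finally show "Omega_11 \<tau>1' \<tau>2 \<epsilon>' = (of_int a * Omega_11 \<tau>1 \<tau>2 \<epsilon> + of_int b) / D" .
qed

section \<open>Injectivity over half-planes\<close>

lemma norm_power_diff_le:
  fixes z w :: complex
  assumes "norm z \<le> M" "norm w \<le> M"
  shows "norm (z ^ Suc n - w ^ Suc n) \<le> real (Suc n) * M ^ n * norm (z - w)"
proof (induction n)
  case (Suc n)
  have M: "M \<ge> 0" using assms(1) norm_ge_zero order_trans by blast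
  have "z ^ Suc (Suc n) - w ^ Suc (Suc n) = z * (z ^ Suc n - w ^ Suc n) + (z - w) * w ^ Suc n"
    by (simp add: algebra_simps)
  moreover have "norm (z * (z ^ Suc n - w ^ Suc n)) \<le> M * (real (Suc n) * M ^ n * norm (z - w))"
    unfolding norm_mult[of z] using assms Suc M by (intro mult_mono) auto
  moreover have "norm ((z - w) * w ^ Suc n) \<le> norm (z - w) * M ^ Suc n"
    unfolding norm_mult[of "z - w"] norm_power using assms M by (intro mult_left_mono power_mono) auto
  ultimately have "norm (z ^ Suc (Suc n) - w ^ Suc (Suc n)) \<le> M * (real (Suc n) * M ^ n * norm (z - w)) + norm (z - w) * M ^ Suc n"
    by (metis norm_triangle_mono)
  also have "\<dots> = real (Suc (Suc n)) * M ^ Suc n * norm (z - w)" by (simp add: algebra_simps)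
  finally show ?case .
qed auto

text \<open>
  Since \<open>k + l \<ge> 2\<close> for every entry, one factor \<open>\<epsilon>\<close> can be split off; the remaining powers of \<open>\<epsilon>\<close> produce
  the geometric decay with ratio \<open>1 / 2\<close>.  The factor \<open>m\<close> from differentiating \<open>\<epsilon>^m\<close> is absorbed by
  \<open>m \<le> 2^m\<close>.
\<close>

lemma A_matrix_Lipschitz:
  fixes K b M :: real
  assumes K: "K > 0" "b \<ge> 1"
    and bound: "\<And>k \<tau>. k \<ge> 1 \<Longrightarrow> Im \<tau> \<ge> y \<Longrightarrow> norm (eisenstein_E k \<tau>) \<le> K * b ^ k"
    and lip: "\<And>k \<tau> \<tau>'. k \<ge> 1 \<Longrightarrow> Im \<tau> \<ge> y \<Longrightarrow> Im \<tau>' \<ge> y \<Longrightarrow>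
       norm (eisenstein_E k \<tau> - eisenstein_E k \<tau>') \<le> K * b ^ k * norm (\<tau> - \<tau>')"
    and M: "0 < M" "128 * b\<^sup>2 * M \<le> 1"
    and \<tau>: "Im \<tau> \<ge> y" "Im \<tau>' \<ge> y" and \<epsilon>: "norm \<epsilon> \<le> M" "norm \<epsilon>' \<le> M"
  shows "mat_bound (A_matrix \<tau> \<epsilon>) (128 * b\<^sup>2 * K * M) (1 / 2)"
    and "mat_bound (\<lambda>k l. A_matrix \<tau> \<epsilon> k l - A_matrix \<tau>' \<epsilon>' k l)
           (128 * b\<^sup>2 * K * (M * norm (\<tau> - \<tau>') + norm (\<epsilon> - \<epsilon>'))) (1 / 2)"
proof -
  have quarter: "(32 * b\<^sup>2) ^ Suc n * M ^ n \<le> 128 * b\<^sup>2 * (1 / 2) ^ (2 * Suc n)" for n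
  proof -
    have "(32 * b\<^sup>2) ^ Suc n * M ^ n = 32 * b\<^sup>2 * (32 * b\<^sup>2 * M) ^ n" by (simp add: power_mult_distrib)
    also have "\<dots> \<le> 32 * b\<^sup>2 * (1 / 4) ^ n" using M by (intro mult_left_mono power_mono) auto
    also have "\<dots> = 128 * b\<^sup>2 * (1 / 2) ^ (2 * Suc n)" unfolding power_mult by (simp add: power2_eq_square)
    finally show ?thesis .
  qed
  have coeff: "norm (sewing_coeff k l) \<le> (16 :: real) ^ m" if "k \<ge> 1" "l \<ge> 1" "k + l = 2 * m" for k l m
    using norm_sewing_coeff_le[OF that(1,2)] unfolding that(3) power_mult by simp
  show "mat_bound (A_matrix \<tau> \<epsilon>) (128 * b\<^sup>2 * K * M) (1 / 2)"
    unfolding mat_bound_def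
  proof (intro allI impI)
    fix k l :: nat assume kl: "1 \<le> k" "1 \<le> l"
    show "norm (A_matrix \<tau> \<epsilon> k l) \<le> 128 * b\<^sup>2 * K * M * (1 / 2) ^ (k + l)"
    proof (cases "even (k + l)")
      case True
      then obtain m where "k + l = 2 * m" by (elim evenE)
      then obtain n where m: "k + l = 2 * Suc n" using kl by (cases m) auto
      have "A_matrix \<tau> \<epsilon> k l = \<epsilon> ^ Suc n * sewing_coeff k l * eisenstein_E (2 * Suc n) \<tau>"
        unfolding A_matrix_eq m by (simp del: power_Suc mult_Suc_right)
      moreover have "norm (\<epsilon> ^ Suc n) \<le> M ^ Suc n" unfolding norm_power using \<epsilon> by (intro power_mono) auto
      moreover have "norm (eisenstein_E (2 * Suc n) \<tau>) \<le> K * b ^ (2 * Suc n)" using \<tau> by (intro bound) auto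
      ultimately have "norm (A_matrix \<tau> \<epsilon> k l) \<le> M ^ Suc n * 16 ^ Suc n * (K * b ^ (2 * Suc n))"
        using coeff[OF kl m] M K by (simp only: norm_mult) (intro mult_mono, auto simp del: power_Suc mult_Suc_right)
      also have "\<dots> = K * M * ((16 * b\<^sup>2) ^ Suc n * M ^ n)"
        unfolding power_mult[of b] power_mult_distrib by simp
      also have "\<dots> \<le> K * M * ((32 * b\<^sup>2) ^ Suc n * M ^ n)"
        using K M by (intro mult_left_mono mult_right_mono power_mono) auto
      also have "\<dots> \<le> K * M * (128 * b\<^sup>2 * (1 / 2) ^ (2 * Suc n))"
        using K M by (intro mult_left_mono quarter) auto
      finally show ?thesis unfolding m by (simp add: mult_ac)
    qed (use K M in \<open>simp add: A_matrix_odd\<close>)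
  qed
  show "mat_bound (\<lambda>k l. A_matrix \<tau> \<epsilon> k l - A_matrix \<tau>' \<epsilon>' k l)
           (128 * b\<^sup>2 * K * (M * norm (\<tau> - \<tau>') + norm (\<epsilon> - \<epsilon>'))) (1 / 2)"
    unfolding mat_bound_def
  proof (intro allI impI)
    fix k l :: nat assume kl: "1 \<le> k" "1 \<le> l"
    define t e where "t = norm (\<tau> - \<tau>')" and "e = norm (\<epsilon> - \<epsilon>')"
    have te: "t \<ge> 0" "e \<ge> 0" by (auto simp: t_def e_def)
    show "norm (A_matrix \<tau> \<epsilon> k l - A_matrix \<tau>' \<epsilon>' k l) \<le> 128 * b\<^sup>2 * K * (M * norm (\<tau> - \<tau>') + norm (\<epsilon> - \<epsilon>')) * (1 / 2) ^ (k + l)"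
    proof (cases "even (k + l)")
      case True
      then obtain m where "k + l = 2 * m" by (elim evenE)
      then obtain n where m: "k + l = 2 * Suc n" using kl by (cases m) auto
      have n1: "real (Suc n) \<le> 2 ^ Suc n" using less_exp[of "Suc n"] by (metis less_imp_le of_nat_le_iff of_nat_numeral of_nat_power)
      have "norm (\<epsilon> ^ Suc n * (eisenstein_E (k + l) \<tau> - eisenstein_E (k + l) \<tau>')) \<le> M ^ Suc n * (K * b ^ (2 * Suc n) * t)"
      proof -
        have "norm (\<epsilon> ^ Suc n) \<le> M ^ Suc n" unfolding norm_power using \<epsilon> by (intro power_mono) auto
        moreover have "norm (eisenstein_E (k + l) \<tau> - eisenstein_E (k + l) \<tau>') \<le> K * b ^ (2 * Suc n) * t"
          unfolding t_def m using \<tau> by (intro lip) auto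
        ultimately show ?thesis
          using M by (simp only: norm_mult) (intro mult_mono, auto simp del: power_Suc mult_Suc_right)
      qed
      moreover have "norm ((\<epsilon> ^ Suc n - \<epsilon>' ^ Suc n) * eisenstein_E (k + l) \<tau>') \<le> (2 ^ Suc n * M ^ n * e) * (K * b ^ (2 * Suc n))"
      proof -
        have "norm (\<epsilon> ^ Suc n - \<epsilon>' ^ Suc n) \<le> real (Suc n) * M ^ n * e"
          unfolding e_def by (rule norm_power_diff_le[OF \<epsilon>])
        also have "\<dots> \<le> 2 ^ Suc n * M ^ n * e" using n1 M te by (intro mult_right_mono) auto
        finally have "norm (\<epsilon> ^ Suc n - \<epsilon>' ^ Suc n) \<le> 2 ^ Suc n * M ^ n * e" .
        moreover have "norm (eisenstein_E (k + l) \<tau>') \<le> K * b ^ (2 * Suc n)"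
          unfolding m using \<tau> by (intro bound) auto
        ultimately show ?thesis
          using M te by (simp only: norm_mult) (intro mult_mono, auto simp del: power_Suc mult_Suc_right)
      qed
      moreover have "\<epsilon> ^ Suc n * eisenstein_E (k + l) \<tau> - \<epsilon>' ^ Suc n * eisenstein_E (k + l) \<tau>'
        = \<epsilon> ^ Suc n * (eisenstein_E (k + l) \<tau> - eisenstein_E (k + l) \<tau>') + (\<epsilon> ^ Suc n - \<epsilon>' ^ Suc n) * eisenstein_E (k + l) \<tau>'"
        by (simp add: algebra_simps)
      ultimately have 1: "norm (\<epsilon> ^ Suc n * eisenstein_E (k + l) \<tau> - \<epsilon>' ^ Suc n * eisenstein_E (k + l) \<tau>')
         \<le> M ^ Suc n * (K * b ^ (2 * Suc n) * t) + (2 ^ Suc n * M ^ n * e) * (K * b ^ (2 * Suc n))"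
        by (metis norm_triangle_mono)
      also have "\<dots> = K * b ^ (2 * Suc n) * M ^ n * (1 * (M * t) + 2 ^ Suc n * e)" by (simp add: algebra_simps)
      also have "\<dots> \<le> K * b ^ (2 * Suc n) * M ^ n * (2 ^ Suc n * (M * t) + 2 ^ Suc n * e)"
        using K M te by (intro mult_left_mono add_right_mono mult_right_mono one_le_power) auto
      also have "\<dots> = K * b ^ (2 * Suc n) * M ^ n * 2 ^ Suc n * (M * t + e)"
        by (simp add: algebra_simps del: power_Suc mult_Suc_right)
      finally have 2: "norm (\<epsilon> ^ Suc n * eisenstein_E (k + l) \<tau> - \<epsilon>' ^ Suc n * eisenstein_E (k + l) \<tau>')
         \<le> K * b ^ (2 * Suc n) * M ^ n * 2 ^ Suc n * (M * t + e)" .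
      have "A_matrix \<tau> \<epsilon> k l - A_matrix \<tau>' \<epsilon>' k l
         = sewing_coeff k l * (\<epsilon> ^ Suc n * eisenstein_E (k + l) \<tau> - \<epsilon>' ^ Suc n * eisenstein_E (k + l) \<tau>')"
        unfolding A_matrix_eq m by (simp add: algebra_simps)
      then have "norm (A_matrix \<tau> \<epsilon> k l - A_matrix \<tau>' \<epsilon>' k l) \<le> 16 ^ Suc n * (K * b ^ (2 * Suc n) * M ^ n * 2 ^ Suc n * (M * t + e))"
        unfolding norm_mult using coeff[OF kl m] 2 by (simp only: norm_mult) (intro mult_mono, auto)
      also have "\<dots> = K * (M * t + e) * ((16 ^ Suc n * 2 ^ Suc n * (b\<^sup>2) ^ Suc n) * M ^ n)"
        unfolding power_mult[of b] by (simp only: mult_ac)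
      also have "16 ^ Suc n * 2 ^ Suc n * (b\<^sup>2) ^ Suc n = (32 * b\<^sup>2) ^ Suc n"
        unfolding power_mult_distrib[symmetric] by simp
      also have "K * (M * t + e) * ((32 * b\<^sup>2) ^ Suc n * M ^ n) \<le> K * (M * t + e) * (128 * b\<^sup>2 * (1 / 2) ^ (2 * Suc n))"
        using K M te by (intro mult_left_mono quarter) auto
      finally show ?thesis unfolding m t_def e_def by (simp only: mult_ac)
    qed (use K M in \<open>simp add: A_matrix_odd\<close>)
  qed
qed

lemma F_eps_eq_iff:
  "F_eps (\<tau>1, \<tau>2, \<epsilon>) = F_eps (\<tau>1', \<tau>2', \<epsilon>') \<longleftrightarrow>
     Omega_11 \<tau>1 \<tau>2 \<epsilon> = Omega_11 \<tau>1' \<tau>2' \<epsilon>' \<and> Omega_12 \<tau>1 \<tau>2 \<epsilon> = Omega_12 \<tau>1' \<tau>2' \<epsilon>' \<and>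
     Omega_22 \<tau>1 \<tau>2 \<epsilon> = Omega_22 \<tau>1' \<tau>2' \<epsilon>'"
  by (auto simp: vec_eq_iff forall_2)

text \<open>
  Up to constant factors, the three entries are \<open>\<tau>1\<close>, \<open>\<tau>2\<close> and \<open>\<epsilon>\<close> plus functions whose Lipschitz constant is
  \<open>O(M)\<close> when \<open>|\<epsilon>| \<le> M\<close>.  For small \<open>M\<close> equality of the entries forces equality of the arguments.
\<close>

lemma F_eps_injective_half_planes:
  assumes y: "y > 0"
  obtains M where "M > 0" "inj_on F_eps {(\<tau>1, \<tau>2, \<epsilon>). y \<le> Im \<tau>1 \<and> y \<le> Im \<tau>2 \<and> norm \<epsilon> \<le> M}"
proof -
  obtain K b where Kb: "K > 0" "b \<ge> 1"
    "\<And>k \<tau>. k \<ge> 1 \<Longrightarrow> Im \<tau> \<ge> y \<Longrightarrow> norm (eisenstein_E k \<tau>) \<le> K * b ^ k"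
    "\<And>k \<tau> \<tau>'. k \<ge> 1 \<Longrightarrow> Im \<tau> \<ge> y \<Longrightarrow> Im \<tau>' \<ge> y \<Longrightarrow>
       norm (eisenstein_E k \<tau> - eisenstein_E k \<tau>') \<le> K * b ^ k * norm (\<tau> - \<tau>')"
    by (rule eisenstein_growth[OF y]) (rule that)
  define H where "H = 128 * b\<^sup>2 * K"
  \<comment> \<open>The last entry gives \<open>36 H M \<le> 1\<close>, where \<open>H M\<close> bounds the matrices and \<open>7 H M\<close> will be the
     contraction constant.\<close>
  define M where "M = min 1 (min (1 / (128 * b\<^sup>2)) (1 / (36 * H)))"
  have b: "b\<^sup>2 > 0" using Kb by simp
  have H: "H > 0" using Kb by (simp add: H_def)
  have M: "0 < M" "M \<le> 1" using b H by (auto simp: M_def)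
  have M1: "128 * b\<^sup>2 * M \<le> 1"
  proof -
    have "128 * b\<^sup>2 * M \<le> 128 * b\<^sup>2 * (1 / (128 * b\<^sup>2))" using b by (intro mult_left_mono) (auto simp: M_def)
    then show ?thesis using b by simp
  qed
  have M2: "36 * (H * M) \<le> 1"
  proof -
    have "36 * H * M \<le> 36 * H * (1 / (36 * H))" using H by (intro mult_left_mono) (auto simp: M_def)
    then show ?thesis using H by simp
  qed
  have *: "\<tau>1 = \<tau>1' \<and> \<tau>2 = \<tau>2' \<and> \<epsilon> = \<epsilon>'"
    if \<tau>: "Im \<tau>1 \<ge> y" "Im \<tau>2 \<ge> y" "Im \<tau>1' \<ge> y" "Im \<tau>2' \<ge> y" and \<epsilon>: "norm \<epsilon> \<le> M" "norm \<epsilon>' \<le> M"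
      and eq: "Omega_11 \<tau>1 \<tau>2 \<epsilon> = Omega_11 \<tau>1' \<tau>2' \<epsilon>'" "Omega_12 \<tau>1 \<tau>2 \<epsilon> = Omega_12 \<tau>1' \<tau>2' \<epsilon>'"
       "Omega_22 \<tau>1 \<tau>2 \<epsilon> = Omega_22 \<tau>1' \<tau>2' \<epsilon>'" for \<tau>1 \<tau>2 \<epsilon> \<tau>1' \<tau>2' \<epsilon>'
  proof -
    define e where "e = norm (\<epsilon> - \<epsilon>')"
    define t where "t = norm (\<tau>1 - \<tau>1') + norm (\<tau>2 - \<tau>2')"
    have te: "t \<ge> 0" "e \<ge> 0" "norm (\<tau>1 - \<tau>1') \<le> t" "norm (\<tau>2 - \<tau>2') \<le> t" by (auto simp: t_def e_def)
    have A: "mat_bound (A_matrix \<tau> \<eta>) (H * M) (1 / 2)" if "Im \<tau> \<ge> y" "norm \<eta> \<le> M" for \<tau> \<eta>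
      unfolding H_def using A_matrix_Lipschitz(1)[OF Kb M(1) M1 that(1,1,2,2)] by simp
    have dA: "mat_bound (\<lambda>k l. A_matrix \<tau> \<epsilon> k l - A_matrix \<tau>' \<epsilon>' k l) (H * (M * t + e)) (1 / 2)"
      if "Im \<tau> \<ge> y" "Im \<tau>' \<ge> y" "norm (\<tau> - \<tau>') \<le> t" for \<tau> \<tau>'
      unfolding mat_bound_def
    proof (intro allI impI)
      fix k l :: nat assume "1 \<le> k" "1 \<le> l"
      then have "norm (A_matrix \<tau> \<epsilon> k l - A_matrix \<tau>' \<epsilon>' k l) \<le> H * (M * norm (\<tau> - \<tau>') + e) * (1 / 2) ^ (k + l)"
        using A_matrix_Lipschitz(2)[OF Kb M(1) M1 that(1,2) \<epsilon>] unfolding H_def e_def mat_bound_def by blast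
      also have "\<dots> \<le> H * (M * t + e) * (1 / 2) ^ (k + l)"
        using that H M by (intro mult_right_mono mult_left_mono add_right_mono) auto
      finally show "norm (A_matrix \<tau> \<epsilon> k l - A_matrix \<tau>' \<epsilon>' k l) \<le> H * (M * t + e) * (1 / 2) ^ (k + l)" .
    qed
    have HM: "0 \<le> H * M" "H * M \<le> 1 / 2" using H M M2 by auto
    have sp: "small_pair (A_matrix \<tau> \<eta>) (A_matrix \<tau>' \<eta>) (H * M) (1 / 2) (1 / 2)"
      if "Im \<tau> \<ge> y" "Im \<tau>' \<ge> y" "norm \<eta> \<le> M" for \<tau> \<tau>' \<eta>
      unfolding small_pair_def using A that HM by auto
    define X where "X = H * (M * t + e)"
    have X: "0 \<le> X" "X \<le> H * (t + e)"
      using H M te by (auto simp: X_def intro!: mult_left_mono mult_left_le_one_le)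
    have S: "M * X \<le> H * M * (t + e)" using X(2) M mult_left_mono[of X "H * (t + e)" M] by (simp add: mult_ac)
    have diag: "norm (\<sigma>1 - \<sigma>1') \<le> H * M * (t + e)"
      if s: "Im \<sigma>1 \<ge> y" "Im \<sigma>2 \<ge> y" "Im \<sigma>1' \<ge> y" "Im \<sigma>2' \<ge> y" "norm (\<sigma>1 - \<sigma>1') \<le> t" "norm (\<sigma>2 - \<sigma>2') \<le> t"
        and O: "Omega_11 \<sigma>1 \<sigma>2 \<epsilon> = Omega_11 \<sigma>1' \<sigma>2' \<epsilon>'" for \<sigma>1 \<sigma>2 \<sigma>1' \<sigma>2'
    proof -
      define w where "w = mat_vec (A_matrix \<sigma>2 \<epsilon>) (neumann_column (A_matrix \<sigma>1 \<epsilon>) (A_matrix \<sigma>2 \<epsilon>)) 1"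
      define w' where "w' = mat_vec (A_matrix \<sigma>2' \<epsilon>') (neumann_column (A_matrix \<sigma>1' \<epsilon>') (A_matrix \<sigma>2' \<epsilon>')) 1"
      have w: "norm w \<le> 2 * (H * M)" using neumann_column_bounds(3)[OF sp[OF s(1,2) \<epsilon>(1)]] by (simp add: w_def)
      have ww: "norm (w - w') \<le> 4 * X"
        using neumann_column_Lipschitz(2)[OF sp[OF s(1,2) \<epsilon>(1)] sp[OF s(3,4) \<epsilon>(2)] dA[OF s(1,3,5)] dA[OF s(2,4,6)]]
        by (simp add: w_def w'_def X_def)
      have "two_pi_i * (\<sigma>1' - \<sigma>1) = \<epsilon> * w - \<epsilon>' * w'"
        using O unfolding Omega_11_eq w_def[symmetric] w'_def[symmetric] by (simp add: field_simps)
      also have "\<dots> = (\<epsilon> - \<epsilon>') * w + \<epsilon>' * (w - w')" by (simp add: algebra_simps)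
      finally have "2 * pi * norm (\<sigma>1 - \<sigma>1') = norm ((\<epsilon> - \<epsilon>') * w + \<epsilon>' * (w - w'))"
        by (metis (no_types, lifting) norm_mult norm_minus_commute norm_of_real norm_ii norm_numeral mult_1_right abs_of_nonneg pi_ge_zero)
      also have "\<dots> \<le> e * (2 * (H * M)) + M * (4 * X)"
        unfolding e_def using w ww \<epsilon> M by (intro norm_triangle_mono) (auto simp: norm_mult intro!: mult_mono)
      also have "\<dots> \<le> 2 * (H * M * (t + e)) + 4 * (H * M * (t + e))"
      proof (rule add_mono)
        have "e * (2 * (H * M)) = 2 * (H * M * e)" by simp
        also have "\<dots> \<le> 2 * (H * M * (t + e))" using HM te by (intro mult_left_mono) auto
        finally show "e * (2 * (H * M)) \<le> 2 * (H * M * (t + e))" .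
        have "M * (4 * X) = 4 * (M * X)" by simp
        also have "\<dots> \<le> 4 * (H * M * (t + e))" using S by (intro mult_left_mono) auto
        finally show "M * (4 * X) \<le> 4 * (H * M * (t + e))" .
      qed
      also have "\<dots> \<le> 2 * pi * (H * M * (t + e))"
        using HM te pi_gt3 mult_right_mono[of 6 "2 * pi" "H * M * (t + e)"] by auto
      finally show ?thesis by simp
    qed
    have d1: "norm (\<tau>1 - \<tau>1') \<le> H * M * (t + e)"
      by (rule diag[OF \<tau> te(3,4) eq(1)])
    \<comment> \<open>The second diagonal entry is the first one with the two tori exchanged.\<close>
    have d2: "norm (\<tau>2 - \<tau>2') \<le> H * M * (t + e)"
      by (rule diag[OF \<tau>(2,1,4,3) te(4,3) eq(3)[unfolded Omega_22_eq_swap]])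
    define v where "v = neumann_column (A_matrix \<tau>1 \<epsilon>) (A_matrix \<tau>2 \<epsilon>) 1"
    define v' where "v' = neumann_column (A_matrix \<tau>1' \<epsilon>') (A_matrix \<tau>2' \<epsilon>') 1"
    have v: "norm (v - 1) \<le> 2 * (H * M)\<^sup>2" unfolding v_def by (rule neumann_column_bounds(2)[OF sp[OF \<tau>(1,2) \<epsilon>(1)]])
    have vv: "norm (v - v') \<le> 8 * (H * M) * X"
      unfolding v_def v'_def X_def
      by (rule neumann_column_Lipschitz(1)[OF sp[OF \<tau>(1,2) \<epsilon>(1)] sp[OF \<tau>(3,4) \<epsilon>(2)] dA[OF \<tau>(1,3) te(3)] dA[OF \<tau>(2,4) te(4)]])
    have "\<epsilon> * v = \<epsilon>' * v'" using eq(2) unfolding Omega_12_eq v_def[symmetric] v'_def[symmetric] by simp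
    then have "\<epsilon>' - \<epsilon> = (\<epsilon> - \<epsilon>') * (v - 1) + \<epsilon>' * (v - v')" by (simp add: algebra_simps)
    then have "e = norm ((\<epsilon> - \<epsilon>') * (v - 1) + \<epsilon>' * (v - v'))" unfolding e_def by (metis norm_minus_commute)
    also have "\<dots> \<le> e * (2 * (H * M)\<^sup>2) + M * (8 * (H * M) * X)"
      unfolding e_def using v vv \<epsilon> M by (intro norm_triangle_mono) (auto simp: norm_mult intro!: mult_mono)
    also have "\<dots> \<le> H * M * (t + e) + 4 * (H * M * (t + e))"
    proof (rule add_mono)
      have "e * (2 * (H * M)\<^sup>2) = (2 * (H * M)) * (H * M * e)" by (simp add: power2_eq_square)
      also have "\<dots> \<le> 1 * (H * M * (t + e))" using HM H M te by (intro mult_mono) (auto intro: mult_left_mono)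
      finally show "e * (2 * (H * M)\<^sup>2) \<le> H * M * (t + e)" by simp
      have "M * (8 * (H * M) * X) = (8 * (H * M)) * (M * X)" by simp
      also have "\<dots> \<le> 4 * (H * M * (t + e))" using HM S M X by (intro mult_mono[of "8 * (H * M)" 4 "M * X"]) auto
      finally show "M * (8 * (H * M) * X) \<le> 4 * (H * M * (t + e))" .
    qed
    finally have "t + e \<le> 7 * (H * M * (t + e))" using d1 d2 unfolding t_def by linarith
    moreover have "36 * (H * M * (t + e)) \<le> t + e"
      using mult_right_mono[OF M2, of "t + e"] te by (simp add: mult.assoc)
    moreover have "0 \<le> H * M * (t + e)" using HM te by simp
    ultimately have "t + e = 0" using te by linarith
    then show ?thesis using te by (simp add: t_def e_def add_nonneg_eq_0_iff)
  qed
  have "inj_on F_eps {(\<tau>1, \<tau>2, \<epsilon>). y \<le> Im \<tau>1 \<and> y \<le> Im \<tau>2 \<and> norm \<epsilon> \<le> M}"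
    by (rule inj_onI) (use * in \<open>force simp only: F_eps_eq_iff mem_Collect_eq split_paired_all prod.case prod.inject\<close>)
  then show thesis using that M(1) by blast
qed

section \<open>Modular orbits of horizontal strips\<close>

lemma SL2Z_det: "\<gamma> \<in> SL2Z \<Longrightarrow> \<gamma> $ 1 $ 1 * \<gamma> $ 2 $ 2 - \<gamma> $ 1 $ 2 * \<gamma> $ 2 $ 1 = 1"
  by (simp add: SL2Z_def det_2)

lemma aut_factor_nonzero: "\<gamma> \<in> SL2Z \<Longrightarrow> Im \<tau> > 0 \<Longrightarrow> aut_factor \<gamma> \<tau> \<noteq> 0"
  unfolding aut_factor_def by (rule Im_moebius_int(1)[OF SL2Z_det])

lemma Im_moebius: "\<gamma> \<in> SL2Z \<Longrightarrow> Im \<tau> > 0 \<Longrightarrow> Im (moebius \<gamma> \<tau>) = Im \<tau> / (norm (aut_factor \<gamma> \<tau>))\<^sup>2"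
  unfolding moebius_def aut_factor_def by (rule Im_moebius_int(2)[OF SL2Z_det])

lemma Im_moebius_pos: "\<gamma> \<in> SL2Z \<Longrightarrow> Im \<tau> > 0 \<Longrightarrow> Im (moebius \<gamma> \<tau>) > 0"
  using aut_factor_nonzero[of \<gamma> \<tau>] by (simp add: Im_moebius)

definition sl2_inverse :: "int^2^2 \<Rightarrow> int^2^2" where
  "sl2_inverse \<gamma> = vector [vector [\<gamma> $ 2 $ 2, - \<gamma> $ 1 $ 2], vector [- \<gamma> $ 2 $ 1, \<gamma> $ 1 $ 1]]"

lemma sl2_inverse:
  assumes "\<gamma> \<in> SL2Z"
  shows "sl2_inverse \<gamma> \<in> SL2Z" "sl2_inverse \<gamma> ** \<gamma> = mat 1" "\<gamma> ** sl2_inverse \<gamma> = mat 1"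
  using SL2Z_det[OF assms]
  by (simp_all add: SL2Z_def det_2 sl2_inverse_def vec_eq_iff forall_2 matrix_matrix_mult_def sum_2 mat_def mult.commute)

lemma SL2Z_mult: "\<gamma> \<in> SL2Z \<Longrightarrow> \<delta> \<in> SL2Z \<Longrightarrow> \<gamma> ** \<delta> \<in> SL2Z"
  by (simp add: SL2Z_def det_mul)

lemma aut_factor_mult:
  assumes "\<delta> \<in> SL2Z" "Im \<tau> > 0"
  shows "aut_factor (\<gamma> ** \<delta>) \<tau> = aut_factor \<gamma> (moebius \<delta> \<tau>) * aut_factor \<delta> \<tau>"
proof -
  have "aut_factor \<gamma> (moebius \<delta> \<tau>) * aut_factor \<delta> \<tau>
     = of_int (\<gamma> $ 2 $ 1) * (of_int (\<delta> $ 1 $ 1) * \<tau> + of_int (\<delta> $ 1 $ 2)) + of_int (\<gamma> $ 2 $ 2) * aut_factor \<delta> \<tau>"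
    using aut_factor_nonzero[OF assms] unfolding aut_factor_def[of \<gamma>] moebius_def by (simp add: field_simps)
  then show ?thesis by (simp add: aut_factor_def matrix_matrix_mult_def sum_2 algebra_simps)
qed

lemma moebius_mult:
  assumes "\<delta> \<in> SL2Z" "Im \<tau> > 0"
  shows "moebius (\<gamma> ** \<delta>) \<tau> = moebius \<gamma> (moebius \<delta> \<tau>)"
proof -
  let ?m = "\<lambda>z. of_int (\<gamma> $ 1 $ 1) * z + of_int (\<gamma> $ 1 $ 2) :: complex"
  have "?m (moebius \<delta> \<tau>) * aut_factor \<delta> \<tau>
     = of_int (\<gamma> $ 1 $ 1) * (of_int (\<delta> $ 1 $ 1) * \<tau> + of_int (\<delta> $ 1 $ 2)) + of_int (\<gamma> $ 1 $ 2) * aut_factor \<delta> \<tau>"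
    using aut_factor_nonzero[OF assms] unfolding moebius_def by (simp add: field_simps)
  also have "\<dots> = of_int ((\<gamma> ** \<delta>) $ 1 $ 1) * \<tau> + of_int ((\<gamma> ** \<delta>) $ 1 $ 2)"
    by (simp add: aut_factor_def matrix_matrix_mult_def sum_2 algebra_simps)
  finally show ?thesis
    unfolding moebius_def[of "\<gamma> ** \<delta>"] moebius_def[of \<gamma>] aut_factor_mult[OF assms]
    using aut_factor_nonzero[OF assms] by (metis mult_divide_mult_cancel_right)
qed

lemma moebius_mat_1: "moebius (mat 1) \<tau> = \<tau>" "aut_factor (mat 1) \<tau> = 1"
  by (simp_all add: moebius_def aut_factor_def mat_def)

lemma mat_1_in_SL2Z: "mat 1 \<in> SL2Z"
  by (simp add: SL2Z_def)

lemma act_1_mult: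
  assumes "\<delta> \<in> SL2Z" "Im (fst x) > 0"
  shows "act_1 \<gamma> (act_1 \<delta> x) = act_1 (\<gamma> ** \<delta>) x"
  using assms by (cases x) (simp add: moebius_mult aut_factor_mult mult.commute)

lemma act_1_inverse:
  assumes "\<gamma> \<in> SL2Z" "Im (fst x) > 0"
  shows "act_1 \<gamma> (act_1 (sl2_inverse \<gamma>) x) = x" "act_1 (sl2_inverse \<gamma>) (act_1 \<gamma> x) = x"
  using sl2_inverse[OF assms(1)] assms
  by (cases x, simp_all only: act_1_mult fst_conv, simp_all add: moebius_mat_1)+

lemma act_beta_involution: "act_beta (act_beta x) = x"
  by (cases x) simp

lemma act_2_eq: "act_2 \<gamma> x = act_beta (act_1 \<gamma> (act_beta x))"
  by (cases x) simp

text \<open>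
  A bounded strip, rather than a half-plane, because the Eisenstein series do not decay as \<open>Im \<tau>\<close>
  grows, whereas the invariant bound of \<open>eisenstein_bound_strip_orbit\<close> does.
\<close>

definition strip_orbit :: "real \<Rightarrow> real \<Rightarrow> complex set" where
  "strip_orbit y Y = {\<tau>. Im \<tau> > 0 \<and> (\<exists>\<gamma>\<in>SL2Z. y < Im (moebius \<gamma> \<tau>) \<and> Im (moebius \<gamma> \<tau>) < Y)}"

lemma strip_orbitE:
  assumes "\<tau> \<in> strip_orbit y Y"
  obtains \<gamma> where "\<gamma> \<in> SL2Z" "Im \<tau> > 0" "y < Im (moebius \<gamma> \<tau>)" "Im (moebius \<gamma> \<tau>) < Y"
  using assms unfolding strip_orbit_def by blast

lemma strip_orbit_pos: "\<tau> \<in> strip_orbit y Y \<Longrightarrow> Im \<tau> > 0"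
  by (auto simp: strip_orbit_def)

lemma strip_orbit_moebius:
  assumes "\<delta> \<in> SL2Z" "\<tau> \<in> strip_orbit y Y" shows "moebius \<delta> \<tau> \<in> strip_orbit y Y"
proof -
  obtain \<gamma> where \<gamma>: "\<gamma> \<in> SL2Z" "Im \<tau> > 0" "y < Im (moebius \<gamma> \<tau>)" "Im (moebius \<gamma> \<tau>) < Y"
    using assms(2) by (rule strip_orbitE)
  have "moebius (\<gamma> ** sl2_inverse \<delta>) (moebius \<delta> \<tau>) = moebius ((\<gamma> ** sl2_inverse \<delta>) ** \<delta>) \<tau>"
    by (rule moebius_mult[OF assms(1) \<gamma>(2), symmetric])
  also have "(\<gamma> ** sl2_inverse \<delta>) ** \<delta> = \<gamma>"
    by (simp add: matrix_mul_assoc[symmetric] sl2_inverse[OF assms(1)])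
  finally have "moebius (\<gamma> ** sl2_inverse \<delta>) (moebius \<delta> \<tau>) = moebius \<gamma> \<tau>" .
  then show ?thesis unfolding strip_orbit_def
    using \<gamma> SL2Z_mult[OF \<gamma>(1) sl2_inverse(1)[OF assms(1)]] Im_moebius_pos[OF assms(1) \<gamma>(2)] by force
qed

lemma open_strip_orbit: "open (strip_orbit y Y)"
proof -
  have "open {\<tau>. Im \<tau> > 0 \<and> y < Im (moebius \<gamma> \<tau>) \<and> Im (moebius \<gamma> \<tau>) < Y}" if "\<gamma> \<in> SL2Z" for \<gamma>
  proof -
    have H: "open {\<tau>. Im \<tau> > 0}" by (rule open_halfspace_Im_gt)
    have "continuous_on {\<tau>. Im \<tau> > 0} (moebius \<gamma>)"
      unfolding moebius_def[abs_def] aut_factor_def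
      using aut_factor_nonzero[OF that] by (intro continuous_intros) (auto simp: aut_factor_def)
    then have "continuous_on {\<tau>. Im \<tau> > 0} (\<lambda>\<tau>. Im (moebius \<gamma> \<tau>))" by (intro continuous_intros)
    from continuous_open_preimage[OF this H open_greaterThanLessThan[of y Y]]
    show ?thesis by (simp add: Int_def vimage_def)
  qed
  then have "open (\<Union>\<gamma>\<in>SL2Z. {\<tau>. Im \<tau> > 0 \<and> y < Im (moebius \<gamma> \<tau>) \<and> Im (moebius \<gamma> \<tau>) < Y})" by blast
  also have "\<dots> = strip_orbit y Y" by (auto simp: strip_orbit_def)
  finally show ?thesis .
qed

text \<open>
  The quotient \<open>lattice_min \<tau> / sqrt (Im \<tau>)\<close> is a modular invariant, and on the strip it is bounded
  below.
\<close>

lemma lattice_min_strip_orbit: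
  assumes "0 < y" "\<tau> \<in> strip_orbit y Y"
  shows "lattice_min \<tau> \<ge> min 1 y / sqrt Y * sqrt (Im \<tau>)"
proof -
  obtain \<gamma> where \<gamma>: "\<gamma> \<in> SL2Z" "Im \<tau> > 0" "y < Im (moebius \<gamma> \<tau>)" "Im (moebius \<gamma> \<tau>) < Y"
    using assms(2) by (rule strip_orbitE)
  define j where "j = aut_factor \<gamma> \<tau>"
  have j: "j \<noteq> 0" unfolding j_def by (rule aut_factor_nonzero[OF \<gamma>(1,2)])
  have "Im \<tau> = Im (moebius \<gamma> \<tau>) * (norm j)\<^sup>2" using j by (simp add: Im_moebius[OF \<gamma>(1,2)] j_def)
  then have "sqrt (Im \<tau>) = sqrt (Im (moebius \<gamma> \<tau>)) * norm j" by (simp add: real_sqrt_mult)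
  also have "\<dots> \<le> sqrt Y * norm j" using \<gamma> by (intro mult_right_mono) auto
  finally have "min 1 y / sqrt Y * sqrt (Im \<tau>) \<le> min 1 y / sqrt Y * (sqrt Y * norm j)"
    using assms(1) \<gamma> by (intro mult_left_mono) auto
  then have *: "min 1 y / sqrt Y * sqrt (Im \<tau>) \<le> min 1 y * norm j" using assms(1) \<gamma> by simp
  have "two_pi_i \<in> period_lattice \<tau>"
    unfolding period_lattice_def by (rule CollectI, rule exI[of _ 0], rule exI[of _ 1]) simp
  moreover have "two_pi_i \<noteq> (0 :: complex)" by simp
  ultimately have ne: "period_lattice \<tau> - {0} \<noteq> {}" by blast
  show ?thesis unfolding lattice_min_def
  proof (rule cINF_greatest[OF ne])
    fix w assume w: "w \<in> period_lattice \<tau> - {0}"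
    have "w / j \<in> period_lattice (moebius \<gamma> \<tau>)"
      using period_lattice_moebius(2)[OF SL2Z_det[OF \<gamma>(1)] \<gamma>(2), of w] w
      unfolding j_def moebius_def aut_factor_def by blast
    moreover have "w / j \<noteq> 0" using w j by auto
    ultimately have "2 * pi * min 1 (Im (moebius \<gamma> \<tau>)) \<le> norm (w / j)"
      using period_lattice_norm_ge[of "moebius \<gamma> \<tau>"] \<gamma> assms(1) by auto
    moreover have "1 * min 1 y \<le> 2 * pi * min 1 (Im (moebius \<gamma> \<tau>))"
      using pi_gt3 \<gamma> assms(1) by (intro mult_mono) auto
    ultimately have "min 1 y \<le> norm w / norm j" by (simp add: norm_divide)
    then have "min 1 y * norm j \<le> norm w" using j by (simp add: pos_le_divide_eq)
    with * show "min 1 y / sqrt Y * sqrt (Im \<tau>) \<le> norm w" by simp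
  qed
qed

text \<open>
  The bound is transported from the strip: both \<open>|E_k|\<close> and \<open>Im \<tau>^(- k/2)\<close> are multiplied by
  \<open>|c \<tau> + d|^k\<close>.  The anomalous term of \<open>E_2\<close> is of the same size, since \<open>|c| Im \<tau> \<le> |c \<tau> + d|\<close>.
\<close>

lemma eisenstein_bound_strip_orbit:
  assumes "0 < y"
  obtains K L where "K > 0" "L > 0"
    "\<And>k \<tau>. k \<ge> 2 \<Longrightarrow> \<tau> \<in> strip_orbit y Y \<Longrightarrow> norm (eisenstein_E k \<tau>) \<le> K * (L / sqrt (Im \<tau>)) ^ k"
proof -
  obtain K b where Kb: "K > 0" "b \<ge> 1"
    "\<And>k \<tau>. k \<ge> 1 \<Longrightarrow> Im \<tau> \<ge> y \<Longrightarrow> norm (eisenstein_E k \<tau>) \<le> K * b ^ k"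
    by (rule eisenstein_growth[OF assms]) (rule that)
  \<comment> \<open>\<open>L\<close> is such that \<open>b \<le> L / sqrt (Im \<tau>)\<close> on the strip; the maximum keeps \<open>L\<close> positive for every \<open>Y\<close>.\<close>
  define L where "L = b * sqrt (max 1 Y)"
  have L: "L > 0" using Kb by (simp add: L_def)
  have "norm (eisenstein_E k \<tau>) \<le> (K + 1 / L\<^sup>2) * (L / sqrt (Im \<tau>)) ^ k" if k: "k \<ge> 2" and \<tau>: "\<tau> \<in> strip_orbit y Y" for k \<tau>
  proof -
    obtain \<gamma> where \<gamma>: "\<gamma> \<in> SL2Z" "Im \<tau> > 0" "y < Im (moebius \<gamma> \<tau>)" "Im (moebius \<gamma> \<tau>) < Y"
      using \<tau> by (rule strip_orbitE)
    define \<tau>0 where "\<tau>0 = moebius \<gamma> \<tau>"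
    define \<delta> where "\<delta> = sl2_inverse \<gamma>"
    have \<delta>: "\<delta> \<in> SL2Z" "\<delta> ** \<gamma> = mat 1" unfolding \<delta>_def using sl2_inverse[OF \<gamma>(1)] by auto
    have \<tau>0: "Im \<tau>0 > 0" "y < Im \<tau>0" "Im \<tau>0 < Y" using \<gamma> assms by (auto simp: \<tau>0_def)
    have \<tau>eq: "moebius \<delta> \<tau>0 = \<tau>" unfolding \<tau>0_def moebius_mult[OF \<gamma>(1,2), symmetric] \<delta>(2) by (rule moebius_mat_1)
    define j where "j = aut_factor \<delta> \<tau>0"
    have j: "j \<noteq> 0" unfolding j_def by (rule aut_factor_nonzero[OF \<delta>(1) \<tau>0(1)])
    have Im\<tau>: "Im \<tau> = Im \<tau>0 / (norm j)\<^sup>2" using Im_moebius[OF \<delta>(1) \<tau>0(1)] by (simp add: \<tau>eq j_def)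
    have Lj: "L / sqrt (Im \<tau>) = norm j * (L / sqrt (Im \<tau>0))"
      unfolding Im\<tau> using j by (simp add: real_sqrt_divide)
    obtain n where n: "k = Suc n" using k by (cases k) auto
    have "eisenstein_E k \<tau> = j ^ k * eisenstein_E k \<tau>0 - (if k = 2 then of_int (\<delta> $ 2 $ 1) * j / two_pi_i else 0)"
      using eisenstein_modular[OF SL2Z_det[OF \<delta>(1)] \<tau>0(1), of n] \<tau>eq
      unfolding moebius_def j_def aut_factor_def n by simp
    moreover have "norm (j ^ k * eisenstein_E k \<tau>0) \<le> K * (L / sqrt (Im \<tau>)) ^ k"
    proof -
      have "b \<le> L / sqrt (Im \<tau>0)"
      proof -
        have "b * sqrt (Im \<tau>0) \<le> b * sqrt (max 1 Y)" using Kb \<tau>0 by (intro mult_left_mono) auto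
        then show ?thesis using \<tau>0 by (simp add: L_def pos_le_divide_eq)
      qed
      then have "b ^ k \<le> (L / sqrt (Im \<tau>0)) ^ k" using Kb by (intro power_mono) auto
      then have "K * b ^ k \<le> K * (L / sqrt (Im \<tau>0)) ^ k" using Kb by (intro mult_left_mono) auto
      then have "norm (eisenstein_E k \<tau>0) \<le> K * (L / sqrt (Im \<tau>0)) ^ k" using Kb(3)[of k \<tau>0] k \<tau>0 by simp
      then have "norm j ^ k * norm (eisenstein_E k \<tau>0) \<le> norm j ^ k * (K * (L / sqrt (Im \<tau>0)) ^ k)"
        by (intro mult_left_mono) auto
      then show ?thesis unfolding Lj power_mult_distrib norm_mult norm_power by (simp only: mult_ac)
    qed
    moreover have "norm (if k = 2 then of_int (\<delta> $ 2 $ 1) * j / two_pi_i else 0 :: complex) \<le> 1 / L\<^sup>2 * (L / sqrt (Im \<tau>)) ^ k"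
    proof (cases "k = 2")
      case True
      have "\<bar>real_of_int (\<delta> $ 2 $ 1)\<bar> * Im \<tau>0 = \<bar>Im j\<bar>" using \<tau>0 by (simp add: j_def aut_factor_def abs_mult)
      also have "\<dots> \<le> norm j" by (rule abs_Im_le_cmod)
      finally have c: "\<bar>real_of_int (\<delta> $ 2 $ 1)\<bar> \<le> norm j / Im \<tau>0" using \<tau>0 by (simp add: pos_le_divide_eq)
      have "\<bar>real_of_int (\<delta> $ 2 $ 1)\<bar> * norm j / (2 * pi) \<le> \<bar>real_of_int (\<delta> $ 2 $ 1)\<bar> * norm j / 1"
        using pi_gt3 by (intro divide_left_mono) auto
      also have "\<dots> \<le> norm j / Im \<tau>0 * norm j / 1" using c by (intro divide_right_mono mult_right_mono) auto
      also have "\<dots> = 1 / L\<^sup>2 * (L / sqrt (Im \<tau>)) ^ k"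
        unfolding True Lj power_mult_distrib power_divide using L \<tau>0 by (simp add: power2_eq_square)
      finally show ?thesis using True by (simp add: norm_mult norm_divide)
    qed (use L \<gamma>(2) in simp)
    ultimately have "norm (eisenstein_E k \<tau>) \<le> K * (L / sqrt (Im \<tau>)) ^ k + 1 / L\<^sup>2 * (L / sqrt (Im \<tau>)) ^ k"
      by (simp only:) (intro order_trans[OF norm_triangle_ineq4] add_mono)
    then show ?thesis by (simp only: distrib_right)
  qed
  moreover have "K + 1 / L\<^sup>2 > 0" using Kb L by (simp add: add_pos_pos)
  ultimately show thesis using that L by blast
qed

text \<open>
  The ratio of the weighted norm in which \<open>A_matrix \<tau> \<epsilon>\<close> is measured.  Under a modular transformation of
  \<open>\<tau>\<close> it is multiplied by \<open>sqrt |c \<tau> + d|\<close>, which is the absolute value of the conjugating factor \<open>\<sigma>\<close>; thus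
  the hypotheses of \<open>Omega_moebius\<close> on the original and on the transformed pair match.
\<close>

definition weight :: "complex \<Rightarrow> complex \<Rightarrow> real" where
  "weight \<tau> \<tau>' = sqrt (sqrt (Im \<tau>' / Im \<tau>)) / 2"

lemma weight_pos: "Im \<tau> > 0 \<Longrightarrow> Im \<tau>' > 0 \<Longrightarrow> weight \<tau> \<tau>' > 0"
  by (simp add: weight_def)

lemma weight_mult:
  assumes "Im \<tau> > 0" "Im \<tau>' > 0" shows "weight \<tau> \<tau>' * weight \<tau>' \<tau> = 1 / 4"
  using assms by (simp add: weight_def real_sqrt_mult[symmetric])

lemma weight_quotient:
  assumes "Im \<tau> > 0" "Im \<tau>' > 0" shows "weight \<tau>' \<tau> / weight \<tau> \<tau>' = sqrt (Im \<tau> / Im \<tau>')"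
proof -
  define x where "x = sqrt (Im \<tau> / Im \<tau>')"
  have x: "x > 0" "sqrt (Im \<tau>' / Im \<tau>) = 1 / x" using assms by (simp_all add: x_def real_sqrt_divide)
  have "sqrt x / sqrt (1 / x) = x" using x(1) by (simp add: real_sqrt_divide)
  then show ?thesis unfolding weight_def x(2) x_def[symmetric] by simp
qed

lemma weight_moebius:
  assumes "\<gamma> \<in> SL2Z" "Im \<tau> > 0" "Im \<tau>' > 0"
  shows "weight (moebius \<gamma> \<tau>) \<tau>' = sqrt (norm (aut_factor \<gamma> \<tau>)) * weight \<tau> \<tau>'"
    "weight \<tau>' (moebius \<gamma> \<tau>) = weight \<tau>' \<tau> / sqrt (norm (aut_factor \<gamma> \<tau>))"
  unfolding weight_def Im_moebius[OF assms(1,2)] by (simp_all add: real_sqrt_divide real_sqrt_mult)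

text \<open>
  The squared ratio \<open>|\<epsilon>| (L / sqrt (Im \<tau>))^2\<close> of the entries is at most a constant times
  \<open>\<eta> sqrt (Im \<tau>' / Im \<tau>)\<close>, that is, \<open>\<eta>\<close> times the square of the weight.
\<close>

lemma A_matrix_weight_bound:
  assumes K: "K > 0" "L > 0" and \<tau>: "Im \<tau> > 0" "Im \<tau>' > 0"
    and E: "\<And>k. k \<ge> 2 \<Longrightarrow> norm (eisenstein_E k \<tau>) \<le> K * (L / sqrt (Im \<tau>)) ^ k"
    and \<eta>: "\<eta> > 0" "64 * L\<^sup>2 * \<eta> \<le> 1"
    and \<epsilon>: "norm \<epsilon> \<le> \<eta> * sqrt (Im \<tau> * Im \<tau>')"
  shows "mat_bound (A_matrix \<tau> \<epsilon>) (64 * K * L\<^sup>2 * \<eta>) (weight \<tau> \<tau>')"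
  unfolding mat_bound_def
proof (intro allI impI)
  fix k l :: nat assume kl: "1 \<le> k" "1 \<le> l"
  let ?r = "weight \<tau> \<tau>'"
  have r: "?r > 0" by (rule weight_pos[OF \<tau>])
  show "norm (A_matrix \<tau> \<epsilon> k l) \<le> 64 * K * L\<^sup>2 * \<eta> * ?r ^ (k + l)"
  proof (cases "even (k + l)")
    case True
    then obtain m where m: "k + l = 2 * m" by (elim evenE)
    then obtain n where n: "m = Suc n" using kl by (cases m) auto
    have r2: "?r\<^sup>2 = sqrt (Im \<tau>' / Im \<tau>) / 4" using \<tau> by (simp add: weight_def power_divide)
    have step: "\<eta> * sqrt (Im \<tau> * Im \<tau>') * 16 * (L / sqrt (Im \<tau>))\<^sup>2 = 64 * L\<^sup>2 * \<eta> * ?r\<^sup>2"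
    proof -
      have "sqrt (Im \<tau> * Im \<tau>') / (Im \<tau>) = sqrt (Im \<tau>' / Im \<tau>)"
        using \<tau> by (simp add: real_sqrt_mult real_sqrt_divide field_simps)
      then show ?thesis unfolding r2 using \<tau> by (simp add: power_divide field_simps)
    qed
    have "A_matrix \<tau> \<epsilon> k l = \<epsilon> ^ m * sewing_coeff k l * eisenstein_E (2 * m) \<tau>"
      unfolding A_matrix_eq m by simp
    moreover have "norm (\<epsilon> ^ m) \<le> (\<eta> * sqrt (Im \<tau> * Im \<tau>')) ^ m"
      unfolding norm_power using \<epsilon> by (intro power_mono) auto
    moreover have "norm (sewing_coeff k l) \<le> 16 ^ m"
      using norm_sewing_coeff_le[OF kl] unfolding m power_mult by simp
    moreover have "norm (eisenstein_E (2 * m) \<tau>) \<le> K * ((L / sqrt (Im \<tau>))\<^sup>2) ^ m"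
      using E[of "2 * m"] n by (simp only: power_mult) simp
    ultimately have "norm (A_matrix \<tau> \<epsilon> k l) \<le> (\<eta> * sqrt (Im \<tau> * Im \<tau>')) ^ m * 16 ^ m * (K * ((L / sqrt (Im \<tau>))\<^sup>2) ^ m)"
      using \<eta> \<tau> by (simp only: norm_mult) (intro mult_mono, auto)
    also have "\<dots> = K * (\<eta> * sqrt (Im \<tau> * Im \<tau>') * 16 * (L / sqrt (Im \<tau>))\<^sup>2) ^ m"
      by (simp only: power_mult_distrib mult_ac)
    also have "\<dots> = K * ((64 * L\<^sup>2 * \<eta>) ^ m * ?r ^ (k + l))"
      unfolding step m power_mult by (simp only: power_mult_distrib)
    also have "\<dots> \<le> K * ((64 * L\<^sup>2 * \<eta>) * ?r ^ (k + l))"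
    proof -
      have "(64 * L\<^sup>2 * \<eta>) ^ n \<le> 1" using \<eta> K by (intro power_le_one) auto
      then have "(64 * L\<^sup>2 * \<eta>) ^ m \<le> 64 * L\<^sup>2 * \<eta>" using \<eta> K unfolding n power_Suc by (intro mult_left_le) auto
      then show ?thesis using K r by (intro mult_left_mono mult_right_mono) auto
    qed
    finally show ?thesis by (simp only: mult_ac)
  qed (use K \<eta> r in \<open>simp add: A_matrix_odd\<close>)
qed

section \<open>The invariant neighbourhood\<close>

definition region :: "real \<Rightarrow> real \<Rightarrow> real \<Rightarrow> (complex \<times> complex \<times> complex) set" where
  "region y Y \<eta> = {(\<tau>1, \<tau>2, \<epsilon>). \<tau>1 \<in> strip_orbit y Y \<and> \<tau>2 \<in> strip_orbit y Y \<and>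
     norm \<epsilon> < \<eta> * sqrt (Im \<tau>1 * Im \<tau>2)}"

lemma open_region: "open (region y Y \<eta>)"
proof -
  have "open ((strip_orbit y Y \<times> strip_orbit y Y \<times> UNIV) \<inter>
      {x. norm (snd (snd x)) < \<eta> * sqrt (Im (fst x) * Im (fst (snd x)))})"
    by (intro open_Int open_Times open_strip_orbit open_UNIV open_Collect_less continuous_intros)
  also have "\<dots> = region y Y \<eta>" by (auto simp: region_def)
  finally show ?thesis .
qed

lemma region_act_1:
  assumes "\<gamma> \<in> SL2Z" "x \<in> region y Y \<eta>" shows "act_1 \<gamma> x \<in> region y Y \<eta>"
proof -
  obtain \<tau>1 \<tau>2 \<epsilon> where x: "x = (\<tau>1, \<tau>2, \<epsilon>)" by (cases x)
  have o: "\<tau>1 \<in> strip_orbit y Y" "\<tau>2 \<in> strip_orbit y Y" "norm \<epsilon> < \<eta> * sqrt (Im \<tau>1 * Im \<tau>2)"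
    using assms(2) by (auto simp: x region_def)
  have p: "Im \<tau>1 > 0" using strip_orbit_pos[OF o(1)] .
  have j: "norm (aut_factor \<gamma> \<tau>1) > 0" using aut_factor_nonzero[OF assms(1) p] by simp
  have "sqrt (Im (moebius \<gamma> \<tau>1) * Im \<tau>2) = sqrt (Im \<tau>1 * Im \<tau>2) / norm (aut_factor \<gamma> \<tau>1)"
    unfolding Im_moebius[OF assms(1) p] by (simp add: real_sqrt_divide real_sqrt_mult)
  moreover have "norm \<epsilon> / norm (aut_factor \<gamma> \<tau>1) < \<eta> * sqrt (Im \<tau>1 * Im \<tau>2) / norm (aut_factor \<gamma> \<tau>1)"
    using o(3) j by (rule divide_strict_right_mono)
  ultimately show ?thesis
    using strip_orbit_moebius[OF assms(1) o(1)] o(2) by (simp add: x region_def norm_divide)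
qed

lemma region_act_beta: "x \<in> region y Y \<eta> \<Longrightarrow> act_beta x \<in> region y Y \<eta>"
  by (cases x) (auto simp: region_def mult.commute)

lemma region_Im_pos: "x \<in> region y Y \<eta> \<Longrightarrow> Im (fst x) > 0"
  by (cases x) (auto simp: region_def strip_orbit_pos)

lemma act_1_image_region:
  assumes "\<gamma> \<in> SL2Z" shows "act_1 \<gamma> ` region y Y \<eta> = region y Y \<eta>"
proof (intro equalityI subsetI)
  fix x assume x: "x \<in> region y Y \<eta>"
  then have "x = act_1 \<gamma> (act_1 (sl2_inverse \<gamma>) x)"
    using act_1_inverse(1)[OF assms region_Im_pos[OF x]] by simp
  then show "x \<in> act_1 \<gamma> ` region y Y \<eta>"
    using region_act_1[OF sl2_inverse(1)[OF assms] x] by blast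
qed (use region_act_1[OF assms] in auto)

lemma act_beta_image_region: "act_beta ` region y Y \<eta> = region y Y \<eta>"
proof (intro equalityI subsetI)
  fix x assume "x \<in> region y Y \<eta>"
  then show "x \<in> act_beta ` region y Y \<eta>"
    using region_act_beta act_beta_involution[of x] by (metis image_eqI)
qed (use region_act_beta in auto)

lemma G_act_image_region:
  assumes "g \<in> G_group" shows "G_act g ` region y Y \<eta> = region y Y \<eta>"
proof -
  obtain \<gamma>1 \<gamma>2 s where g: "g = (\<gamma>1, \<gamma>2, s)" "\<gamma>1 \<in> SL2Z" "\<gamma>2 \<in> SL2Z"
    using assms by (cases g) (auto simp: G_group_def)
  have 2: "act_2 \<gamma>2 ` region y Y \<eta> = region y Y \<eta>"
  proof -
    have "act_2 \<gamma>2 ` region y Y \<eta> = act_beta ` act_1 \<gamma>2 ` act_beta ` region y Y \<eta>"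
      by (simp add: image_image act_2_eq)
    then show ?thesis by (simp add: act_beta_image_region act_1_image_region[OF g(3)])
  qed
  have "G_act g ` region y Y \<eta> = act_1 \<gamma>1 ` act_2 \<gamma>2 ` (\<lambda>x. if s then act_beta x else x) ` region y Y \<eta>"
    unfolding g(1) by (simp add: image_image)
  also have "(\<lambda>x. if s then act_beta x else x) ` region y Y \<eta> = region y Y \<eta>"
    by (cases s) (simp_all add: act_beta_image_region)
  finally show ?thesis by (simp add: 2 act_1_image_region[OF g(2)])
qed

lemma region_small_pair:
  assumes "0 < y"
  obtains \<eta>0 where "\<eta>0 > 0"
    "\<And>\<eta> \<tau>1 \<tau>2 \<epsilon>. \<eta> \<le> \<eta>0 \<Longrightarrow> (\<tau>1, \<tau>2, \<epsilon>) \<in> region y Y \<eta> \<Longrightarrow>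
       small_pair (A_matrix \<tau>1 \<epsilon>) (A_matrix \<tau>2 \<epsilon>) (1 / 2) (weight \<tau>1 \<tau>2) (weight \<tau>2 \<tau>1)"
proof -
  obtain K L where KL: "K > 0" "L > 0"
    "\<And>k \<tau>. k \<ge> 2 \<Longrightarrow> \<tau> \<in> strip_orbit y Y \<Longrightarrow> norm (eisenstein_E k \<tau>) \<le> K * (L / sqrt (Im \<tau>)) ^ k"
    by (rule eisenstein_bound_strip_orbit[OF assms]) (rule that)
  define \<eta>0 where "\<eta>0 = min (1 / (64 * L\<^sup>2)) (1 / (128 * K * L\<^sup>2))"
  have \<eta>0: "\<eta>0 > 0" "64 * L\<^sup>2 * \<eta>0 \<le> 1" "64 * K * L\<^sup>2 * \<eta>0 \<le> 1 / 2"
  proof -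
    show "\<eta>0 > 0" using KL by (simp add: \<eta>0_def)
    have "64 * L\<^sup>2 * \<eta>0 \<le> 64 * L\<^sup>2 * (1 / (64 * L\<^sup>2))" by (intro mult_left_mono) (auto simp: \<eta>0_def)
    then show "64 * L\<^sup>2 * \<eta>0 \<le> 1" using KL by simp
    have "64 * K * L\<^sup>2 * \<eta>0 \<le> 64 * K * L\<^sup>2 * (1 / (128 * K * L\<^sup>2))" using KL by (intro mult_left_mono) (auto simp: \<eta>0_def)
    then show "64 * K * L\<^sup>2 * \<eta>0 \<le> 1 / 2" using KL by simp
  qed
  have "small_pair (A_matrix \<tau>1 \<epsilon>) (A_matrix \<tau>2 \<epsilon>) (1 / 2) (weight \<tau>1 \<tau>2) (weight \<tau>2 \<tau>1)"
    if "\<eta> \<le> \<eta>0" "(\<tau>1, \<tau>2, \<epsilon>) \<in> region y Y \<eta>" for \<eta> \<tau>1 \<tau>2 \<epsilon>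
  proof -
    have o: "\<tau>1 \<in> strip_orbit y Y" "\<tau>2 \<in> strip_orbit y Y" and e: "norm \<epsilon> < \<eta> * sqrt (Im \<tau>1 * Im \<tau>2)"
      using that(2) by (auto simp: region_def)
    have p: "Im \<tau>1 > 0" "Im \<tau>2 > 0" using o strip_orbit_pos by auto
    have "\<eta> * sqrt (Im \<tau>1 * Im \<tau>2) \<le> \<eta>0 * sqrt (Im \<tau>1 * Im \<tau>2)" using that(1) p by (intro mult_right_mono) auto
    then have e1: "norm \<epsilon> \<le> \<eta>0 * sqrt (Im \<tau>1 * Im \<tau>2)" "norm \<epsilon> \<le> \<eta>0 * sqrt (Im \<tau>2 * Im \<tau>1)"
      using e by (auto simp: mult.commute)
    have half: "mat_bound A (1 / 2) r" if "mat_bound A (64 * K * L\<^sup>2 * \<eta>0) r" "r > 0" for A r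
      using that \<eta>0(3) unfolding mat_bound_def
      by (meson mult_right_mono order_trans zero_le_power less_imp_le)
    have "mat_bound (A_matrix \<tau>1 \<epsilon>) (64 * K * L\<^sup>2 * \<eta>0) (weight \<tau>1 \<tau>2)"
      by (rule A_matrix_weight_bound[OF KL(1,2) p KL(3)[OF _ o(1)] \<eta>0(1,2) e1(1)])
    moreover have "mat_bound (A_matrix \<tau>2 \<epsilon>) (64 * K * L\<^sup>2 * \<eta>0) (weight \<tau>2 \<tau>1)"
      by (rule A_matrix_weight_bound[OF KL(1,2) p(2,1) KL(3)[OF _ o(2)] \<eta>0(1,2) e1(2)])
    ultimately show ?thesis
      unfolding small_pair_def using p weight_pos weight_mult[OF p] half by auto
  qed
  then show thesis using that[OF \<eta>0(1)] by blast
qed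

text \<open>
  The heights combine to \<open>sqrt (Im \<tau>1 Im \<tau>2) * sqrt (Im \<tau>1 / Im \<tau>2) = Im \<tau>1\<close>: the relative error
  of \<open>Omega_11\<close> is uniform over whole orbits.
\<close>

lemma Omega_estimates:
  assumes "small_pair (A_matrix \<tau>1 \<epsilon>) (A_matrix \<tau>2 \<epsilon>) (1 / 2) (weight \<tau>1 \<tau>2) (weight \<tau>2 \<tau>1)"
    and p: "Im \<tau>1 > 0" "Im \<tau>2 > 0" and e: "norm \<epsilon> \<le> \<eta> * sqrt (Im \<tau>1 * Im \<tau>2)" and \<eta>: "\<eta> \<ge> 0"
  shows "norm (Omega_11 \<tau>1 \<tau>2 \<epsilon> - \<tau>1) \<le> \<eta> * Im \<tau>1" "norm (Omega_22 \<tau>1 \<tau>2 \<epsilon> - \<tau>2) \<le> \<eta> * Im \<tau>2"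
    "norm (Omega_12 \<tau>1 \<tau>2 \<epsilon>) \<le> \<eta> * sqrt (Im \<tau>1 * Im \<tau>2)"
proof -
  have pi1: "norm (x / two_pi_i :: complex) \<le> norm x / 2" for x
  proof -
    have "norm (x / two_pi_i :: complex) = norm x / (2 * pi)" by (simp add: norm_divide norm_mult)
    also have "\<dots> \<le> norm x / 2" using pi_gt3 by (intro divide_left_mono) auto
    finally show ?thesis .
  qed
  have diag: "norm (Omega_11 \<sigma>1 \<sigma>2 \<epsilon> - \<sigma>1) \<le> \<eta> * Im \<sigma>1"
    if s: "small_pair (A_matrix \<sigma>1 \<epsilon>) (A_matrix \<sigma>2 \<epsilon>) (1 / 2) (weight \<sigma>1 \<sigma>2) (weight \<sigma>2 \<sigma>1)"
      and p: "Im \<sigma>1 > 0" "Im \<sigma>2 > 0" and e: "norm \<epsilon> \<le> \<eta> * sqrt (Im \<sigma>1 * Im \<sigma>2)" for \<sigma>1 \<sigma>2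
  proof -
    define w where "w = mat_vec (A_matrix \<sigma>2 \<epsilon>) (neumann_column (A_matrix \<sigma>1 \<epsilon>) (A_matrix \<sigma>2 \<epsilon>)) 1"
    have "norm w \<le> weight \<sigma>2 \<sigma>1 / weight \<sigma>1 \<sigma>2" using neumann_column_bounds(3)[OF s] by (simp add: w_def)
    then have w: "norm w \<le> sqrt (Im \<sigma>1 / Im \<sigma>2)" unfolding weight_quotient[OF p] .
    have "Omega_11 \<sigma>1 \<sigma>2 \<epsilon> - \<sigma>1 = \<epsilon> * w / two_pi_i" by (simp add: Omega_11_eq w_def)
    then have "norm (Omega_11 \<sigma>1 \<sigma>2 \<epsilon> - \<sigma>1) \<le> norm \<epsilon> * norm w / 2"
      using pi1[of "\<epsilon> * w"] by (simp add: norm_mult)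
    also have "\<dots> \<le> norm \<epsilon> * norm w / 1" by (intro divide_left_mono) auto
    also have "\<dots> \<le> \<eta> * sqrt (Im \<sigma>1 * Im \<sigma>2) * sqrt (Im \<sigma>1 / Im \<sigma>2) / 1"
      using w e \<eta> p by (intro divide_right_mono mult_mono) auto
    also have "\<dots> = \<eta> * Im \<sigma>1" using p by (simp add: real_sqrt_mult real_sqrt_divide)
    finally show ?thesis .
  qed
  show "norm (Omega_11 \<tau>1 \<tau>2 \<epsilon> - \<tau>1) \<le> \<eta> * Im \<tau>1" by (rule diag[OF assms(1) p e])
  show "norm (Omega_22 \<tau>1 \<tau>2 \<epsilon> - \<tau>2) \<le> \<eta> * Im \<tau>2"
    unfolding Omega_22_eq_swap using e by (intro diag[OF small_pair_swap[OF assms(1)] p(2,1)]) (simp add: mult.commute)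
  have "norm (Omega_12 \<tau>1 \<tau>2 \<epsilon>) \<le> norm \<epsilon> * norm (neumann_column (A_matrix \<tau>1 \<epsilon>) (A_matrix \<tau>2 \<epsilon>) 1) / 2"
    unfolding Omega_12_eq using pi1[of "- \<epsilon> * neumann_column (A_matrix \<tau>1 \<epsilon>) (A_matrix \<tau>2 \<epsilon>) 1"] by (simp add: norm_mult)
  also have "\<dots> \<le> norm \<epsilon> * 2 / 2"
    using neumann_column_bounds(1)[OF assms(1)] by (intro divide_right_mono mult_left_mono) auto
  finally show "norm (Omega_12 \<tau>1 \<tau>2 \<epsilon>) \<le> \<eta> * sqrt (Im \<tau>1 * Im \<tau>2)" using e by simp
qed

text \<open>
  Completing the square: \<open>a (a s^2 + 2 b s t + d t^2) = (a s + b t)^2 + (a d - b^2) t^2\<close>, where the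
  letters stand for imaginary parts.
\<close>

lemma siegel_criterion:
  assumes "0 < Im a" "(Im b)\<^sup>2 < Im a * Im d"
  shows "vector [vector [a, b], vector [b, d]] \<in> siegel_upper_half_space_2"
proof -
  have "0 < v \<bullet> ((\<chi> i j. Im ((vector [vector [a, b], vector [b, d]] :: complex^2^2) $ i $ j)) *v v)" if "v \<noteq> 0" for v :: "real^2"
  proof -
    define s t where "s = v $ 1" and "t = v $ 2"
    have "v \<bullet> ((\<chi> i j. Im ((vector [vector [a, b], vector [b, d]] :: complex^2^2) $ i $ j)) *v v)
      = Im a * s\<^sup>2 + 2 * Im b * s * t + Im d * t\<^sup>2"
      by (simp add: inner_vec_def matrix_vector_mult_def sum_2 s_def t_def power2_eq_square algebra_simps)
    also have "Im a * (\<dots>) = (Im a * s + Im b * t)\<^sup>2 + (Im a * Im d - (Im b)\<^sup>2) * t\<^sup>2"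
      by (simp add: power2_eq_square algebra_simps)
    finally have eq: "Im a * (v \<bullet> ((\<chi> i j. Im ((vector [vector [a, b], vector [b, d]] :: complex^2^2) $ i $ j)) *v v))
       = (Im a * s + Im b * t)\<^sup>2 + (Im a * Im d - (Im b)\<^sup>2) * t\<^sup>2" .
    have "\<dots> > 0"
    proof (cases "t = 0")
      case True
      then have "s \<noteq> 0" using that by (auto simp: vec_eq_iff forall_2 s_def t_def)
      then show ?thesis using True assms by simp
    next
      case False
      then have "(Im a * Im d - (Im b)\<^sup>2) * t\<^sup>2 > 0" using assms by simp
      then show ?thesis by (simp add: add_nonneg_pos)
    qed
    then show ?thesis unfolding eq[symmetric] using assms(1) by (simp add: zero_less_mult_iff)
  qed
  then show ?thesis by (simp add: siegel_upper_half_space_2_def transpose_def vec_eq_iff forall_2)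
qed

theorem proposition4p8:
  fixes x :: "complex \<times> complex \<times> complex"
  assumes "x \<in> D_eps_0"
  shows "\<exists>N. open N \<and> x \<in> N \<and> N \<subseteq> D_eps \<and>
             (\<forall>g\<in>G_group. G_act g ` N = N) \<and>
             F_eps ` N \<subseteq> siegel_upper_half_space_2 \<and>
             bij_betw F_eps N (F_eps ` N)"
proof -
  obtain p q where x: "x = (p, q, 0)" and pq: "Im p > 0" "Im q > 0"
    using assms by (auto simp: D_eps_0_def D_eps_def upper_half_plane_def)
  \<comment> \<open>A strip containing both \<open>p\<close> and \<open>q\<close>, so that the neighbourhood is symmetric under the exchange of the tori.\<close>
  define y where "y = min (Im p) (Im q) / 2"
  define Y where "Y = 2 * max (Im p) (Im q)"
  have y: "0 < y" "y < Im p" "y < Im q" "Im p < Y" "Im q < Y" "y < Y"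
    using pq by (auto simp: y_def Y_def)
  obtain M where M: "M > 0" "inj_on F_eps {(\<tau>1, \<tau>2, \<epsilon>). y / 2 \<le> Im \<tau>1 \<and> y / 2 \<le> Im \<tau>2 \<and> norm \<epsilon> \<le> M}"
    by (rule F_eps_injective_half_planes[OF half_gt_zero[OF y(1)]]) (rule that)
  obtain \<eta>0 where \<eta>0: "\<eta>0 > 0"
    "\<And>\<eta> \<tau>1 \<tau>2 \<epsilon>. \<eta> \<le> \<eta>0 \<Longrightarrow> (\<tau>1, \<tau>2, \<epsilon>) \<in> region y Y \<eta> \<Longrightarrow>
       small_pair (A_matrix \<tau>1 \<epsilon>) (A_matrix \<tau>2 \<epsilon>) (1 / 2) (weight \<tau>1 \<tau>2) (weight \<tau>2 \<tau>1)"
    by (rule region_small_pair[OF y(1), of Y]) (rule that)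
  define c where "c = min 1 y / sqrt Y"
  have c: "c > 0" using y by (simp add: c_def)
  \<comment> \<open>In this order: convergence of the series, relative errors of at most \<open>1 / 4\<close>, inclusion in
     \<open>D_eps\<close>, and \<open>|\<epsilon>| \<le> M\<close> whenever the heights are at most \<open>2 * Y\<close>.\<close>
  define \<eta> where "\<eta> = Min {\<eta>0, 1 / 4, c\<^sup>2 / 4, M / (2 * Y)}"
  have \<eta>: "\<eta> > 0" "\<eta> \<le> \<eta>0" "\<eta> \<le> 1 / 4" "\<eta> \<le> c\<^sup>2 / 4" "\<eta> \<le> M / (2 * Y)"
    using \<eta>0 c M y by (auto simp: \<eta>_def)
  let ?N = "region y Y \<eta>"
  note small = \<eta>0(2)[OF \<eta>(2)]
  have N: "\<tau>1 \<in> strip_orbit y Y" "\<tau>2 \<in> strip_orbit y Y" "Im \<tau>1 > 0" "Im \<tau>2 > 0" "norm \<epsilon> < \<eta> * sqrt (Im \<tau>1 * Im \<tau>2)"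
    if "(\<tau>1, \<tau>2, \<epsilon>) \<in> ?N" for \<tau>1 \<tau>2 \<epsilon>
    using that by (auto simp: region_def strip_orbit_pos)
  have est: "norm (Omega_11 \<tau>1 \<tau>2 \<epsilon> - \<tau>1) \<le> 1 / 4 * Im \<tau>1" "norm (Omega_22 \<tau>1 \<tau>2 \<epsilon> - \<tau>2) \<le> 1 / 4 * Im \<tau>2"
     "norm (Omega_12 \<tau>1 \<tau>2 \<epsilon>) \<le> 1 / 4 * sqrt (Im \<tau>1 * Im \<tau>2)" if "(\<tau>1, \<tau>2, \<epsilon>) \<in> ?N" for \<tau>1 \<tau>2 \<epsilon>
  proof -
    note n = N[OF that]
    have "\<eta> * sqrt (Im \<tau>1 * Im \<tau>2) \<le> 1 / 4 * sqrt (Im \<tau>1 * Im \<tau>2)" using \<eta> n by (intro mult_right_mono) auto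
    then have "norm \<epsilon> \<le> 1 / 4 * sqrt (Im \<tau>1 * Im \<tau>2)" using n(5) by linarith
    from Omega_estimates[OF small[OF that] n(3,4) this]
    show "norm (Omega_11 \<tau>1 \<tau>2 \<epsilon> - \<tau>1) \<le> 1 / 4 * Im \<tau>1" "norm (Omega_22 \<tau>1 \<tau>2 \<epsilon> - \<tau>2) \<le> 1 / 4 * Im \<tau>2"
     "norm (Omega_12 \<tau>1 \<tau>2 \<epsilon>) \<le> 1 / 4 * sqrt (Im \<tau>1 * Im \<tau>2)" by auto
  qed
  have "x \<in> ?N"
  proof -
    have "moebius (mat 1) p = p" "moebius (mat 1) q = q" by (rule moebius_mat_1)+
    then show ?thesis using mat_1_in_SL2Z y pq \<eta> by (auto simp: x region_def strip_orbit_def intro!: bexI[of _ "mat 1"])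
  qed
  moreover have "?N \<subseteq> D_eps"
  proof
    fix z assume z: "z \<in> ?N"
    obtain \<tau>1 \<tau>2 \<epsilon> where zeq: "z = (\<tau>1, \<tau>2, \<epsilon>)" by (cases z)
    note n = N[OF z[unfolded zeq]]
    have l: "c * sqrt (Im \<tau>1) \<le> lattice_min \<tau>1" "c * sqrt (Im \<tau>2) \<le> lattice_min \<tau>2"
      unfolding c_def using lattice_min_strip_orbit[OF y(1)] n by auto
    have "\<eta> * sqrt (Im \<tau>1 * Im \<tau>2) \<le> c\<^sup>2 / 4 * sqrt (Im \<tau>1 * Im \<tau>2)" using \<eta> n by (intro mult_right_mono) auto
    also have "\<dots> = 1 / 4 * ((c * sqrt (Im \<tau>1)) * (c * sqrt (Im \<tau>2)))" by (simp add: real_sqrt_mult power2_eq_square)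
    also have "\<dots> \<le> 1 / 4 * (lattice_min \<tau>1 * lattice_min \<tau>2)"
      using l c n by (intro mult_left_mono mult_mono) (auto intro: order_trans[of _ "c * sqrt (Im \<tau>1)"])
    finally show "z \<in> D_eps" using n by (simp add: zeq D_eps_def upper_half_plane_def)
  qed
  moreover have "F_eps ` ?N \<subseteq> siegel_upper_half_space_2"
  proof
    fix \<Omega> assume "\<Omega> \<in> F_eps ` ?N"
    then obtain \<tau>1 \<tau>2 \<epsilon> where z: "(\<tau>1, \<tau>2, \<epsilon>) \<in> ?N" and \<Omega>: "\<Omega> = F_eps (\<tau>1, \<tau>2, \<epsilon>)" by auto
    note n = N[OF z]
    have i1: "Im (Omega_11 \<tau>1 \<tau>2 \<epsilon>) \<ge> 3 / 4 * Im \<tau>1"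
      using est(1)[OF z] abs_Im_le_cmod[of "Omega_11 \<tau>1 \<tau>2 \<epsilon> - \<tau>1"] by simp
    have i2: "Im (Omega_22 \<tau>1 \<tau>2 \<epsilon>) \<ge> 3 / 4 * Im \<tau>2"
      using est(2)[OF z] abs_Im_le_cmod[of "Omega_22 \<tau>1 \<tau>2 \<epsilon> - \<tau>2"] by simp
    have "\<bar>Im (Omega_12 \<tau>1 \<tau>2 \<epsilon>)\<bar> \<le> 1 / 4 * sqrt (Im \<tau>1 * Im \<tau>2)"
      using est(3)[OF z] abs_Im_le_cmod[of "Omega_12 \<tau>1 \<tau>2 \<epsilon>"] by simp
    then have "\<bar>Im (Omega_12 \<tau>1 \<tau>2 \<epsilon>)\<bar>\<^sup>2 \<le> (1 / 4 * sqrt (Im \<tau>1 * Im \<tau>2))\<^sup>2" by (intro power_mono) auto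
    also have "\<dots> = 1 / 16 * (Im \<tau>1 * Im \<tau>2)" using n by (simp add: power_mult_distrib power_divide)
    also have "\<dots> < (3 / 4 * Im \<tau>1) * (3 / 4 * Im \<tau>2)" using n by simp
    also have "\<dots> \<le> Im (Omega_11 \<tau>1 \<tau>2 \<epsilon>) * Im (Omega_22 \<tau>1 \<tau>2 \<epsilon>)" using i1 i2 n by (intro mult_mono) auto
    finally show "\<Omega> \<in> siegel_upper_half_space_2"
      unfolding \<Omega> F_eps.simps using i1 n by (intro siegel_criterion) auto
  qed
  moreover have "inj_on F_eps ?N"
  proof -
    have beta: "F_eps (act_beta u) = F_eps (act_beta u')" if "u \<in> ?N" "u' \<in> ?N" "F_eps u = F_eps u'" for u u'
    proof -
      obtain \<tau>1 \<tau>2 \<epsilon> where u: "u = (\<tau>1, \<tau>2, \<epsilon>)" by (cases u)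
      obtain \<tau>1' \<tau>2' \<epsilon>' where u': "u' = (\<tau>1', \<tau>2', \<epsilon>')" by (cases u')
      show ?thesis
        using that(3) Omega_12_swap[OF small[OF that(1)[unfolded u]]] Omega_12_swap[OF small[OF that(2)[unfolded u']]]
        by (simp only: u u' act_beta.simps F_eps_eq_iff Omega_22_eq_swap)
    qed
    have act1: "F_eps (act_1 \<gamma> u) = F_eps (act_1 \<gamma> u')"
      if "u \<in> ?N" "u' \<in> ?N" "F_eps u = F_eps u'" "\<gamma> \<in> SL2Z" for u u' \<gamma>
    proof -
      obtain \<tau>1 \<tau>2 \<epsilon> where u: "u = (\<tau>1, \<tau>2, \<epsilon>)" by (cases u)
      obtain \<tau>1' \<tau>2' \<epsilon>' where u': "u' = (\<tau>1', \<tau>2', \<epsilon>')" by (cases u')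
      have *: "Omega_11 (moebius \<gamma> \<sigma>1) \<sigma>2 (\<zeta> / aut_factor \<gamma> \<sigma>1) = moebius \<gamma> (Omega_11 \<sigma>1 \<sigma>2 \<zeta>)"
        "Omega_12 (moebius \<gamma> \<sigma>1) \<sigma>2 (\<zeta> / aut_factor \<gamma> \<sigma>1) = Omega_12 \<sigma>1 \<sigma>2 \<zeta> / aut_factor \<gamma> (Omega_11 \<sigma>1 \<sigma>2 \<zeta>)"
        "Omega_22 (moebius \<gamma> \<sigma>1) \<sigma>2 (\<zeta> / aut_factor \<gamma> \<sigma>1)
           = Omega_22 \<sigma>1 \<sigma>2 \<zeta> - of_int (\<gamma> $ 2 $ 1) * (Omega_12 \<sigma>1 \<sigma>2 \<zeta>)\<^sup>2 / aut_factor \<gamma> (Omega_11 \<sigma>1 \<sigma>2 \<zeta>)"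
        if "(\<sigma>1, \<sigma>2, \<zeta>) \<in> ?N" for \<sigma>1 \<sigma>2 \<zeta>
      proof -
        note n = N[OF that]
        have "(moebius \<gamma> \<sigma>1, \<sigma>2, \<zeta> / aut_factor \<gamma> \<sigma>1) \<in> ?N"
          using region_act_1[OF \<open>\<gamma> \<in> SL2Z\<close> that] by simp
        note s = small[OF this, unfolded weight_moebius[OF \<open>\<gamma> \<in> SL2Z\<close> n(3,4)]]
        note O = Omega_moebius[OF SL2Z_det[OF \<open>\<gamma> \<in> SL2Z\<close>] n(3) small[OF that], folded aut_factor_def, folded moebius_def, OF s]
        show "Omega_11 (moebius \<gamma> \<sigma>1) \<sigma>2 (\<zeta> / aut_factor \<gamma> \<sigma>1) = moebius \<gamma> (Omega_11 \<sigma>1 \<sigma>2 \<zeta>)"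
          "Omega_12 (moebius \<gamma> \<sigma>1) \<sigma>2 (\<zeta> / aut_factor \<gamma> \<sigma>1) = Omega_12 \<sigma>1 \<sigma>2 \<zeta> / aut_factor \<gamma> (Omega_11 \<sigma>1 \<sigma>2 \<zeta>)"
          "Omega_22 (moebius \<gamma> \<sigma>1) \<sigma>2 (\<zeta> / aut_factor \<gamma> \<sigma>1)
             = Omega_22 \<sigma>1 \<sigma>2 \<zeta> - of_int (\<gamma> $ 2 $ 1) * (Omega_12 \<sigma>1 \<sigma>2 \<zeta>)\<^sup>2 / aut_factor \<gamma> (Omega_11 \<sigma>1 \<sigma>2 \<zeta>)"
          using O by auto
      qed
      show ?thesis
        using that(3) unfolding u u' act_1.simps F_eps_eq_iff *[OF that(1)[unfolded u]] *[OF that(2)[unfolded u']] by simp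
    qed
    show ?thesis
    proof (rule inj_onI)
      fix u u' assume u: "u \<in> ?N" and u': "u' \<in> ?N" and eq: "F_eps u = F_eps u'"
      obtain \<tau>1 \<tau>2 \<epsilon> where ueq: "u = (\<tau>1, \<tau>2, \<epsilon>)" by (cases u)
      note n = N[OF u[unfolded ueq]]
      obtain \<gamma>1 where \<gamma>1: "\<gamma>1 \<in> SL2Z" "y < Im (moebius \<gamma>1 \<tau>1)" "Im (moebius \<gamma>1 \<tau>1) < Y"
        using n(1) by (rule strip_orbitE)
      obtain \<gamma>2 where \<gamma>2: "\<gamma>2 \<in> SL2Z" "y < Im (moebius \<gamma>2 \<tau>2)" "Im (moebius \<gamma>2 \<tau>2) < Y"
        using n(2) by (rule strip_orbitE)
      \<comment> \<open>The group element that moves \<open>u\<close> into the strip, written with the first factor and the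
         exchange only, and its inverse.\<close>
      define h where "h v = act_beta (act_1 \<gamma>2 (act_beta (act_1 \<gamma>1 v)))" for v
      define h' where "h' v = act_1 (sl2_inverse \<gamma>1) (act_beta (act_1 (sl2_inverse \<gamma>2) (act_beta v)))" for v
      have h: "h v \<in> ?N" "h' (h v) = v" if "v \<in> ?N" for v
      proof -
        have 1: "act_1 \<gamma>1 v \<in> ?N" by (rule region_act_1[OF \<gamma>1(1) that])
        then have 2: "act_beta (act_1 \<gamma>1 v) \<in> ?N" by (rule region_act_beta)
        then show "h v \<in> ?N" unfolding h_def by (rule region_act_beta[OF region_act_1[OF \<gamma>2(1)]])
        show "h' (h v) = v"
          unfolding h_def h'_def act_beta_involution act_1_inverse(2)[OF \<gamma>2(1) region_Im_pos[OF 2]]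
          by (rule act_1_inverse(2)[OF \<gamma>1(1) region_Im_pos[OF that]])
      qed
      have heq: "F_eps (h u) = F_eps (h u')"
        unfolding h_def by (intro beta act1 region_act_beta region_act_1 \<gamma>1 \<gamma>2 u u' eq)
      obtain \<sigma>1 \<sigma>2 \<zeta> where hu: "h u = (\<sigma>1, \<sigma>2, \<zeta>)" by (cases "h u")
      obtain \<sigma>1' \<sigma>2' \<zeta>' where hu': "h u' = (\<sigma>1', \<sigma>2', \<zeta>')" by (cases "h u'")
      have \<sigma>: "y < Im \<sigma>1" "Im \<sigma>1 < Y" "y < Im \<sigma>2" "Im \<sigma>2 < Y"
        using hu \<gamma>1 \<gamma>2 by (auto simp: h_def ueq)
      have hN: "(\<sigma>1, \<sigma>2, \<zeta>) \<in> ?N" "(\<sigma>1', \<sigma>2', \<zeta>') \<in> ?N" using h(1)[OF u] h(1)[OF u'] hu hu' by simp_all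
      have O: "Omega_11 \<sigma>1 \<sigma>2 \<zeta> = Omega_11 \<sigma>1' \<sigma>2' \<zeta>'" "Omega_12 \<sigma>1 \<sigma>2 \<zeta> = Omega_12 \<sigma>1' \<sigma>2' \<zeta>'"
        "Omega_22 \<sigma>1 \<sigma>2 \<zeta> = Omega_22 \<sigma>1' \<sigma>2' \<zeta>'"
        using heq unfolding hu hu' F_eps_eq_iff by auto
      \<comment> \<open>Two points within relative distance \<open>1 / 4\<close> of a common point have comparable heights.\<close>
      have close: "y / 2 \<le> Im b \<and> Im b \<le> 2 * Y"
        if "norm (w - a) \<le> 1 / 4 * Im a" "norm (w - b) \<le> 1 / 4 * Im b" "y < Im a" "Im a < Y" "0 < Im b" for w a b :: complex
        using that y(1) abs_Im_le_cmod[of "w - a"] abs_Im_le_cmod[of "w - b"] by (simp add: abs_le_iff)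
      have 1: "y / 2 \<le> Im \<sigma>1'" "Im \<sigma>1' \<le> 2 * Y"
        using close[OF est(1)[OF hN(1)] _ \<sigma>(1,2)] est(1)[OF hN(2)] N(3)[OF hN(2)] O(1) by auto
      have 2: "y / 2 \<le> Im \<sigma>2'" "Im \<sigma>2' \<le> 2 * Y"
        using close[OF est(2)[OF hN(1)] _ \<sigma>(3,4)] est(2)[OF hN(2)] N(4)[OF hN(2)] O(3) by auto
      have small_eps: "norm e \<le> M" if "norm e < \<eta> * sqrt (Im a * Im b)" "0 < Im a" "0 < Im b" "Im a \<le> 2 * Y" "Im b \<le> 2 * Y" for a b e :: complex
      proof -
        have "sqrt (Im a * Im b) \<le> sqrt ((2 * Y)\<^sup>2)"
          unfolding power2_eq_square using that by (intro real_sqrt_le_mono mult_mono) auto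
        also have "\<dots> = 2 * Y" unfolding real_sqrt_abs using y by simp
        finally have "\<eta> * sqrt (Im a * Im b) \<le> M / (2 * Y) * (2 * Y)"
          using \<eta> y M that by (intro mult_mono) auto
        also have "\<dots> = M" using y by simp
        finally show ?thesis using that(1) by simp
      qed
      have "norm \<zeta> \<le> M" using N[OF hN(1)] \<sigma> y by (intro small_eps[of \<zeta> \<sigma>1 \<sigma>2]) auto
      moreover have "norm \<zeta>' \<le> M" using N[OF hN(2)] 1 2 by (intro small_eps[of \<zeta>' \<sigma>1' \<sigma>2']) auto
      ultimately have "h u = h u'"
        using 1 2 \<sigma> y unfolding hu hu' by (intro inj_onD[OF M(2) heq[unfolded hu hu']]) auto
      then show "u = u'" using h(2)[OF u] h(2)[OF u'] by metis
    qed
  qed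
  ultimately show ?thesis
    using open_region G_act_image_region by (intro exI[of _ ?N]) (auto simp: bij_betw_def)
qed

end
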